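(* Let $X$ be a separable real Banach space, let $\eta$ be a centered, nondegenerate Gaussian measure on $X$, and let $H$ and $\mathscr{J}:H\to X$ be the associated Hilbert space and linear map (see context). Let $K\subset X^*$ be nonempty, convex and weak* compact, and let $G:K\times K\to\mathbb{R}$ be weak* continuous, such that $K\ni\nu\mapsto G(\mu,\nu)$ is convex for each $\mu\in K$. Suppose $G$ is monotone, i.e. $\langle\mu-\nu,x-y\rangle\ge 0$ whenever $\mu,\nu\in K$, $x\in\partial_\nu G(\mu,\mu)$ and $y\in\partial_\nu G(\nu,\nu)$. Let $$\mathcal{C}=\{\mu\in K:\mathscr{J}^{-1}(\partial_\nu G(\mu,\mu))\ne\emptyset\}$$ and suppose $\mu^0\in\mathcal{C}$. Then there is a unique absolutely continuous $\zeta:[0,\infty)\to H$ with $\zeta(t)\in\mathcal{C}$ for all $t\ge0$ that satisfies $$\begin{cases}\mathscr{J}\dot\zeta(t)+\partial_\nu G(\zeta(t),\zeta(t))\ni0 &\text{for a.e. }t\ge0,\\ \zeta(0)=\mu^0.\end{cases}$$ Furthermore, $\zeta$ is Lipschitz continuous and $$\frac1t\int_0^t\zeta(s)\,ds$$ converges weak* to an equilibrium of $G$ as $t\to\infty$.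
   Context: $X^*$ is the continuous dual of $X$ and $\langle\mu,x\rangle=\mu(x)$ for $\mu\in X^*$, $x\in X$. A centered, nondegenerate Gaussian measure on $X$ is a Borel probability measure $\eta$ on $X$ whose pushforward under every $\mu\in X^*\setminus\{0\}$ is a Gaussian measure on $\mathbb{R}$ with mean $0$ and positive variance. Such $\eta$ satisfies $\int_X\|x\|^2d\eta(x)<\infty$, so $X^*\subset L^2(X,\eta)$; two elements of $X^*$ that agree $\eta$-a.e. are equal. $H$ is the closure of $X^*$ in $L^2(X,\eta)$, with inner product $(\mu,\nu)=\int_X\mu(x)\nu(x)\,d\eta(x)$; an element of $H$ agreeing $\eta$-a.e. with an element of $X^*$ is identified with that element, so that $K\subset H$. The linear map $\mathscr{J}:H\to X$ is the Bochner integral $\mathscr{J}\xi=\int_X x\,\xi(x)\,d\eta(x)$. For $\mu\in K$, $$\partial_\nu G(\mu,\mu)=\{x\in X: G(\mu,\nu)\ge G(\mu,\mu)+\langle\nu-\mu,x\rangle\ \text{for all }\nu\in K\}.$$ The inclusion $\mathscr{J}\dot\zeta(t)+\partial_\nu G(\zeta(t),\zeta(t))\ni0$ means $-\mathscr{J}\dot\zeta(t)\in\partial_\nu G(\zeta(t),\zeta(t))$. $\mu\in K$ is an equilibrium for $G$ if $G(\mu,\mu)\le G(\mu,\nu)$ for all $\nu\in K$. *)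

theory Defs
  imports "HOL-Probability.Probability"
begin

text \<open>The dual of \<open>'a\<close> is \<open>'a \<Rightarrow>\<^sub>L real\<close>, with \<open>blinfun_apply \<mu> x\<close> for the pairing. For real-valued
  operators the strong operator topology is pointwise convergence on \<open>'a\<close>, i.e. the weak* topology.\<close>

abbreviation weak_star_topology :: "('a::real_normed_vector \<Rightarrow>\<^sub>L real) topology" where
  "weak_star_topology \<equiv> strong_operator_topology"

definition centered_nondegenerate_gaussian :: "'a::real_normed_vector measure \<Rightarrow> bool" where
  "centered_nondegenerate_gaussian \<eta> \<longleftrightarrow>
     prob_space \<eta> \<and> sets \<eta> = sets borel \<and>
     (\<forall>\<mu>::'a \<Rightarrow>\<^sub>L real. \<mu> \<noteq> 0 \<longrightarrow>
        (\<exists>\<sigma>>0. distr \<eta> borel (blinfun_apply \<mu>) = density lborel (\<lambda>r. ennreal (normal_density 0 \<sigma> r))))"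

text \<open>Elements of \<open>L\<^sup>2(\<eta>)\<close> are represented by square-integrable functions, two of them being the same
  element when they agree almost everywhere, equivalently when \<open>H_norm\<close> of their difference is 0.
  All notions below depend only on the almost-everywhere class. A functional \<open>\<mu>\<close> is represented by
  \<open>blinfun_apply \<mu>\<close>.\<close>

definition H_inner :: "'a measure \<Rightarrow> ('a \<Rightarrow> real) \<Rightarrow> ('a \<Rightarrow> real) \<Rightarrow> real" where
  "H_inner \<eta> f g = (\<integral>x. f x * g x \<partial>\<eta>)"

definition H_norm :: "'a measure \<Rightarrow> ('a \<Rightarrow> real) \<Rightarrow> real" where
  "H_norm \<eta> f = sqrt (H_inner \<eta> f f)"

definition gaussian_H :: "'a::real_normed_vector measure \<Rightarrow> ('a \<Rightarrow> real) set" where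
  "gaussian_H \<eta> =
     {\<xi> \<in> borel_measurable \<eta>. integrable \<eta> (\<lambda>x. (\<xi> x)\<^sup>2) \<and>
        (\<forall>\<epsilon>>0. \<exists>\<mu>::'a \<Rightarrow>\<^sub>L real. H_norm \<eta> (\<lambda>x. \<xi> x - blinfun_apply \<mu> x) < \<epsilon>)}"

definition gaussian_J :: "'a::{banach, second_countable_topology} measure \<Rightarrow> ('a \<Rightarrow> real) \<Rightarrow> 'a" where
  "gaussian_J \<eta> \<xi> = (\<integral>x. \<xi> x *\<^sub>R x \<partial>\<eta>)"

text \<open>Curves \<open>[0,\<infinity>) \<rightarrow> H\<close> are functions \<open>real \<Rightarrow> ('a \<Rightarrow> real)\<close> whose values at negative times are
  irrelevant. Absolute continuity on \<open>[0,\<infinity>)\<close> means absolute continuity on every \<open>[0,T]\<close>.\<close>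

definition H_absolutely_continuous :: "'a measure \<Rightarrow> (real \<Rightarrow> 'a \<Rightarrow> real) \<Rightarrow> bool" where
  "H_absolutely_continuous \<eta> \<zeta> \<longleftrightarrow>
     (\<forall>T>0. \<forall>\<epsilon>>0. \<exists>\<delta>>0. \<forall>(n::nat) a b.
        (\<forall>i<n. 0 \<le> a i \<and> a i \<le> b i \<and> b i \<le> T) \<longrightarrow>
        disjoint_family_on (\<lambda>i. {a i<..<b i}) {..<n} \<longrightarrow>
        (\<Sum>i<n. b i - a i) < \<delta> \<longrightarrow>
        (\<Sum>i<n. H_norm \<eta> (\<lambda>x. \<zeta> (b i) x - \<zeta> (a i) x)) < \<epsilon>)"

definition H_lipschitz :: "'a measure \<Rightarrow> (real \<Rightarrow> 'a \<Rightarrow> real) \<Rightarrow> bool" where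
  "H_lipschitz \<eta> \<zeta> \<longleftrightarrow>
     (\<exists>L. \<forall>s\<ge>0. \<forall>t\<ge>0. H_norm \<eta> (\<lambda>x. \<zeta> t x - \<zeta> s x) \<le> L * \<bar>t - s\<bar>)"

definition has_H_derivative ::
  "'a measure \<Rightarrow> (real \<Rightarrow> 'a \<Rightarrow> real) \<Rightarrow> ('a \<Rightarrow> real) \<Rightarrow> real \<Rightarrow> bool" where
  "has_H_derivative \<eta> \<zeta> \<xi> t \<longleftrightarrow>
     ((\<lambda>s. H_norm \<eta> (\<lambda>x. (\<zeta> s x - \<zeta> t x) / (s - t) - \<xi> x)) \<longlongrightarrow> 0) (at t within {0..})"

text \<open>The integral of an \<open>H\<close>-valued curve over \<open>[a,b]\<close>: this is \<open>has_integral\<close> with convergence of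
  the Riemann sums taken in \<open>H\<close>. For a continuous curve it is the Riemann and the Bochner integral.\<close>

definition has_H_integral ::
  "'a measure \<Rightarrow> (real \<Rightarrow> 'a \<Rightarrow> real) \<Rightarrow> ('a \<Rightarrow> real) \<Rightarrow> real \<Rightarrow> real \<Rightarrow> bool" where
  "has_H_integral \<eta> \<zeta> I a b \<longleftrightarrow>
     ((\<lambda>p. H_norm \<eta> (\<lambda>x. (\<Sum>(s, k)\<in>p. measure lborel k * \<zeta> s x) - I x)) \<longlongrightarrow> 0)
       (division_filter (cbox a b))"

text \<open>\<open>diag_subdiff K G \<mu>\<close> is \<open>\<partial>\<^sub>\<nu>G(\<mu>,\<mu>)\<close>.\<close>

definition diag_subdiff ::
  "('a::real_normed_vector \<Rightarrow>\<^sub>L real) set \<Rightarrow> (('a \<Rightarrow>\<^sub>L real) \<Rightarrow> ('a \<Rightarrow>\<^sub>L real) \<Rightarrow> real) \<Rightarrow>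
   ('a \<Rightarrow>\<^sub>L real) \<Rightarrow> 'a set" where
  "diag_subdiff K G \<mu> = {x. \<forall>\<nu>\<in>K. G \<mu> \<nu> \<ge> G \<mu> \<mu> + blinfun_apply (\<nu> - \<mu>) x}"

definition monotone_game ::
  "('a::real_normed_vector \<Rightarrow>\<^sub>L real) set \<Rightarrow> (('a \<Rightarrow>\<^sub>L real) \<Rightarrow> ('a \<Rightarrow>\<^sub>L real) \<Rightarrow> real) \<Rightarrow> bool" where
  "monotone_game K G \<longleftrightarrow>
     (\<forall>\<mu>\<in>K. \<forall>\<nu>\<in>K. \<forall>x\<in>diag_subdiff K G \<mu>. \<forall>y\<in>diag_subdiff K G \<nu>.
        blinfun_apply (\<mu> - \<nu>) (x - y) \<ge> 0)"

definition is_equilibrium ::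
  "('a::real_normed_vector \<Rightarrow>\<^sub>L real) set \<Rightarrow> (('a \<Rightarrow>\<^sub>L real) \<Rightarrow> ('a \<Rightarrow>\<^sub>L real) \<Rightarrow> real) \<Rightarrow>
   ('a \<Rightarrow>\<^sub>L real) \<Rightarrow> bool" where
  "is_equilibrium K G \<mu> \<longleftrightarrow> \<mu> \<in> K \<and> (\<forall>\<nu>\<in>K. G \<mu> \<mu> \<le> G \<mu> \<nu>)"

definition flow_domain ::
  "'a::{banach, second_countable_topology} measure \<Rightarrow> ('a \<Rightarrow>\<^sub>L real) set \<Rightarrow>
   (('a \<Rightarrow>\<^sub>L real) \<Rightarrow> ('a \<Rightarrow>\<^sub>L real) \<Rightarrow> real) \<Rightarrow> ('a \<Rightarrow>\<^sub>L real) set" where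
  "flow_domain \<eta> K G =
     {\<mu> \<in> K. {\<xi> \<in> gaussian_H \<eta>. gaussian_J \<eta> \<xi> \<in> diag_subdiff K G \<mu>} \<noteq> {}}"

text \<open>Solution curves take values in \<open>flow_domain \<eta> K G \<subseteq> K\<close>, so they are given as curves of
  functionals; continuity and differentiation are nevertheless those of \<open>H\<close>.\<close>

definition is_flow_solution ::
  "'a::{banach, second_countable_topology} measure \<Rightarrow> ('a \<Rightarrow>\<^sub>L real) set \<Rightarrow>
   (('a \<Rightarrow>\<^sub>L real) \<Rightarrow> ('a \<Rightarrow>\<^sub>L real) \<Rightarrow> real) \<Rightarrow> ('a \<Rightarrow>\<^sub>L real) \<Rightarrow> (real \<Rightarrow> 'a \<Rightarrow>\<^sub>L real) \<Rightarrow> bool" where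
  "is_flow_solution \<eta> K G \<mu>0 \<zeta> \<longleftrightarrow>
     H_absolutely_continuous \<eta> (\<lambda>t. blinfun_apply (\<zeta> t)) \<and>
     (\<forall>t\<ge>0. \<zeta> t \<in> flow_domain \<eta> K G) \<and>
     (AE t in lborel. t \<ge> 0 \<longrightarrow>
        (\<exists>\<xi>\<in>gaussian_H \<eta>. has_H_derivative \<eta> (\<lambda>s. blinfun_apply (\<zeta> s)) \<xi> t \<and>
           - gaussian_J \<eta> \<xi> \<in> diag_subdiff K G (\<zeta> t))) \<and>
     \<zeta> 0 = \<mu>0"

end

(*
  In the inner product of L^2(eta) the relation A = {(mu, y). J y is a diagonal subgradient at mu} is
  monotone, because <mu, J y> = (mu, y). Its resolvents exist on K by Ky Fan's inequality applied to
  w |-> G x w - (w, (nu - x) / l), and they stay in X*, so apart from one limit everything happens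
  in the pre-Hilbert space X*. Implicit Euler curves live in the compact product of copies of K; a
  cluster point u inherits contraction and energy inequalities. They show that difference quotients
  of u are close to the Yosida approximations Y l (u t) wherever the nonincreasing function
  sup_l |Y l (u t)| is continuous, hence off a countable set, and the Yosida approximations converge
  in L^2 to the derivative. Weak* limits of the averages are zeros of A by the energy inequality;
  there is only one because |u(t) - e| is nonincreasing for every zero e.
  Integrability of the squared norm (Fernique) makes J a Bochner integral and the L^2 norm weak*
  continuous on K; it needs the rotation invariance of eta x eta, obtained from characteristic
  functionals by Stone-Weierstrass.
*)

theory Submission
  imports Defs
begin

section \<open>Monotone operators with resolvents and the implicit Euler scheme\<close>

text \<open>The obstacle: the evolution lives in \<open>H\<close>, but \<open>K\<close>,
  \<open>G\<close> and the resolvents live in the dual space, which need not be complete for the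
  \<open>L^2\<close> norm. On \<open>K\<close>, however, weak* and \<open>L^2\<close> topology
  coincide, so compactness of \<open>K\<close> replaces completeness: the Euler curves need no
  quantitative Cauchy estimate, only a cluster point. An uncountable product gives no convergent
  subsequence, but every inequality that must survive involves at most two times, and for two times
  an approximating sequence can be extracted. A cluster point is thus known through inequalities
  only. They yield a derivative when the energy inequality is tested at the resolvent of a point of
  the curve: the pairing of the negated difference quotient with the Yosida approximation is then at
  least the squared norm of the latter, up to an error of order h / l, while the speed bounds the
  quotient from above. A vector that is hardly longer than another one and has such a pairing with
  it is close to it. For right quotients all quantities belong to the same time; for left ones they
  do not, which is where continuity of the speed enters.\<close>

lemma right_dini_nonincreasing:
  fixes f :: "real \<Rightarrow> real"
  assumes "a \<le> b" and cont: "continuous_on {a..b} f"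
    and step: "\<And>t e. a \<le> t \<Longrightarrow> t < b \<Longrightarrow> e > 0 \<Longrightarrow> \<exists>d>0. \<forall>h. 0 < h \<and> h < d \<longrightarrow> f (t + h) \<le> f t + e * h"
  shows "f b \<le> f a"
proof -
  have "f b \<le> f a + e * (b - a)" if "e > 0" for e
  proof -
    \<comment> \<open>The last point of \<open>T\<close> must be \<open>b\<close>: at an earlier one
      the hypothesis, with the same slope \<open>e\<close>, would produce a later element.\<close>
    define T where "T = {t \<in> {a..b}. f t - e * (t - a) \<le> f a}"
    have "closed T"
      unfolding T_def by (intro continuous_on_closed_Collect_le continuous_intros cont closed_atLeastAtMost)
    moreover have "bounded T"
      by (rule bounded_subset[of "{a..b}"]) (auto simp: T_def)
    ultimately have "compact T"
      by (simp add: compact_eq_bounded_closed)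
    moreover have "a \<in> T"
      using assms(1) by (auto simp: T_def)
    ultimately obtain c where c: "c \<in> T" "\<And>t. t \<in> T \<Longrightarrow> t \<le> c"
      using compact_attains_sup[of T] by auto
    have "c = b"
    proof (rule ccontr)
      assume "c \<noteq> b"
      then have cb: "a \<le> c" "c < b"
        using c(1) by (auto simp: T_def)
      obtain d where d: "d > 0" "\<And>h. 0 < h \<Longrightarrow> h < d \<Longrightarrow> f (c + h) \<le> f c + e * h"
        using step[OF cb \<open>e > 0\<close>] by auto
      define h where "h = min (d / 2) (b - c)"
      have h: "0 < h" "h < d" "c + h \<le> b"
        using d(1) cb by (auto simp: h_def)
      have "c + h \<in> T"
        using d(2)[OF h(1,2)] c(1) h cb by (auto simp: T_def algebra_simps)
      then show False
        using c(2) h(1) by fastforce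
    qed
    then show ?thesis
      using c(1) by (auto simp: T_def)
  qed
  note * = this
  show ?thesis
  proof (rule field_le_epsilon)
    fix e :: real assume "e > 0"
    have "f b \<le> f a + e / (b - a + 1) * (b - a)"
      using \<open>e > 0\<close> assms(1) by (intro *) auto
    also have "e / (b - a + 1) * (b - a) \<le> e"
      using \<open>e > 0\<close> assms(1) by (simp add: field_simps)
    finally show "f b \<le> f a + e" by simp
  qed
qed

text \<open>A locale rather than a type class, because the dual space already carries its operator
  norm; here it gets the weaker norm of \<open>L^2\<close>, for which it need not be
  complete.\<close>

locale inner_form =
  fixes B :: "'v::real_vector \<Rightarrow> 'v \<Rightarrow> real"
  assumes B_add: "B (x + y) z = B x z + B y z"
    and B_scale: "B (c *\<^sub>R x) z = c * B x z"
    and B_commute: "B x y = B y x"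
    and B_nonneg: "B x x \<ge> 0"
    and B_definite: "B x x = 0 \<Longrightarrow> x = 0"
begin

definition nrm :: "'v \<Rightarrow> real" where "nrm x = sqrt (B x x)"

lemma B_zero [simp]: "B 0 x = 0" "B x 0 = 0"
  using B_scale[of 0 0 x] B_commute[of x 0] by auto

lemma B_minus [simp]: "B (- x) y = - B x y" "B x (- y) = - B x y"
  using B_scale[of "-1" x y] B_scale[of "-1" y x] B_commute[of x] by auto

lemma B_diff: "B (x - y) z = B x z - B y z"
  using B_add[of x "- y" z] by simp

lemma B_add2: "B z (x + y) = B z x + B z y"
  using B_add B_commute by metis

lemma B_diff2: "B z (x - y) = B z x - B z y"
  using B_diff B_commute by metis

lemma B_scale2: "B z (c *\<^sub>R x) = c * B z x"
  using B_scale B_commute by metis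

lemmas bilin = B_add B_add2 B_diff B_diff2 B_scale B_scale2

lemma nrm_nonneg [simp]: "nrm x \<ge> 0"
  by (simp add: nrm_def B_nonneg)

lemma nrm_sq: "(nrm x)\<^sup>2 = B x x"
  by (simp add: nrm_def B_nonneg)

lemma nrm_eq_0 [simp]: "nrm x = 0 \<longleftrightarrow> x = 0"
  using B_definite by (auto simp: nrm_def)

lemma nrm_zero [simp]: "nrm 0 = 0"
  by simp

lemma nrm_scale: "nrm (c *\<^sub>R x) = \<bar>c\<bar> * nrm x"
  by (simp add: nrm_def bilin real_sqrt_mult flip: mult.assoc power2_eq_square)

lemma nrm_minus [simp]: "nrm (- x) = nrm x"
  by (simp add: nrm_def)

lemma nrm_minus_commute: "nrm (x - y) = nrm (y - x)"
  using nrm_minus[of "x - y"] by simp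

lemma B_le: "B x y \<le> nrm x * nrm y"
proof (cases "x = 0 \<or> y = 0")
  case False
  then have p: "nrm x > 0" "nrm y > 0"
    by (simp_all add: less_le)
  have "0 \<le> B (nrm y *\<^sub>R x - nrm x *\<^sub>R y) (nrm y *\<^sub>R x - nrm x *\<^sub>R y)"
    by (rule B_nonneg)
  also have "\<dots> = 2 * (nrm x * nrm y) * (nrm x * nrm y - B x y)"
    using nrm_sq[of x] nrm_sq[of y] B_commute[of y x]
    by (simp add: bilin algebra_simps power2_eq_square)
  finally have "0 \<le> nrm x * nrm y - B x y"
    using p mult_pos_pos[OF p] by (simp only: zero_le_mult_iff) auto
  then show ?thesis by simp
qed auto

lemma abs_B_le: "\<bar>B x y\<bar> \<le> nrm x * nrm y"
  using B_le[of x y] B_le[of "- x" y] by simp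

lemma nrm_triangle: "nrm (x + y) \<le> nrm x + nrm y"
proof (rule power2_le_imp_le)
  show "(nrm (x + y))\<^sup>2 \<le> (nrm x + nrm y)\<^sup>2"
    using B_le[of x y] B_commute[of y x] by (simp add: nrm_sq bilin power2_sum)
qed simp

lemma nrm_triangle_diff: "nrm (x - y) \<le> nrm x + nrm y"
  using nrm_triangle[of x "- y"] by simp

lemma nrm_diff_triangle: "nrm (x - z) \<le> nrm (x - y) + nrm (y - z)"
  using nrm_triangle[of "x - y" "y - z"] by simp

lemma nrm_diff_le: "\<bar>nrm x - nrm y\<bar> \<le> nrm (x - y)"
  using nrm_triangle[of "x - y" y] nrm_triangle[of "y - x" x] nrm_minus_commute[of x y] by simp

text \<open>The usual exit from a monotonicity inequality: Cauchy-Schwarz on the right, then one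
  factor \<open>nrm x\<close> cancels.\<close>

lemma nrm_le_if_B_le: "B x x \<le> B x y \<Longrightarrow> nrm x \<le> nrm y"
  using B_le[of x y] nrm_sq[of x] mult_le_cancel_left_pos[of "nrm x" "nrm x" "nrm y"]
  by (cases "x = 0") (auto simp: power2_eq_square less_le)

lemma tendsto_B:
  assumes "((\<lambda>n. nrm (f n - x)) \<longlongrightarrow> 0) F"
  shows "((\<lambda>n. B y (f n)) \<longlongrightarrow> B y x) F"
proof (rule LIM_zero_cancel, rule Lim_null_comparison)
  show "\<forall>\<^sub>F n in F. norm (B y (f n) - B y x) \<le> nrm y * nrm (f n - x)"
    using abs_B_le[of y] by (simp flip: B_diff2)
  show "((\<lambda>n. nrm y * nrm (f n - x)) \<longlongrightarrow> 0) F"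
    using tendsto_mult_right_zero[OF assms] .
qed

lemma tendsto_nrm:
  assumes "((\<lambda>n. nrm (f n - x)) \<longlongrightarrow> 0) F"
  shows "((\<lambda>n. nrm (f n)) \<longlongrightarrow> nrm x) F"
proof (rule LIM_zero_cancel, rule Lim_null_comparison)
  show "\<forall>\<^sub>F n in F. norm (nrm (f n) - nrm x) \<le> nrm (f n - x)"
    using nrm_diff_le by simp
qed (rule assms)

end

section \<open>Resolvents and Yosida approximations of a monotone relation\<close>

locale monotone_resolvent = inner_form B
  for B :: "'v::real_vector \<Rightarrow> 'v \<Rightarrow> real" +
  fixes K :: "'v set" and A :: "('v \<times> 'v) set" and R :: "real \<Rightarrow> 'v \<Rightarrow> 'v"
  assumes R_in: "l > 0 \<Longrightarrow> x \<in> K \<Longrightarrow> R l x \<in> K"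
    and R_A: "l > 0 \<Longrightarrow> x \<in> K \<Longrightarrow> (R l x, (1 / l) *\<^sub>R (x - R l x)) \<in> A"
    and A_mono: "(x, y) \<in> A \<Longrightarrow> (x', y') \<in> A \<Longrightarrow> B (x - x') (y - y') \<ge> 0"
begin

text \<open>The Yosida approximation \<open>A\<^sub>l\<close>.\<close>

definition Y :: "real \<Rightarrow> 'v \<Rightarrow> 'v" where "Y l x = (1 / l) *\<^sub>R (x - R l x)"

lemma R_eq: "l \<noteq> 0 \<Longrightarrow> R l x = x - l *\<^sub>R Y l x"
  by (simp add: Y_def)

lemma Y_A: "l > 0 \<Longrightarrow> x \<in> K \<Longrightarrow> (R l x, Y l x) \<in> A"
  using R_A by (simp add: Y_def)

text \<open>Monotonicity is tested on \<open>(x, y)\<close> and \<open>(R l x, Y l x)\<close>, whose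
  first components differ by \<open>l *\<^sub>R Y l x\<close>. This is the source of the a priori
  bounds for the Euler scheme.\<close>

lemma Y_le:
  assumes "l > 0" "x \<in> K" "(x, y) \<in> A"
  shows "nrm (Y l x) \<le> nrm y"
proof (rule nrm_le_if_B_le)
  have "0 \<le> B (x - R l x) (y - Y l x)"
    using assms Y_A by (intro A_mono)
  also have "\<dots> = l * (B (Y l x) y - B (Y l x) (Y l x))"
    using assms(1) by (simp add: R_eq bilin algebra_simps)
  finally show "B (Y l x) (Y l x) \<le> B (Y l x) y"
    using assms(1) by (simp add: zero_le_mult_iff)
qed

lemma R_nonexpansive:
  assumes "l > 0" "x \<in> K" "x' \<in> K"
  shows "nrm (R l x - R l x') \<le> nrm (x - x')"
proof (rule nrm_le_if_B_le)
  have "0 \<le> B (R l x - R l x') (Y l x - Y l x')"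
    using assms Y_A by (intro A_mono)
  also have "\<dots> = (1 / l) * (B (R l x - R l x') (x - x') - B (R l x - R l x') (R l x - R l x'))"
    by (simp add: Y_def bilin algebra_simps)
  finally show "B (R l x - R l x') (R l x - R l x') \<le> B (R l x - R l x') (x - x')"
    using assms(1) by (simp add: zero_le_divide_iff)
qed

lemma Y_lipschitz:
  assumes "l > 0" "x \<in> K" "x' \<in> K"
  shows "nrm (Y l x - Y l x') \<le> (2 / l) * nrm (x - x')"
proof -
  have "Y l x - Y l x' = (1 / l) *\<^sub>R ((x - x') - (R l x - R l x'))"
    by (simp add: Y_def algebra_simps)
  then have "nrm (Y l x - Y l x') = (1 / l) * nrm ((x - x') - (R l x - R l x'))"
    using assms(1) by (simp add: nrm_scale)
  also have "\<dots> \<le> (1 / l) * (2 * nrm (x - x'))"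
    using assms R_nonexpansive[OF assms] nrm_triangle_diff[of "x - x'" "R l x - R l x'"]
    by (intro mult_left_mono) auto
  finally show ?thesis by simp
qed

lemma Y_mono:
  assumes "l > 0" "x \<in> K" "x' \<in> K"
  shows "0 \<le> B (x - x') (Y l x - Y l x')"
proof -
  have "0 \<le> B (R l x - R l x') (Y l x - Y l x')"
    using assms Y_A by (intro A_mono)
  also have "\<dots> = B (x - x') (Y l x - Y l x') - l * B (Y l x - Y l x') (Y l x - Y l x')"
    using assms(1) by (simp add: R_eq bilin algebra_simps)
  also have "\<dots> \<le> B (x - x') (Y l x - Y l x')"
    using assms(1) B_nonneg by simp
  finally show ?thesis .
qed

text \<open>Monotonicity is tested on the two resolvents of the same point. It makes the pairing of
  \<open>Y l x\<close> with \<open>Y l x - Y l' x\<close> nonpositive, so the norm grows as the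
  parameter decreases, and the growth of its square bounds the squared distance.\<close>

lemma Y_cauchy:
  assumes "0 < l'" "l' \<le> l" "x \<in> K"
  shows "(nrm (Y l x - Y l' x))\<^sup>2 \<le> (nrm (Y l' x))\<^sup>2 - (nrm (Y l x))\<^sup>2"
    and "nrm (Y l x) \<le> nrm (Y l' x)"
proof -
  let ?a = "Y l x" and ?b = "Y l' x"
  have "0 \<le> B (R l x - R l' x) (?a - ?b)"
    using assms Y_A by (intro A_mono) auto
  also have "R l x - R l' x = - (l' *\<^sub>R (?a - ?b) + (l - l') *\<^sub>R ?a)"
    using assms by (simp add: R_eq algebra_simps)
  also have "B \<dots> (?a - ?b) = - (l' * B (?a - ?b) (?a - ?b)) - (l - l') * B ?a (?a - ?b)"
    by (simp only: B_minus bilin) (simp add: algebra_simps)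
  finally have *: "(l - l') * B ?a (?a - ?b) \<le> - l' * B (?a - ?b) (?a - ?b)"
    by simp
  also have "\<dots> \<le> 0"
    using assms B_nonneg by (simp add: mult_nonneg_nonneg)
  finally have **: "(l - l') * B ?a (?a - ?b) \<le> 0" .
  have "B ?a (?a - ?b) \<le> 0"
  proof (cases "l = l'")
    case False
    then show ?thesis
      using ** assms by (simp add: mult_le_0_iff)
  qed simp
  then show "(nrm (?a - ?b))\<^sup>2 \<le> (nrm ?b)\<^sup>2 - (nrm ?a)\<^sup>2" "nrm ?a \<le> nrm ?b"
    using B_commute[of ?b ?a] by (auto simp: nrm_sq bilin intro!: nrm_le_if_B_le)
qed

lemma Y_near_Sup:
  assumes x: "x \<in> K" and M: "\<And>l. l > 0 \<Longrightarrow> nrm (Y l x) \<le> M" and "e > 0"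
  shows "\<exists>l0>0. \<forall>l. 0 < l \<and> l \<le> l0 \<longrightarrow> (SUP l\<in>{0<..}. nrm (Y l x))\<^sup>2 - (nrm (Y l x))\<^sup>2 < e"
proof -
  define S where "S = (SUP l\<in>{0<..}. nrm (Y l x))"
  have M0: "M \<ge> 0"
    using M[of 1] nrm_nonneg[of "Y 1 x"] by linarith
  \<comment> \<open>A gap \<open>d\<close> in the norms costs at most \<open>d * (2 * M)\<close> in
    their squares; the added 1 covers \<open>M = 0\<close>.\<close>
  define d where "d = e / (2 * M + 1)"
  have d: "d > 0"
    using \<open>e > 0\<close> M0 by (simp add: d_def)
  have bdd: "bdd_above ((\<lambda>l. nrm (Y l x)) ` {0<..})"
    using M by (auto intro!: bdd_aboveI2[where M = M])
  have SM: "0 \<le> S" "S \<le> M"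
    using cSUP_upper[OF _ bdd, of 1] nrm_nonneg[of "Y 1 x"] M
    by (auto simp: S_def intro!: cSUP_least order_trans[OF nrm_nonneg[of "Y 1 x"]])
  have "\<exists>l\<in>{0<..}. S - d < nrm (Y l x)"
    unfolding S_def using bdd d S_def by (subst less_cSUP_iff[symmetric]) auto
  then obtain l0 where l0: "l0 > 0" "S - d < nrm (Y l0 x)"
    by auto
  have "S\<^sup>2 - (nrm (Y l x))\<^sup>2 < e" if l: "0 < l" "l \<le> l0" for l
  proof -
    have a: "S - nrm (Y l x) \<le> d"
      using Y_cauchy(2)[OF l x] l0 by linarith
    have "S\<^sup>2 - (nrm (Y l x))\<^sup>2 = (S - nrm (Y l x)) * (S + nrm (Y l x))"
      by (simp add: power2_eq_square algebra_simps)
    also have "\<dots> \<le> d * (2 * M)"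
      using a SM M[OF l(1)] d by (intro mult_mono) auto
    also have "\<dots> < e"
      using \<open>e > 0\<close> M0 by (simp add: d_def field_simps)
    finally show ?thesis .
  qed
  then show ?thesis
    using l0(1) by (auto simp: S_def)
qed

text \<open>The norms are bounded and grow as \<open>l\<close> decreases to 0, so they are nearly at
  their supremum for small \<open>l\<close>; \<open>Y_cauchy\<close> turns this into a Cauchy
  property. A limit need not exist in \<open>'v\<close>, so none is mentioned.\<close>

lemma Y_cauchy_at_0:
  assumes x: "x \<in> K" and M: "\<And>l. l > 0 \<Longrightarrow> nrm (Y l x) \<le> M" and "e > 0"
  shows "\<exists>l0>0. \<forall>l l'. 0 < l' \<and> l' \<le> l \<and> l \<le> l0 \<longrightarrow> nrm (Y l x - Y l' x) \<le> e"
proof -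
  define S where "S = (SUP l\<in>{0<..}. nrm (Y l x))"
  have bdd: "bdd_above ((\<lambda>l. nrm (Y l x)) ` {0<..})"
    using M by (auto intro!: bdd_aboveI2[where M = M])
  obtain l0 where l0: "l0 > 0" "\<And>l. 0 < l \<Longrightarrow> l \<le> l0 \<Longrightarrow> S\<^sup>2 - (nrm (Y l x))\<^sup>2 < e\<^sup>2"
    using Y_near_Sup[OF x M, of "e\<^sup>2"] \<open>e > 0\<close> unfolding S_def by auto
  have "nrm (Y l x - Y l' x) \<le> e" if l: "0 < l'" "l' \<le> l" "l \<le> l0" for l l'
  proof (rule power2_le_imp_le)
    have "nrm (Y l' x) \<le> S"
      unfolding S_def using l bdd by (intro cSUP_upper) auto
    then have "(nrm (Y l' x))\<^sup>2 \<le> S\<^sup>2"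
      by (intro power_mono) auto
    then show "(nrm (Y l x - Y l' x))\<^sup>2 \<le> e\<^sup>2"
      using Y_cauchy(1)[OF l(1,2) x] l0(2)[of l] l by linarith
  qed (use \<open>e > 0\<close> in simp)
  then show ?thesis
    using l0(1) by blast
qed

section \<open>The implicit Euler scheme\<close>

primrec euler :: "real \<Rightarrow> 'v \<Rightarrow> nat \<Rightarrow> 'v" where
  "euler l x 0 = x"
| "euler l x (Suc k) = R l (euler l x k)"

lemma euler_in: "l > 0 \<Longrightarrow> x \<in> K \<Longrightarrow> euler l x k \<in> K"
  by (induction k) (auto intro: R_in)

lemma euler_A: "l > 0 \<Longrightarrow> x \<in> K \<Longrightarrow> (euler l x (Suc k), Y l (euler l x k)) \<in> A"
  using Y_A euler_in by simp

lemma euler_Suc: "l > 0 \<Longrightarrow> euler l x (Suc k) = euler l x k - l *\<^sub>R Y l (euler l x k)"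
  by (simp add: R_eq)

declare euler.simps(2) [simp del]

context
  fixes x M l
  assumes x: "x \<in> K" and M: "\<And>l. l > 0 \<Longrightarrow> nrm (Y l x) \<le> M" and l: "l > (0::real)"
begin

text \<open>The velocity \<open>Y l\<close> at step \<open>k\<close> lies in \<open>A\<close> at
  step \<open>k + 1\<close>, so \<open>Y_le\<close> there makes the velocities nonincreasing in norm
  along the scheme.\<close>

lemma euler_Y: "nrm (Y l (euler l x k)) \<le> M"
proof (induction k)
  case (Suc k)
  have "nrm (Y l (euler l x (Suc k))) \<le> nrm (Y l (euler l x k))"
    using euler_A euler_in x l by (intro Y_le)
  then show ?case
    using Suc by simp
qed (use M l in auto)

lemma euler_Y':
  assumes "l' > 0"
  shows "nrm (Y l' (euler l x k)) \<le> M"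
proof (cases k)
  case (Suc j)
  have "nrm (Y l' (euler l x (Suc j))) \<le> nrm (Y l (euler l x j))"
    using euler_A euler_in x l assms by (intro Y_le)
  then show ?thesis
    using Suc euler_Y order_trans by blast
qed (use M assms in auto)

lemma euler_lipschitz: "nrm (euler l x (k + n) - euler l x k) \<le> M * (l * n)"
proof (induction n)
  case (Suc n)
  have eq: "euler l x (k + Suc n) - euler l x k
      = (euler l x (k + n) - euler l x k) - l *\<^sub>R Y l (euler l x (k + n))"
    using euler_Suc[OF l] by simp
  have "nrm (euler l x (k + Suc n) - euler l x k)
      \<le> nrm (euler l x (k + n) - euler l x k) + l * nrm (Y l (euler l x (k + n)))"
    unfolding eq using nrm_triangle_diff[of "euler l x (k + n) - euler l x k" "l *\<^sub>R Y l (euler l x (k + n))"] l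
    by (simp add: nrm_scale)
  also have "\<dots> \<le> M * (l * n) + l * M"
    using Suc euler_Y l by (intro add_mono mult_left_mono) auto
  finally show ?case
    by (simp add: algebra_simps)
qed simp

text \<open>For consecutive Euler points \<open>u\<close> and \<open>v\<close>, monotonicity against
  \<open>(z, y)\<close> reads
  \<open>B (v - z) (v - z) \<le> B (v - z) (u - z - l *\<^sub>R y)\<close>. For \<open>y = 0\<close>
  the distances to a zero of \<open>A\<close> do not increase.\<close>

lemma euler_contract:
  assumes "(z, y) \<in> A"
  shows "nrm (euler l x (k + n) - z) \<le> nrm (euler l x k - z) + (l * n) * nrm y"
proof (induction n)
  case (Suc n)
  let ?u = "euler l x (k + n)" and ?v = "euler l x (Suc (k + n))"
  have "0 \<le> B (?v - z) (Y l ?u - y)"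
    using euler_A x l assms by (intro A_mono)
  then have "0 \<le> l * B (?v - z) (Y l ?u - y)"
    using l by simp
  also have "\<dots> = B (?v - z) (l *\<^sub>R Y l ?u - l *\<^sub>R y)"
    by (simp add: bilin algebra_simps)
  also have "l *\<^sub>R Y l ?u - l *\<^sub>R y = (?u - z - l *\<^sub>R y) - (?v - z)"
    by (simp add: euler_Suc[OF l])
  finally have "nrm (?v - z) \<le> nrm (?u - z - l *\<^sub>R y)"
    by (intro nrm_le_if_B_le) (simp add: B_diff2)
  also have "\<dots> \<le> nrm (?u - z) + l * nrm y"
    using nrm_triangle_diff[of "?u - z" "l *\<^sub>R y"] l by (simp add: nrm_scale)
  finally show ?case
    using Suc by (simp add: algebra_simps)
qed simp

text \<open>Discrete form of the inequality d/dt |u - z|^2 / 2 <= (y, z - u) that characterizes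
  integral solutions. The position on the right is frozen at step \<open>k\<close>; the Lipschitz
  bound pays for this with the last term.\<close>

lemma euler_energy:
  assumes "(z, y) \<in> A"
  shows "(nrm (euler l x (k + n) - z))\<^sup>2 / 2 - (nrm (euler l x k - z))\<^sup>2 / 2
    \<le> (l * n) * (B y (z - euler l x k) + nrm y * (M * (l * n)))"
proof -
  \<comment> \<open>The bracket keeps the final \<open>n\<close> while \<open>j\<close> runs, so
    that every step contributes the same amount.\<close>
  have "(nrm (euler l x (k + j) - z))\<^sup>2 / 2 - (nrm (euler l x k - z))\<^sup>2 / 2
    \<le> (l * j) * (B y (z - euler l x k) + nrm y * (M * (l * n)))" if "j \<le> n" for j
    using that
  proof (induction j)
    case (Suc j)
    let ?u = "euler l x (k + j)" and ?v = "euler l x (Suc (k + j))"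
    have "0 \<le> l * B (?v - z) (Y l ?u - y)"
      using A_mono[OF euler_A[OF l x] assms] l by simp
    also have "\<dots> = B (?v - z) (?u - ?v) - l * B (?v - z) y"
      by (simp add: euler_Suc[OF l] bilin algebra_simps)
    finally have 1: "B (?v - z) (?v - ?u) \<le> l * B y (z - ?v)"
      using B_commute[of y] by (simp add: bilin algebra_simps)
    have "0 \<le> B (?v - ?u) (?v - ?u)"
      by (rule B_nonneg)
    then have "(nrm (?v - z))\<^sup>2 / 2 - (nrm (?u - z))\<^sup>2 / 2 \<le> B (?v - z) (?v - ?u)"
      using B_commute[of ?u ?v] B_commute[of z ?v] B_commute[of z ?u]
      by (simp add: nrm_sq bilin field_simps)
    also note 1
    also have "B y (z - ?v) \<le> B y (z - euler l x k) + nrm y * (M * (l * n))"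
    proof -
      have "B y (euler l x k - ?v) \<le> nrm y * nrm (?v - euler l x k)"
        using B_le[of y "euler l x k - ?v"] nrm_minus_commute by metis
      also have "nrm (?v - euler l x k) \<le> M * (l * Suc j)"
        using euler_lipschitz[of k "Suc j"] by simp
      also have "\<dots> \<le> M * (l * n)"
        using Suc.prems l order_trans[OF nrm_nonneg M[OF l]]
        by (intro mult_left_mono) auto
      finally show ?thesis
        by (simp add: bilin mult_left_mono)
    qed
    finally have "(nrm (?v - z))\<^sup>2 / 2 - (nrm (?u - z))\<^sup>2 / 2
        \<le> l * (B y (z - euler l x k) + nrm y * (M * (l * n)))"
      using l by simp
    then show ?case
      using Suc by (simp add: algebra_simps)
  qed simp
  then show ?thesis by blast
qed

end

definition euler_curve :: "'v \<Rightarrow> nat \<Rightarrow> real \<Rightarrow> 'v" where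
  "euler_curve x n t = euler (1 / Suc n) x (nat \<lfloor>t * real (Suc n)\<rfloor>)"

lemma euler_curve_in: "x \<in> K \<Longrightarrow> euler_curve x n t \<in> K"
  by (simp add: euler_curve_def euler_in)

end

text \<open>These are the properties of Euler curves that survive limits at two fixed times.
  \<open>u_energy\<close> stands in for the differential inclusion as long as nothing is known about
  differentiability.\<close>

locale evolution = monotone_resolvent B K A R
  for B :: "'v::real_vector \<Rightarrow> 'v \<Rightarrow> real" and K A R +
  fixes u :: "real \<Rightarrow> 'v" and M :: real
  assumes u_in: "t \<ge> 0 \<Longrightarrow> u t \<in> K"
    and u_lipschitz': "0 \<le> s \<Longrightarrow> s \<le> t \<Longrightarrow> nrm (u t - u s) \<le> M * (t - s)"
    and Y_u_le: "t \<ge> 0 \<Longrightarrow> l > 0 \<Longrightarrow> nrm (Y l (u t)) \<le> M"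
    and u_contract: "(z, y) \<in> A \<Longrightarrow> 0 \<le> s \<Longrightarrow> s \<le> t \<Longrightarrow> nrm (u t - z) \<le> nrm (u s - z) + (t - s) * nrm y"
    and u_energy: "(z, y) \<in> A \<Longrightarrow> 0 \<le> s \<Longrightarrow> s \<le> t \<Longrightarrow>
      (nrm (u t - z))\<^sup>2 / 2 - (nrm (u s - z))\<^sup>2 / 2 \<le> (t - s) * (B y (z - u s) + nrm y * (M * (t - s)))"

context monotone_resolvent
begin

text \<open>The approximating index in \<open>cluster\<close> may depend on the pair of times. This
  is enough because each property required by \<open>evolution\<close> compares at most two times,
  and all its terms are continuous in \<open>nrm\<close>.\<close>

lemma evolution_from_euler:
  assumes x: "x \<in> K" and M: "\<And>l. l > 0 \<Longrightarrow> nrm (Y l x) \<le> M"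
    and u: "\<And>t. t \<ge> 0 \<Longrightarrow> u t \<in> K"
    and cluster: "\<And>s t e N. s \<ge> 0 \<Longrightarrow> t \<ge> 0 \<Longrightarrow> e > 0 \<Longrightarrow>
      \<exists>n\<ge>N. nrm (euler_curve x n s - u s) < e \<and> nrm (euler_curve x n t - u t) < e"
  shows "evolution B K A R u M" and "u 0 = x"
proof -
  have M0: "M \<ge> 0"
    using M[of 1] nrm_nonneg[of "Y 1 x"] by linarith
  have seq: "\<exists>r. (\<forall>n. r n \<ge> n) \<and> (\<lambda>n. nrm (euler_curve x (r n) s - u s)) \<longlonglongrightarrow> 0
      \<and> (\<lambda>n. nrm (euler_curve x (r n) t - u t)) \<longlonglongrightarrow> 0" if st: "s \<ge> 0" "t \<ge> 0" for s t
  proof -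
    have "\<forall>k. \<exists>n\<ge>k. nrm (euler_curve x n s - u s) < 1 / Suc k \<and> nrm (euler_curve x n t - u t) < 1 / Suc k"
      using cluster[OF st] by simp
    then obtain r where r: "\<And>k. r k \<ge> k" "\<And>k. nrm (euler_curve x (r k) s - u s) < 1 / Suc k"
        "\<And>k. nrm (euler_curve x (r k) t - u t) < 1 / Suc k"
      by metis
    have "(\<lambda>k. 1 / real (Suc k)) \<longlonglongrightarrow> 0"
      using LIMSEQ_inverse_real_of_nat by (simp add: inverse_eq_divide)
    then have "(\<lambda>n. nrm (euler_curve x (r n) v - u v)) \<longlonglongrightarrow> 0"
        if "\<And>k. nrm (euler_curve x (r k) v - u v) < 1 / Suc k" for v
      by (rule Lim_null_comparison[OF always_eventually, rotated]) (auto intro!: less_imp_le that simp del: of_nat_Suc)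
    then show ?thesis
      using r by blast
  qed
  have shift: "(\<lambda>n. nrm (f n - z - (a - z))) \<longlonglongrightarrow> 0" if "(\<lambda>n. nrm (f n - a)) \<longlonglongrightarrow> 0" for f a z
    using that by simp
  show "u 0 = x"
  proof -
    obtain r where "(\<lambda>n. nrm (euler_curve x (r n) 0 - u 0)) \<longlonglongrightarrow> 0"
      using seq[of 0 0] by auto
    then have "nrm (x - u 0) = 0"
      by (simp add: euler_curve_def LIMSEQ_const_iff)
    then show ?thesis by simp
  qed
  \<comment> \<open>For one index both times lie on the same Euler orbit, \<open>j\<close> steps of
    length \<open>l\<close> apart. The grid distance \<open>d n\<close> differs from
    \<open>t - s\<close> by at most one step, hence converges to it.\<close>
  have two: "\<exists>r d. (\<lambda>n. nrm (euler_curve x (r n) s - u s)) \<longlonglongrightarrow> 0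
      \<and> (\<lambda>n. nrm (euler_curve x (r n) t - u t)) \<longlonglongrightarrow> 0 \<and> d \<longlonglongrightarrow> t - s \<and>
      (\<forall>n. \<exists>l k j. l > 0 \<and> d n = l * real j \<and> euler_curve x (r n) s = euler l x k
        \<and> euler_curve x (r n) t = euler l x (k + j))" if st: "0 \<le> s" "s \<le> t" for s t
  proof -
    obtain r where r: "\<And>n. r n \<ge> n" "(\<lambda>n. nrm (euler_curve x (r n) s - u s)) \<longlonglongrightarrow> 0"
        "(\<lambda>n. nrm (euler_curve x (r n) t - u t)) \<longlonglongrightarrow> 0"
      using seq[of s t] st by auto
    define l where "l n = 1 / real (Suc (r n))" for n
    define k where "k n = nat \<lfloor>s * real (Suc (r n))\<rfloor>" for n
    define i where "i n = nat \<lfloor>t * real (Suc (r n))\<rfloor>" for n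
    have ki: "k n \<le> i n" for n
      unfolding k_def i_def using st by (intro nat_mono floor_mono mult_right_mono) auto
    define d where "d n = l n * real (i n - k n)" for n
    have l0: "l n > 0" for n by (simp add: l_def)
    have fl: "l n * real (nat \<lfloor>v * real (Suc (r n))\<rfloor>) \<le> v \<and> v \<le> l n * real (nat \<lfloor>v * real (Suc (r n))\<rfloor>) + l n"
      if "v \<ge> 0" for v n
    proof -
      have nn: "0 \<le> \<lfloor>v * real (Suc (r n))\<rfloor>"
        using that by simp
      have "real (nat \<lfloor>v * real (Suc (r n))\<rfloor>) \<le> v * real (Suc (r n))"
           "v * real (Suc (r n)) \<le> real (nat \<lfloor>v * real (Suc (r n))\<rfloor>) + 1"
        using nn by linarith+
      then show ?thesis
        unfolding l_def by (simp add: field_simps)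
    qed
    have d_bd: "\<bar>d n - (t - s)\<bar> \<le> l n" for n
      using fl[of s n, folded k_def] fl[of t n, folded i_def] st ki[of n]
      by (simp add: d_def of_nat_diff right_diff_distrib abs_le_iff del: of_nat_Suc)
    have "(\<lambda>k. 1 / real (Suc k)) \<longlonglongrightarrow> 0"
      using LIMSEQ_inverse_real_of_nat by (simp add: inverse_eq_divide)
    moreover have "\<bar>d n - (t - s)\<bar> \<le> 1 / real (Suc n)" for n
    proof -
      have "l n \<le> 1 / real (Suc n)"
        unfolding l_def using r(1)[of n] by (intro divide_left_mono) auto
      then show ?thesis using d_bd[of n] by linarith
    qed
    ultimately have "(\<lambda>n. d n - (t - s)) \<longlonglongrightarrow> 0"
      by - (rule Lim_null_comparison[where g = "\<lambda>k. 1 / real (Suc k)"],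
            simp_all only: real_norm_def eventually_True simp_thms)
    then have "d \<longlonglongrightarrow> t - s"
      by (rule LIM_zero_cancel)
    moreover have "\<exists>l k j. l > 0 \<and> d n = l * real j \<and> euler_curve x (r n) s = euler l x k
        \<and> euler_curve x (r n) t = euler l x (k + j)" for n
      using l0[of n] ki[of n]
      by (intro exI[of _ "l n"] exI[of _ "k n"] exI[of _ "i n - k n"])
         (auto simp: d_def euler_curve_def k_def i_def l_def)
    ultimately show ?thesis
      using r by blast
  qed
  show "evolution B K A R u M"
  proof (unfold_locales, goal_cases)
    case (1 t)
    then show ?case by (rule u)
  next
    case (2 s t)
    obtain r d where r: "(\<lambda>n. nrm (euler_curve x (r n) s - u s)) \<longlonglongrightarrow> 0"
      "(\<lambda>n. nrm (euler_curve x (r n) t - u t)) \<longlonglongrightarrow> 0" "d \<longlonglongrightarrow> t - s"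
      "\<And>n. \<exists>l k j. l > 0 \<and> d n = l * real j \<and> euler_curve x (r n) s = euler l x k
        \<and> euler_curve x (r n) t = euler l x (k + j)"
      using two[OF 2] by blast
    have "nrm (u t - u s) \<le> M * d n + (nrm (euler_curve x (r n) s - u s) + nrm (euler_curve x (r n) t - u t))" for n
    proof -
      have "nrm (euler_curve x (r n) t - euler_curve x (r n) s) \<le> M * d n"
        using r(4)[of n] euler_lipschitz[OF x M] by auto
      moreover have "nrm (u t - u s) \<le> nrm (u t - euler_curve x (r n) t)
          + (nrm (euler_curve x (r n) t - euler_curve x (r n) s) + nrm (euler_curve x (r n) s - u s))"
        using nrm_diff_triangle[of "u t" "u s" "euler_curve x (r n) t"]
          nrm_diff_triangle[of "euler_curve x (r n) t" "u s" "euler_curve x (r n) s"] by linarith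
      ultimately show ?thesis
        using nrm_minus_commute[of "u t"] by simp
    qed
    moreover have "(\<lambda>n. M * d n + (nrm (euler_curve x (r n) s - u s) + nrm (euler_curve x (r n) t - u t)))
        \<longlonglongrightarrow> M * (t - s) + (0 + 0)"
      by (intro tendsto_intros r)
    ultimately show ?case
      by (intro LIMSEQ_le_const[where a = "nrm (u t - u s)"]) auto
  next
    case (3 t l)
    obtain r where r: "(\<lambda>n. nrm (euler_curve x (r n) t - u t)) \<longlonglongrightarrow> 0"
      using seq[of t t] 3 by auto
    have "nrm (Y l (u t)) \<le> M + (2 / l) * nrm (euler_curve x (r n) t - u t)" for n
    proof -
      have "nrm (Y l (euler_curve x (r n) t)) \<le> M"
        unfolding euler_curve_def using 3 by (intro euler_Y'[OF x M]) auto
      moreover have "nrm (Y l (euler_curve x (r n) t) - Y l (u t)) \<le> (2 / l) * nrm (euler_curve x (r n) t - u t)"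
        using 3 u euler_curve_in[OF x] by (intro Y_lipschitz) auto
      ultimately show ?thesis
        using nrm_diff_le[of "Y l (euler_curve x (r n) t)" "Y l (u t)"] by linarith
    qed
    moreover have "(\<lambda>n. M + (2 / l) * nrm (euler_curve x (r n) t - u t)) \<longlonglongrightarrow> M + (2 / l) * 0"
      by (intro tendsto_intros r)
    ultimately show ?case
      by (intro LIMSEQ_le_const[where a = "nrm (Y l (u t))"]) auto
  next
    case (4 z y s t)
    obtain r d where r: "(\<lambda>n. nrm (euler_curve x (r n) s - u s)) \<longlonglongrightarrow> 0"
      "(\<lambda>n. nrm (euler_curve x (r n) t - u t)) \<longlonglongrightarrow> 0" "d \<longlonglongrightarrow> t - s"
      "\<And>n. \<exists>l k j. l > 0 \<and> d n = l * real j \<and> euler_curve x (r n) s = euler l x k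
        \<and> euler_curve x (r n) t = euler l x (k + j)"
      using two[OF 4(2,3)] by blast
    have "nrm (euler_curve x (r n) t - z) \<le> nrm (euler_curve x (r n) s - z) + d n * nrm y" for n
      using r(4)[of n] euler_contract[OF x M _ 4(1)] by force
    then show ?case
      by (intro LIMSEQ_le[OF tendsto_nrm[OF shift[OF r(2)]] tendsto_add[OF tendsto_nrm[OF shift[OF r(1)]]
              tendsto_mult[OF r(3) tendsto_const]]]) auto
  next
    case (5 z y s t)
    obtain r d where r: "(\<lambda>n. nrm (euler_curve x (r n) s - u s)) \<longlonglongrightarrow> 0"
      "(\<lambda>n. nrm (euler_curve x (r n) t - u t)) \<longlonglongrightarrow> 0" "d \<longlonglongrightarrow> t - s"
      "\<And>n. \<exists>l k j. l > 0 \<and> d n = l * real j \<and> euler_curve x (r n) s = euler l x k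
        \<and> euler_curve x (r n) t = euler l x (k + j)"
      using two[OF 5(2,3)] by blast
    have le: "(nrm (euler_curve x (r n) t - z))\<^sup>2 / 2 - (nrm (euler_curve x (r n) s - z))\<^sup>2 / 2
        \<le> d n * (B y z - B y (euler_curve x (r n) s) + nrm y * (M * d n))" for n
      using r(4)[of n] euler_energy[OF x M _ 5(1)] unfolding B_diff2 by force
    have lim1: "(\<lambda>n. (nrm (euler_curve x (r n) t - z))\<^sup>2 / 2 - (nrm (euler_curve x (r n) s - z))\<^sup>2 / 2)
        \<longlonglongrightarrow> (nrm (u t - z))\<^sup>2 / 2 - (nrm (u s - z))\<^sup>2 / 2"
      by (intro tendsto_intros tendsto_nrm shift r) auto
    have lim2: "(\<lambda>n. d n * (B y z - B y (euler_curve x (r n) s) + nrm y * (M * d n)))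
        \<longlonglongrightarrow> (t - s) * (B y z - B y (u s) + nrm y * (M * (t - s)))"
      by (intro tendsto_intros tendsto_B r)
    show ?case
      using LIMSEQ_le[OF lim1 lim2] le by (simp add: B_diff2)
  qed
qed

end

section \<open>Speed and difference quotients of a limit curve\<close>

context evolution
begin

lemma M_nonneg: "M \<ge> 0"
  using Y_u_le[of 0 1] nrm_nonneg[of "Y 1 (u 0)"] by linarith

text \<open>Since the norms grow as \<open>l\<close> decreases, this is their limit at 0: the norm
  of the \<open>L^2\<close> limit of the Yosida approximations at \<open>u t\<close>.\<close>

definition speed :: "real \<Rightarrow> real" where "speed t = (SUP l\<in>{0<..}. nrm (Y l (u t)))"

lemma Y_le_speed:
  assumes "t \<ge> 0" "l > 0"
  shows "nrm (Y l (u t)) \<le> speed t"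
  unfolding speed_def
  by (rule cSUP_upper) (use assms Y_u_le in \<open>auto intro!: bdd_aboveI2[where M = M]\<close>)

lemma speed_le: "t \<ge> 0 \<Longrightarrow> speed t \<le> M"
  unfolding speed_def by (rule cSUP_least) (auto simp: Y_u_le)

lemma Y_near_speed:
  assumes t: "t \<ge> 0" and "e > 0"
  shows "\<exists>l0>0. \<forall>l. 0 < l \<and> l \<le> l0 \<longrightarrow> (speed t)\<^sup>2 - (nrm (Y l (u t)))\<^sup>2 < e"
  unfolding speed_def using assms u_in Y_u_le by (intro Y_near_Sup) auto

text \<open>The curve is compared with the resolvent of its own position,
  \<open>z = R l (u s)\<close> and \<open>y = Y l (u s)\<close>: this point is only
  \<open>l * nrm (Y l (u s))\<close> away, and \<open>y\<close> has norm at most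
  \<open>speed s\<close>. Then \<open>l\<close> tends to 0.\<close>

lemma u_speed:
  assumes "0 \<le> s" "s \<le> t"
  shows "nrm (u t - u s) \<le> (t - s) * speed s"
proof (rule field_le_epsilon)
  fix e :: real assume "e > 0"
  define l where "l = e / (2 * M + 1)"
  have l: "l > 0"
    using \<open>e > 0\<close> M_nonneg by (simp add: l_def)
  have us: "u s \<in> K"
    using assms u_in by simp
  have d: "nrm (u s - R l (u s)) = l * nrm (Y l (u s))"
    using l by (simp add: R_eq nrm_scale)
  have "nrm (u t - R l (u s)) \<le> l * nrm (Y l (u s)) + (t - s) * nrm (Y l (u s))"
    using u_contract[OF Y_A[OF l us] assms] d by simp
  then have "nrm (u t - u s) \<le> 2 * (l * nrm (Y l (u s))) + (t - s) * nrm (Y l (u s))"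
    using nrm_diff_triangle[of "u t" "u s" "R l (u s)"] nrm_minus_commute[of "R l (u s)" "u s"] d by linarith
  also have "\<dots> \<le> 2 * (l * M) + (t - s) * speed s"
    using l Y_u_le[of s l] Y_le_speed[of s l] assms by (intro add_mono mult_left_mono) auto
  also have "2 * (l * M) \<le> e"
    using \<open>e > 0\<close> M_nonneg by (simp add: l_def field_simps)
  finally show "nrm (u t - u s) \<le> (t - s) * speed s + e"
    by simp
qed

text \<open>Write \<open>v\<close> for the quotient and \<open>y = Y l (u r)\<close>. The energy
  inequality at \<open>R l (u r) = u r - l *\<^sub>R y\<close> gives
  \<open>B y y \<le> B v y\<close> up to \<open>3 * M\<^sup>2 * (t - s) / l\<close>, and
  \<open>nrm v \<le> speed s\<close>; expanding the square of \<open>nrm (v - y)\<close> doubles the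
  error. Allowing either endpoint as \<open>r\<close> covers right and left quotients
  together.\<close>

lemma difference_quotient:
  assumes st: "0 \<le> s" "s < t" and r: "r \<in> {s, t}" and l: "l > 0"
  shows "(nrm ((1 / (t - s)) *\<^sub>R (u s - u t) - Y l (u r)))\<^sup>2
    \<le> (speed s)\<^sup>2 - (nrm (Y l (u r)))\<^sup>2 + 6 * M\<^sup>2 * (t - s) / l"
proof -
  define h where "h = t - s"
  have h: "h > 0" using st by (simp add: h_def)
  define v where "v = (1 / h) *\<^sub>R (u s - u t)"
  define y where "y = Y l (u r)"
  define x where "x = R l (u r)"
  have ur: "u r \<in> K" and r0: "r \<ge> 0"
    using u_in r st by auto
  have xy: "(x, y) \<in> A"
    unfolding x_def y_def using Y_A[OF l ur] .
  have x_eq: "x = u r - l *\<^sub>R y"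
    using l by (simp add: x_def y_def R_eq)
  have hv: "u t = u s - h *\<^sub>R v"
    using h by (simp add: v_def)
  have nv: "nrm v \<le> speed s" "nrm v \<le> M"
  proof -
    have "nrm v = (1 / h) * nrm (u t - u s)"
      using h nrm_minus_commute[of "u s"] by (simp add: v_def nrm_scale)
    also have "\<dots> \<le> (1 / h) * (h * speed s)"
      using h u_speed[of s t] st by (intro mult_left_mono) (auto simp: h_def)
    finally show "nrm v \<le> speed s"
      using h by simp
    then show "nrm v \<le> M"
      using speed_le[OF st(1)] by simp
  qed
  have ny: "nrm y \<le> M"
    unfolding y_def using Y_u_le r0 l by simp
  have d: "nrm (u s - u r) \<le> M * h"
    using r u_lipschitz'[of s t] st nrm_minus_commute[of "u s"] M_nonneg h by (auto simp: h_def)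
  have "(nrm (u t - x))\<^sup>2 / 2 - (nrm (u s - x))\<^sup>2 / 2 \<le> h * (B y (x - u s) + nrm y * (M * h))"
    using u_energy[OF xy, of s t] st by (simp add: h_def)
  moreover have "(nrm (u t - x))\<^sup>2 / 2 - (nrm (u s - x))\<^sup>2 / 2 = - (h * B v (u s - x)) + h * h * B v v / 2"
  proof -
    have "u t - x = (u s - x) - h *\<^sub>R v"
      using hv by simp
    then have "B (u t - x) (u t - x) = B (u s - x) (u s - x) - 2 * (h * B v (u s - x)) + h * h * B v v"
      using B_commute[of "u s - x" v]
      by (simp only: B_diff[of "u s - x"] B_diff2[of _ "u s - x"] B_scale B_scale2) (simp add: algebra_simps)
    then show ?thesis
      by (simp add: nrm_sq field_simps)
  qed
  moreover have "0 \<le> h * h * B v v / 2"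
    using B_nonneg by simp
  ultimately have "h * (- B v (u s - x)) \<le> h * (B y (x - u s) + nrm y * (M * h))"
    by linarith
  then have "- B v (u s - x) \<le> B y (x - u s) + nrm y * (M * h)"
    using h by (simp only: mult_le_cancel_left_pos)
  moreover have "B v (u s - x) = l * B v y + B v (u s - u r)"
    unfolding x_eq by (simp add: bilin)
  moreover have "B y (x - u s) = - (l * B y y) - B y (u s - u r)"
    unfolding x_eq by (simp add: bilin)
  \<comment> \<open>Three errors of size \<open>M * (M * h)\<close>: two from replacing
    \<open>u s\<close> by \<open>u r\<close> in the pairings, one from
    \<open>u_energy\<close>.\<close>
  moreover have "\<bar>B v (u s - u r)\<bar> \<le> M * (M * h)"
    using abs_B_le[of v "u s - u r"] mult_mono[OF nv(2) d] M_nonneg by simp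
  moreover have "\<bar>B y (u s - u r)\<bar> \<le> M * (M * h)"
    using abs_B_le[of y "u s - u r"] mult_mono[OF ny d] M_nonneg by simp
  moreover have "nrm y * (M * h) \<le> M * (M * h)"
    using ny M_nonneg h by (intro mult_right_mono) auto
  ultimately have "l * B y y \<le> l * B v y + 3 * (M * (M * h))"
    by linarith
  then have *: "B y y \<le> B v y + 3 * M\<^sup>2 * h / l"
    using l by (simp add: field_simps power2_eq_square)
  have "(nrm (v - y))\<^sup>2 = (nrm v)\<^sup>2 - 2 * B v y + B y y"
    using B_commute[of y v] by (simp add: nrm_sq bilin)
  also have "\<dots> \<le> (nrm v)\<^sup>2 - B y y + 6 * M\<^sup>2 * h / l"
    using * by simp
  also have "(nrm v)\<^sup>2 \<le> (speed s)\<^sup>2"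
    using nv(1) by (intro power_mono) auto
  finally show ?thesis
    by (simp add: nrm_sq v_def y_def h_def)
qed

text \<open>For \<open>s = r = t\<close> in \<open>difference_quotient\<close> the main term is
  \<open>(speed t)\<^sup>2 - (nrm (Y l (u t)))\<^sup>2\<close>, which is small for small
  \<open>l\<close> at every \<open>t\<close>. A left quotient starts at another time and does not
  profit from this.\<close>

lemma right_quotient:
  assumes t: "t \<ge> 0" and "e > 0"
  shows "\<exists>l0>0. \<forall>l. 0 < l \<and> l \<le> l0 \<longrightarrow> (\<exists>d>0. \<forall>h. 0 < h \<and> h < d \<longrightarrow>
    nrm ((1 / h) *\<^sub>R (u t - u (t + h)) - Y l (u t)) \<le> e)"
proof -
  obtain l0 where l0: "l0 > 0" "\<And>l. 0 < l \<Longrightarrow> l \<le> l0 \<Longrightarrow> (speed t)\<^sup>2 - (nrm (Y l (u t)))\<^sup>2 < e\<^sup>2 / 2"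
    using Y_near_speed[OF t, of "e\<^sup>2 / 2"] \<open>e > 0\<close> by auto
  have "\<exists>d>0. \<forall>h. 0 < h \<and> h < d \<longrightarrow> nrm ((1 / h) *\<^sub>R (u t - u (t + h)) - Y l (u t)) \<le> e"
    if l: "0 < l" "l \<le> l0" for l
  proof -
    \<comment> \<open>Keeps \<open>6 * M\<^sup>2 * h / l\<close> below \<open>e\<^sup>2 / 2\<close>
      for \<open>h < d\<close>.\<close>
    define d where "d = l * e\<^sup>2 / (12 * M\<^sup>2 + 1)"
    have M2: "12 * M\<^sup>2 + 1 > 0"
      by (intro add_nonneg_pos) auto
    have d: "d > 0"
      unfolding d_def using l \<open>e > 0\<close> M2 by simp
    have "nrm ((1 / h) *\<^sub>R (u t - u (t + h)) - Y l (u t)) \<le> e" if h: "0 < h" "h < d" for h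
    proof (rule power2_le_imp_le)
      have "(12 * M\<^sup>2 + 1) * h \<le> l * e\<^sup>2"
        using h(2) M2 by (simp add: d_def field_simps)
      then have "12 * M\<^sup>2 * h \<le> l * e\<^sup>2"
        using h(1) by (simp add: algebra_simps)
      then have "6 * M\<^sup>2 * h / l \<le> e\<^sup>2 / 2"
        using l by (simp add: field_simps)
      then show "(nrm ((1 / h) *\<^sub>R (u t - u (t + h)) - Y l (u t)))\<^sup>2 \<le> e\<^sup>2"
        using difference_quotient[of t "t + h" t l] t h l l0(2)[OF l] by simp
    qed (use \<open>e > 0\<close> in simp)
    then show ?thesis
      using d by blast
  qed
  then show ?thesis
    using l0(1) by blast
qed

text \<open>\<open>u_contract\<close> compares the curve with points of the domain of
  \<open>A\<close> only, not with the curve itself. Instead both right quotients are replaced by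
  \<open>- Y l\<close> with the same \<open>l\<close>, and monotonicity of \<open>Y l\<close> makes
  the right Dini derivative of the squared distance nonpositive.\<close>

lemma shift_contract:
  assumes s: "0 \<le> s" "s \<le> t" and h: "h \<ge> 0"
  shows "nrm (u (t + h) - u t) \<le> nrm (u (s + h) - u s)"
proof -
  define f where "f \<tau> = B (u (\<tau> + h) - u \<tau>) (u (\<tau> + h) - u \<tau>)" for \<tau>
  have "f t \<le> f s"
  proof (rule right_dini_nonincreasing[OF s(2)])
    have lip: "\<bar>nrm (u (b + h) - u b) - nrm (u (a + h) - u a)\<bar> \<le> 2 * M * \<bar>b - a\<bar>" if "a \<ge> 0" "b \<ge> 0" for a b
    proof -
      have u: "nrm (u d - u c) \<le> M * \<bar>d - c\<bar>" if "c \<ge> 0" "d \<ge> 0" for c d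
        using u_lipschitz'[of c d] u_lipschitz'[of d c] that nrm_minus_commute[of "u c"] by (cases "c \<le> d") auto
      have "\<bar>nrm (u (b + h) - u b) - nrm (u (a + h) - u a)\<bar> \<le> nrm ((u (b + h) - u (a + h)) - (u b - u a))"
        using nrm_diff_le[of "u (b + h) - u b" "u (a + h) - u a"] by (simp add: algebra_simps)
      also have "\<dots> \<le> M * \<bar>b - a\<bar> + M * \<bar>b - a\<bar>"
        using nrm_triangle_diff[of "u (b + h) - u (a + h)" "u b - u a"] u[of "a + h" "b + h"] u[of a b] that h by simp
      finally show ?thesis by simp
    qed
    have "(2 * M)-lipschitz_on {s..t} (\<lambda>\<tau>. nrm (u (\<tau> + h) - u \<tau>))"
      using lip s M_nonneg by (intro lipschitz_onI) (auto simp: dist_real_def abs_minus_commute)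
    then have "continuous_on {s..t} (\<lambda>\<tau>. nrm (u (\<tau> + h) - u \<tau>))"
      by (rule lipschitz_on_continuous_on)
    then have "continuous_on {s..t} (\<lambda>\<tau>. (nrm (u (\<tau> + h) - u \<tau>))\<^sup>2)"
      by (intro continuous_intros)
    then show "continuous_on {s..t} f"
      by (simp add: f_def nrm_sq)
  next
    fix \<tau> e :: real assume \<tau>: "s \<le> \<tau>" "\<tau> < t" and e: "e > 0"
    define a where "a = u (\<tau> + h)"
    define b where "b = u \<tau>"
    define c where "c = nrm (a - b)"
    \<comment> \<open>Makes the error \<open>4 * c * \<epsilon>\<close> of the two approximations at
      most \<open>e / 2\<close>; the last bound in \<open>d\<close> below does the same for the term
      quadratic in the step.\<close>
    define \<epsilon> where "\<epsilon> = e / (8 * (c + 1))"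
    have c: "c \<ge> 0" by (simp add: c_def)
    then have \<epsilon>: "\<epsilon> > 0" using e by (simp add: \<epsilon>_def)
    have pos: "\<tau> \<ge> 0" "\<tau> + h \<ge> 0" using \<tau> s h by auto
    have ab: "a \<in> K" "b \<in> K" using pos u_in by (auto simp: a_def b_def)
    obtain l1 where l1: "l1 > 0" "\<And>l. 0 < l \<Longrightarrow> l \<le> l1 \<Longrightarrow> \<exists>d>0. \<forall>k. 0 < k \<and> k < d \<longrightarrow>
        nrm ((1 / k) *\<^sub>R (a - u (\<tau> + h + k)) - Y l a) \<le> \<epsilon>"
      using right_quotient[OF pos(2) \<epsilon>] unfolding a_def by blast
    obtain l2 where l2: "l2 > 0" "\<And>l. 0 < l \<Longrightarrow> l \<le> l2 \<Longrightarrow> \<exists>d>0. \<forall>k. 0 < k \<and> k < d \<longrightarrow>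
        nrm ((1 / k) *\<^sub>R (b - u (\<tau> + k)) - Y l b) \<le> \<epsilon>"
      using right_quotient[OF pos(1) \<epsilon>] unfolding b_def by blast
    \<comment> \<open>\<open>Y_mono\<close> compares the two points only for a common
      parameter.\<close>
    define l where "l = min l1 l2"
    have l: "l > 0" "l \<le> l1" "l \<le> l2" using l1 l2 by (auto simp: l_def)
    obtain d1 where d1: "d1 > 0" "\<And>k. 0 < k \<Longrightarrow> k < d1 \<Longrightarrow> nrm ((1 / k) *\<^sub>R (a - u (\<tau> + h + k)) - Y l a) \<le> \<epsilon>"
      using l1(2)[OF l(1,2)] by auto
    obtain d2 where d2: "d2 > 0" "\<And>k. 0 < k \<Longrightarrow> k < d2 \<Longrightarrow> nrm ((1 / k) *\<^sub>R (b - u (\<tau> + k)) - Y l b) \<le> \<epsilon>"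
      using l2(2)[OF l(1,3)] by auto
    define d where "d = min (min d1 d2) (e / (8 * M\<^sup>2 + 1))"
    have M2: "8 * M\<^sup>2 + 1 > 0"
      by (intro add_nonneg_pos) auto
    have "d > 0" using d1 d2 e M2 by (auto simp: d_def)
    moreover have "f (\<tau> + k) \<le> f \<tau> + e * k" if k: "0 < k" "k < d" for k
    proof -
      define va where "va = (1 / k) *\<^sub>R (a - u (\<tau> + h + k))"
      define vb where "vb = (1 / k) *\<^sub>R (b - u (\<tau> + k))"
      have a': "u (\<tau> + k + h) = a - k *\<^sub>R va" and b': "u (\<tau> + k) = b - k *\<^sub>R vb"
        using k by (auto simp: va_def vb_def add_ac)
      have nva: "nrm va \<le> M"
      proof -
        have "k * nrm va = nrm (u (\<tau> + h + k) - a)"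
          using k a' nrm_minus_commute[of a] by (simp add: va_def nrm_scale)
        also have "\<dots> \<le> M * k"
          using u_lipschitz'[of "\<tau> + h" "\<tau> + h + k"] pos k by (simp add: a_def)
        finally show ?thesis using k by (simp add: mult.commute)
      qed
      have nvb: "nrm vb \<le> M"
      proof -
        have "k * nrm vb = nrm (u (\<tau> + k) - b)"
          using k b' nrm_minus_commute[of b] by (simp add: vb_def nrm_scale)
        also have "\<dots> \<le> M * k"
          using u_lipschitz'[of "\<tau>" "\<tau> + k"] pos k by (simp add: b_def)
        finally show ?thesis using k by (simp add: mult.commute)
      qed
      define w where "w = a - b"
      have "f (\<tau> + k) = B (w - k *\<^sub>R (va - vb)) (w - k *\<^sub>R (va - vb))"
        unfolding f_def a' b' w_def by (simp add: algebra_simps)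
      also have "\<dots> = f \<tau> - 2 * (k * B w (va - vb)) + k * k * B (va - vb) (va - vb)"
        using B_commute[of "va - vb" w]
        by (simp only: B_diff[of w] B_diff2[of _ w] B_scale B_scale2)
           (simp add: f_def w_def a_def b_def right_diff_distrib)
      finally have f1: "f (\<tau> + k) = f \<tau> - 2 * (k * B w (va - vb)) + k * k * B (va - vb) (va - vb)" .
      have f2: "B (va - vb) (va - vb) \<le> (2 * M)\<^sup>2"
        unfolding nrm_sq[symmetric] using nrm_triangle_diff[of va vb] nva nvb by (intro power_mono) auto
      have f3: "B w (va - vb) = B w (Y l a - Y l b) + B w ((va - Y l a) - (vb - Y l b))"
        by (simp add: bilin)
      have f4: "- (2 * c * \<epsilon>) \<le> B w (va - vb)"
      proof -
        have "0 \<le> B w (Y l a - Y l b)"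
          unfolding w_def using Y_mono l(1) ab by simp
        moreover have "\<bar>B w ((va - Y l a) - (vb - Y l b))\<bar> \<le> c * (\<epsilon> + \<epsilon>)"
        proof -
          have "nrm ((va - Y l a) - (vb - Y l b)) \<le> \<epsilon> + \<epsilon>"
            using nrm_triangle_diff[of "va - Y l a" "vb - Y l b"] d1(2)[of k] d2(2)[of k] k
            by (simp add: d_def flip: va_def vb_def)
          then have "c * nrm ((va - Y l a) - (vb - Y l b)) \<le> c * (\<epsilon> + \<epsilon>)"
            using c by (rule mult_left_mono)
          then show ?thesis
            using abs_B_le[of w "(va - Y l a) - (vb - Y l b)"] by (simp add: c_def w_def)
        qed
        ultimately show ?thesis
          unfolding f3 by (simp add: abs_le_iff)
      qed
      have "k * (- (2 * c * \<epsilon>)) \<le> k * B w (va - vb)" "k * k * B (va - vb) (va - vb) \<le> k * k * (2 * M)\<^sup>2"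
        by (rule mult_left_mono[OF f4], use k in simp, rule mult_left_mono[OF f2], use k in simp)
      then have "f (\<tau> + k) \<le> f \<tau> + k * (4 * c * \<epsilon> + 4 * M\<^sup>2 * k)"
        unfolding f1 by (simp add: algebra_simps power2_eq_square)
      also have "4 * c * \<epsilon> + 4 * M\<^sup>2 * k \<le> e"
      proof -
        have "4 * c * \<epsilon> \<le> e / 2"
          using c e by (simp add: \<epsilon>_def field_simps)
        moreover have "4 * M\<^sup>2 * k \<le> e / 2"
        proof -
          have "k \<le> e / (8 * M\<^sup>2 + 1)" using k by (simp add: d_def)
          then have "(8 * M\<^sup>2 + 1) * k \<le> e" using M2 by (simp add: field_simps)
          then show ?thesis using k by (simp add: algebra_simps)
        qed
        ultimately show ?thesis by simp
      qed
      finally show ?thesis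
        using k by (simp add: mult.commute)
    qed
    ultimately show "\<exists>d>0. \<forall>h. 0 < h \<and> h < d \<longrightarrow> f (\<tau> + h) \<le> f \<tau> + e * h"
      by blast
  qed
  then show ?thesis
    by (simp add: f_def nrm_def)
qed

text \<open>\<open>Y l (u t)\<close> is close to a right quotient at \<open>t\<close>, which by
  \<open>shift_contract\<close> is at most as long as the one at \<open>s\<close>, and that one is
  bounded by \<open>speed s\<close>.\<close>

lemma speed_antimono:
  assumes s: "0 \<le> s" "s \<le> t"
  shows "speed t \<le> speed s"
proof (rule field_le_epsilon)
  fix e :: real assume e: "e > 0"
  have t: "t \<ge> 0" using s by simp
  obtain l0 where l0: "l0 > 0" "\<And>l. 0 < l \<Longrightarrow> l \<le> l0 \<Longrightarrow> (\<exists>d>0. \<forall>h. 0 < h \<and> h < d \<longrightarrow>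
    nrm ((1 / h) *\<^sub>R (u t - u (t + h)) - Y l (u t)) \<le> e)"
    using right_quotient[OF t e] by blast
  have "nrm (Y l (u t)) \<le> speed s + e" if l: "l > 0" for l
  proof -
    define l' where "l' = min l l0"
    have l': "0 < l'" "l' \<le> l0" "l' \<le> l" using l l0 by (auto simp: l'_def)
    obtain d where d: "d > 0" "\<And>h. 0 < h \<Longrightarrow> h < d \<Longrightarrow> nrm ((1 / h) *\<^sub>R (u t - u (t + h)) - Y l' (u t)) \<le> e"
      using l0(2)[OF l'(1,2)] by auto
    define h where "h = d / 2"
    have h: "0 < h" "h < d" using d by (auto simp: h_def)
    have "nrm ((1 / h) *\<^sub>R (u t - u (t + h))) = (1 / h) * nrm (u (t + h) - u t)"
      using h nrm_minus_commute[of "u t"] by (simp add: nrm_scale)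
    also have "\<dots> \<le> (1 / h) * (h * speed s)"
      using h shift_contract[OF s, of h] u_speed[of s "s + h"] s by (intro mult_left_mono) auto
    finally have "nrm ((1 / h) *\<^sub>R (u t - u (t + h))) \<le> speed s"
      using h by simp
    moreover have "nrm (Y l' (u t)) \<le> nrm ((1 / h) *\<^sub>R (u t - u (t + h))) + e"
      using d(2)[OF h] nrm_diff_le[of "(1 / h) *\<^sub>R (u t - u (t + h))" "Y l' (u t)"] by linarith
    ultimately show ?thesis
      using Y_cauchy(2)[OF l'(1,3) u_in[OF t]] by linarith
  qed
  then show "speed t \<le> speed s + e"
    unfolding speed_def[of t] by (intro cSUP_least) auto
qed

text \<open>A left quotient starts at an earlier time \<open>s\<close> and is bounded with
  \<open>speed s\<close>; continuity of the speed replaces this by \<open>speed t\<close>. The three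
  thirds of \<open>e\<^sup>2\<close> pay for this, for the choice of \<open>l\<close> and for the
  error divided by \<open>l\<close>.\<close>

lemma two_sided_quotient:
  assumes t: "t > 0" and cont: "continuous (at t within {0..}) speed" and "e > 0"
  shows "\<exists>l0>0. \<forall>l. 0 < l \<and> l \<le> l0 \<longrightarrow> (\<exists>d>0. \<forall>s\<ge>0. s \<noteq> t \<and> \<bar>s - t\<bar> < d \<longrightarrow>
    nrm ((1 / (s - t)) *\<^sub>R (u s - u t) + Y l (u t)) \<le> e)"
proof -
  have t0: "t \<ge> 0" using t by simp
  obtain l0 where l0: "l0 > 0" "\<And>l. 0 < l \<Longrightarrow> l \<le> l0 \<Longrightarrow> (speed t)\<^sup>2 - (nrm (Y l (u t)))\<^sup>2 < e\<^sup>2 / 3"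
    using Y_near_speed[OF t0, of "e\<^sup>2 / 3"] \<open>e > 0\<close> by auto
  have "((\<lambda>s. (speed s)\<^sup>2) \<longlongrightarrow> (speed t)\<^sup>2) (at t within {0..})"
    using cont by (intro tendsto_intros) (simp add: continuous_within)
  then have "\<forall>\<^sub>F s in at t within {0..}. dist ((speed s)\<^sup>2) ((speed t)\<^sup>2) < e\<^sup>2 / 3"
    using \<open>e > 0\<close> by (intro tendstoD) auto
  then obtain d0 where d0: "d0 > 0" "\<And>s. s \<ge> 0 \<Longrightarrow> s \<noteq> t \<Longrightarrow> dist s t < d0 \<Longrightarrow> dist ((speed s)\<^sup>2) ((speed t)\<^sup>2) < e\<^sup>2 / 3"
    by (auto simp: eventually_at)
  have "\<exists>d>0. \<forall>s\<ge>0. s \<noteq> t \<and> \<bar>s - t\<bar> < d \<longrightarrow> nrm ((1 / (s - t)) *\<^sub>R (u s - u t) + Y l (u t)) \<le> e"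
    if l: "0 < l" "l \<le> l0" for l
  proof -
    define d where "d = min d0 (l * e\<^sup>2 / (18 * M\<^sup>2 + 1))"
    have M2: "18 * M\<^sup>2 + 1 > 0"
      by (intro add_nonneg_pos) auto
    have d: "d > 0"
      unfolding d_def using l d0 \<open>e > 0\<close> M2 by simp
    have "nrm ((1 / (s - t)) *\<^sub>R (u s - u t) + Y l (u t)) \<le> e" if s: "s \<ge> 0" "s \<noteq> t" "\<bar>s - t\<bar> < d" for s
    proof (rule power2_le_imp_le)
      define a where "a = min s t"
      define b where "b = max s t"
      have ab: "0 \<le> a" "a < b" "t \<in> {a, b}" "b - a = \<bar>s - t\<bar>"
        using s t by (auto simp: a_def b_def min_def max_def)
      have "(1 / (b - a)) *\<^sub>R (u a - u b) = - ((1 / (s - t)) *\<^sub>R (u s - u t))"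
      proof (cases "s < t")
        case True
        then have "1 / (t - s) = - (1 / (s - t))"
          by (simp add: divide_simps)
        then show ?thesis
          using True by (simp add: a_def b_def min_def max_def)
      next
        case False
        then show ?thesis
          by (simp add: a_def b_def min_def max_def algebra_simps)
      qed
      then have "(1 / (b - a)) *\<^sub>R (u a - u b) - Y l (u t) = - ((1 / (s - t)) *\<^sub>R (u s - u t) + Y l (u t))"
        by simp
      then have "(nrm ((1 / (s - t)) *\<^sub>R (u s - u t) + Y l (u t)))\<^sup>2
          \<le> (speed a)\<^sup>2 - (nrm (Y l (u t)))\<^sup>2 + 6 * M\<^sup>2 * (b - a) / l"
        using difference_quotient[OF ab(1,2,3) l(1)] by (simp only: nrm_minus)
      also have "6 * M\<^sup>2 * (b - a) / l \<le> e\<^sup>2 / 3"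
      proof -
        have "(18 * M\<^sup>2 + 1) * \<bar>s - t\<bar> \<le> l * e\<^sup>2"
          using s(3) M2 by (simp add: d_def field_simps)
        then have "18 * M\<^sup>2 * \<bar>s - t\<bar> \<le> l * e\<^sup>2"
          by (simp add: algebra_simps)
        then show ?thesis
          using l ab(4) by (simp add: field_simps)
      qed
      also have "(speed a)\<^sup>2 \<le> (speed t)\<^sup>2 + e\<^sup>2 / 3"
      proof (cases "s \<le> t")
        case True
        then have "\<bar>(speed s)\<^sup>2 - (speed t)\<^sup>2\<bar> < e\<^sup>2 / 3"
          using d0(2)[of s] s by (simp add: d_def dist_real_def)
        then show ?thesis
          using True unfolding a_def min_def by (simp only: if_True)
      qed (use \<open>e > 0\<close> in \<open>simp add: a_def min_def\<close>)
      finally show "(nrm ((1 / (s - t)) *\<^sub>R (u s - u t) + Y l (u t)))\<^sup>2 \<le> e\<^sup>2"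
        using l0(2)[OF l] by simp
    qed (use \<open>e > 0\<close> in simp)
    then show ?thesis
      using d by blast
  qed
  then show ?thesis
    using l0(1) by blast
qed

lemma countable_speed_discontinuities: "countable {t \<in> {0..}. \<not> continuous (at t within {0..}) speed}"
proof -
  have "mono_on {0..} (\<lambda>t. - speed t)"
    by (intro mono_onI) (auto intro: speed_antimono)
  moreover have "continuous (at t within {0..}) (\<lambda>t. - speed t) \<longleftrightarrow> continuous (at t within {0..}) speed" for t
    using continuous_minus[of _ speed] continuous_minus[of _ "\<lambda>t. - speed t"] by auto
  ultimately show ?thesis
    using mono_on_ctble_discont[of "{0..}" "\<lambda>t. - speed t"] by (simp only:)
qed

end

section \<open>Brouwer's theorem on cubes and Ky Fan's inequality\<close>

lemma tendsto_coordinatewise: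
  fixes f :: "'b \<Rightarrow> 'i \<Rightarrow> 'c::topological_space"
  shows "(f \<longlongrightarrow> l) F \<longleftrightarrow> (\<forall>i. ((\<lambda>x. f x i) \<longlongrightarrow> l i) F)"
  using limitin_componentwise[of "\<lambda>_. euclidean" UNIV f l F]
  by (simp add: euclidean_product_topology)

text \<open>The library's Brouwer theorem is stated for Euclidean types; here the dimension \<open>n\<close> has to be a
  number, so it is derived once more from the combinatorial lemma.\<close>

lemma brouwer_cube:
  fixes F :: "(nat \<Rightarrow> real) \<Rightarrow> nat \<Rightarrow> real" and n :: nat
  defines "C \<equiv> PiE UNIV (\<lambda>i. if i < n then {0..1} else {0})"
  assumes cont: "\<And>i. i < n \<Longrightarrow> continuous_on C (\<lambda>a. F a i)"
    and F01: "\<And>a i. a \<in> C \<Longrightarrow> i < n \<Longrightarrow> F a i \<in> {0..1}"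
  shows "\<exists>a\<in>C. \<forall>i<n. F a i = a i"
proof -
  \<comment> \<open>Grid points of mesh \<open>1 / Suc p\<close>. Coordinates from \<open>n\<close>
    on are pinned to 0, so that \<open>C\<close> is a compact set of sequences which is a cube in
    the first \<open>n\<close> coordinates.\<close>
  define sc where "sc p q = (\<lambda>i. if i < n then real (q i) / real (Suc p) else 0)" for p :: nat and q :: "nat \<Rightarrow> nat"
  have scC: "sc p q \<in> C" if "\<forall>i<n. q i \<le> Suc p" for p q
    using that by (auto simp: C_def sc_def divide_simps)
  \<comment> \<open>Label 1 means that \<open>F\<close> does not raise the coordinate, label 0 that
    it does not lower it. The values on the faces \<open>0\<close> and \<open>Suc p\<close> are
    those that Kuhn's lemma demands, and they are correct because \<open>F\<close> stays in the
    cube.\<close>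
  define lab where "lab p q i = (if q i = Suc p \<or> (q i \<noteq> 0 \<and> F (sc p q) i < sc p q i) then 1 else 0 :: nat)" for p q i
  have lab1: "F (sc p q) i \<le> sc p q i" if "\<forall>i<n. q i \<le> Suc p" "i < n" "lab p q i = 1" for p q i
    using F01[OF scC[OF that(1)] that(2)] that by (auto simp: lab_def sc_def split: if_splits)
  have lab0: "F (sc p q) i \<ge> sc p q i" if "\<forall>i<n. q i \<le> Suc p" "i < n" "lab p q i = 0" for p q i
    using F01[OF scC[OF that(1)] that(2)] that by (auto simp: lab_def sc_def split: if_splits)
  have "\<forall>p. \<exists>q. (\<forall>i<n. q i < Suc p) \<and> (\<forall>i<n. \<exists>r s. (\<forall>j<n. q j \<le> r j \<and> r j \<le> q j + 1) \<and>
      (\<forall>j<n. q j \<le> s j \<and> s j \<le> q j + 1) \<and> lab p r i \<noteq> lab p s i)"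
  proof
    fix p
    show "\<exists>q. (\<forall>i<n. q i < Suc p) \<and> (\<forall>i<n. \<exists>r s. (\<forall>j<n. q j \<le> r j \<and> r j \<le> q j + 1) \<and>
      (\<forall>j<n. q j \<le> s j \<and> s j \<le> q j + 1) \<and> lab p r i \<noteq> lab p s i)"
    proof (rule kuhn_lemma[of "Suc p" n "lab p"], goal_cases)
      case (5 q)
      show ?case
        by (rule exI[of _ q], rule conjI, fact 5(1), fact 5(2))
    qed (simp_all add: lab_def)
  qed
  from choice[OF this] obtain q where q': "\<forall>p. (\<forall>i<n. q p i < Suc p) \<and>
      (\<forall>i<n. \<exists>r s. (\<forall>j<n. q p j \<le> r j \<and> r j \<le> q p j + 1) \<and>
      (\<forall>j<n. q p j \<le> s j \<and> s j \<le> q p j + 1) \<and> lab p r i \<noteq> lab p s i)" ..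
  have q: "q p i < Suc p" if "i < n" for p i
    using q' that by blast
  have qrs: "\<exists>r s. (\<forall>j<n. q p j \<le> r j \<and> r j \<le> q p j + 1) \<and>
      (\<forall>j<n. q p j \<le> s j \<and> s j \<le> q p j + 1) \<and> lab p r i \<noteq> lab p s i" if "i < n" for p i
    using q' that by blast
  have "\<exists>r s. (\<forall>j<n. q p j \<le> r j \<and> r j \<le> q p j + 1) \<and>
      (\<forall>j<n. q p j \<le> s j \<and> s j \<le> q p j + 1) \<and> F (sc p r) i \<ge> sc p r i \<and> F (sc p s) i \<le> sc p s i"
    if i: "i < n" for p i
  proof -
    obtain r s where rs: "\<forall>j<n. q p j \<le> r j \<and> r j \<le> q p j + 1"
        "\<forall>j<n. q p j \<le> s j \<and> s j \<le> q p j + 1" "lab p r i \<noteq> lab p s i"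
      using qrs[OF i] by blast
    have le: "\<forall>j<n. r j \<le> Suc p" "\<forall>j<n. s j \<le> Suc p"
      using rs q[of _ p] by (fastforce)+
    have "lab p r i = 0 \<and> lab p s i = 1 \<or> lab p r i = 1 \<and> lab p s i = 0"
      using rs(3) by (auto simp: lab_def split: if_splits)
    then show ?thesis
      using rs lab0[OF le(1) i] lab0[OF le(2) i] lab1[OF le(1) i] lab1[OF le(2) i] by blast
  qed
  then have "\<forall>p i. \<exists>z. i < n \<longrightarrow> (\<forall>j<n. q p j \<le> fst z j \<and> fst z j \<le> q p j + 1) \<and>
      (\<forall>j<n. q p j \<le> snd z j \<and> snd z j \<le> q p j + 1) \<and>
      F (sc p (fst z)) i \<ge> sc p (fst z) i \<and> F (sc p (snd z)) i \<le> sc p (snd z) i"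
    by fastforce
  from this[unfolded choice_iff] obtain z where z: "\<forall>p i. i < n \<longrightarrow> (\<forall>j<n. q p j \<le> fst (z p i) j \<and> fst (z p i) j \<le> q p j + 1) \<and>
      (\<forall>j<n. q p j \<le> snd (z p i) j \<and> snd (z p i) j \<le> q p j + 1) \<and>
      F (sc p (fst (z p i))) i \<ge> sc p (fst (z p i)) i \<and> F (sc p (snd (z p i))) i \<le> sc p (snd (z p i)) i" ..
  define r where "r p i = fst (z p i)" for p i
  define s where "s p i = snd (z p i)" for p i
  have r: "q p j \<le> r p i j \<and> r p i j \<le> q p j + 1" and s: "q p j \<le> s p i j \<and> s p i j \<le> q p j + 1"
    if "i < n" "j < n" for p i j
    using z that by (simp_all add: r_def s_def)
  have Fr: "F (sc p (r p i)) i \<ge> sc p (r p i) i" and Fs: "F (sc p (s p i)) i \<le> sc p (s p i) i"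
    if "i < n" for p i
    using z that by (simp_all add: r_def s_def)
  have "compactin (product_topology (\<lambda>i::nat. euclideanreal) UNIV) C"
    unfolding C_def by (subst compactin_PiE) auto
  then have "compact C"
    by (simp add: euclidean_product_topology)
  then have "seq_compact C"
    by (rule compact_imp_seq_compact)
  moreover have "\<forall>p. sc p (q p) \<in> C"
    using q less_imp_le by (intro allI scC) blast
  ultimately obtain a \<sigma> where a: "a \<in> C" "strict_mono \<sigma>" "((\<lambda>p. sc p (q p)) \<circ> \<sigma>) \<longlonglongrightarrow> a"
    by (rule seq_compactE)
  \<comment> \<open>All corners of the cell at \<open>q\<close> are within one mesh width, so the
    two corners with opposite labels share the limit \<open>a\<close>, where both inequalities then
    hold.\<close>
  have near: "(\<lambda>k. sc (\<sigma> k) (z (\<sigma> k))) \<longlonglongrightarrow> a"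
    if z: "\<And>p j. j < n \<Longrightarrow> q p j \<le> z p j \<and> z p j \<le> q p j + 1" for z
  proof (rule tendsto_coordinatewise[THEN iffD2], rule allI)
    fix j
    have 1: "(\<lambda>k. sc (\<sigma> k) (q (\<sigma> k)) j) \<longlonglongrightarrow> a j"
      using a(3) by (simp add: o_def tendsto_coordinatewise)
    have "(\<lambda>k. 1 / real (Suc k)) \<longlonglongrightarrow> 0"
      using LIMSEQ_inverse_real_of_nat by (simp add: inverse_eq_divide)
    then have 2: "(\<lambda>k. 1 / real (Suc (\<sigma> k))) \<longlonglongrightarrow> 0"
      using LIMSEQ_subseq_LIMSEQ[OF _ a(2)] by (auto simp: o_def)
    have bd: "\<bar>sc p (z p) j - sc p (q p) j\<bar> \<le> 1 / real (Suc p)" for p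
      using z[of j p] by (auto simp: sc_def abs_le_iff divide_simps)
    have "(\<lambda>k. sc (\<sigma> k) (z (\<sigma> k)) j - sc (\<sigma> k) (q (\<sigma> k)) j) \<longlonglongrightarrow> 0"
      by (rule Lim_null_comparison[OF always_eventually 2]) (use bd in \<open>simp only: real_norm_def simp_thms\<close>)
    from tendsto_add[OF this 1] show "(\<lambda>k. sc (\<sigma> k) (z (\<sigma> k)) j) \<longlonglongrightarrow> a j"
      by simp
  qed
  have "F a i = a i" if i: "i < n" for i
  proof (rule antisym)
    have inC: "sc p (r p i) \<in> C" "sc p (s p i) \<in> C" for p
    proof -
      have "r p i j \<le> Suc p" "s p i j \<le> Suc p" if "j < n" for j
        using r[OF i that, of p] s[OF i that, of p] q[OF that, of p] by linarith+
      then show "sc p (r p i) \<in> C" "sc p (s p i) \<in> C"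
        by (auto intro!: scC)
    qed
    have lim: "(\<lambda>k. F (sc (\<sigma> k) (z (\<sigma> k))) i) \<longlonglongrightarrow> F a i \<and> (\<lambda>k. sc (\<sigma> k) (z (\<sigma> k)) i) \<longlonglongrightarrow> a i"
      if z: "\<And>p j. j < n \<Longrightarrow> q p j \<le> z p j \<and> z p j \<le> q p j + 1" "\<And>p. sc p (z p) \<in> C" for z
    proof
      show "(\<lambda>k. sc (\<sigma> k) (z (\<sigma> k)) i) \<longlonglongrightarrow> a i"
        using near[OF z(1)] by (auto simp: tendsto_coordinatewise)
      show "(\<lambda>k. F (sc (\<sigma> k) (z (\<sigma> k))) i) \<longlonglongrightarrow> F a i"
        by (rule continuous_on_tendsto_compose[OF cont[OF i] near[OF z(1)] a(1)]) (auto simp: z(2))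
    qed
    show "F a i \<le> a i"
    proof -
      note l = lim[of "\<lambda>p. s p i", OF s[OF i] inC(2), simplified]
      show ?thesis
        by (rule LIMSEQ_le[OF l[THEN conjunct1] l[THEN conjunct2]]) (use Fs[OF i] in blast)
    qed
    show "a i \<le> F a i"
    proof -
      note l = lim[of "\<lambda>p. r p i", OF r[OF i] inC(1), simplified]
      show ?thesis
        by (rule LIMSEQ_le[OF l[THEN conjunct2] l[THEN conjunct1]]) (use Fr[OF i] in blast)
    qed
  qed
  then show ?thesis
    using a(1) by blast
qed


text \<open>If no such \<open>x\<close> exists, compactness yields finitely many points
  \<open>v i\<close> such that at each \<open>x\<close> some \<open>f x (v i)\<close> is negative.
  Weighting the \<open>v i\<close> by the negative parts has a fixed point by Brouwer, at which
  convexity gives \<open>f x x < 0\<close>. The last premise links \<open>X\<close> to the vector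
  space: combinations of finitely many points depend continuously on the coefficients.\<close>

lemma ky_fan:
  fixes X :: "'v::real_vector topology" and f :: "'v \<Rightarrow> 'v \<Rightarrow> real"
  assumes X: "compact_space X" "topspace X = K" and K: "convex K" "K \<noteq> {}"
    and cont: "\<And>w. w \<in> K \<Longrightarrow> continuous_map X euclideanreal (\<lambda>x. f x w)"
    and conv: "\<And>x. x \<in> K \<Longrightarrow> convex_on K (f x)"
    and diag: "\<And>x. x \<in> K \<Longrightarrow> f x x \<ge> 0"
    and lin: "\<And>v n (C :: (nat \<Rightarrow> real) set) c. (\<And>i. i \<le> n \<Longrightarrow> v i \<in> K) \<Longrightarrow>
      (\<And>i. i \<le> n \<Longrightarrow> continuous_on C (\<lambda>a. c a i)) \<Longrightarrow>
      (\<And>a. a \<in> C \<Longrightarrow> (\<Sum>i\<le>n. c a i *\<^sub>R v i) \<in> K) \<Longrightarrow>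
      continuous_map (top_of_set C) X (\<lambda>a. \<Sum>i\<le>(n::nat). c a i *\<^sub>R v i)"
  shows "\<exists>x\<in>K. \<forall>w\<in>K. f x w \<ge> 0"
proof (rule ccontr)
  assume "\<not> ?thesis"
  then have neg: "\<And>x. x \<in> K \<Longrightarrow> \<exists>w\<in>K. f x w < 0"
    by (meson not_le)
  have "\<exists>\<F>. finite \<F> \<and> \<F> \<subseteq> (\<lambda>w. {x \<in> topspace X. f x w \<in> {..<0}}) ` K \<and> topspace X \<subseteq> \<Union>\<F>"
  proof (rule compactinD[of X "topspace X"])
    show "compactin X (topspace X)"
      using X by (simp add: compact_space_def)
    show "openin X U" if U: "U \<in> (\<lambda>w. {x \<in> topspace X. f x w \<in> {..<0}}) ` K" for U
    proof -
      obtain w where "w \<in> K" "U = {x \<in> topspace X. f x w \<in> {..<0}}"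
        using U by blast
      then show ?thesis
        using openin_continuous_map_preimage[OF cont, of w "{..<0}"] by simp
    qed
    show "topspace X \<subseteq> \<Union> ((\<lambda>w. {x \<in> topspace X. f x w \<in> {..<0}}) ` K)"
      using neg X by auto
  qed
  then obtain \<F> where \<F>: "finite \<F>" "\<F> \<subseteq> (\<lambda>w. {x \<in> topspace X. f x w \<in> {..<0}}) ` K" "topspace X \<subseteq> \<Union>\<F>"
    by blast
  then obtain W where W: "W \<subseteq> K" "finite W" "\<F> = (\<lambda>w. {x \<in> topspace X. f x w \<in> {..<0}}) ` W"
    using finite_subset_image[OF \<F>(1,2)] by blast
  then have W: "finite W" "W \<subseteq> K" "\<And>x. x \<in> K \<Longrightarrow> \<exists>w\<in>W. f x w < 0"
    using \<F>(3) X(2) by auto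
  have "W \<noteq> {}"
    using K W(3) by auto
  obtain v0 where v0: "bij_betw v0 {0..<card W} W"
    using ex_bij_betw_nat_finite[OF W(1)] by blast
  define n where "n = card W - 1"
  have "card W = Suc n"
    using W(1) \<open>W \<noteq> {}\<close> by (simp add: n_def card_gt_0_iff)
  then have "{0..<card W} = {..n}"
    by auto
  then have v: "v0 ` {..n} = W"
    using v0 by (simp add: bij_betw_def)
  define v where "v = v0"
  have vW: "v i \<in> K" if "i \<le> n" for i
    using v that W(2) by (auto simp: v_def)
  define g where "g i x = max 0 (- f x (v i))" for i x
  define S where "S x = (\<Sum>i\<le>n. g i x)" for x
  have g0: "g i x \<ge> 0" for i x
    by (simp add: g_def)
  have S0: "S x > 0" if x: "x \<in> K" for x
  proof -
    obtain i where "i \<le> n" "f x (v i) < 0"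
      using W(3)[OF x] v by (auto simp: v_def)
    then show ?thesis
      unfolding S_def by (intro sum_pos2[of _ i]) (auto simp: g_def)
  qed
  define C where "C = PiE UNIV (\<lambda>i. if i < n then {0..1} else {0::real})"
  define s where "s a = (\<Sum>i<n. a i)" for a :: "nat \<Rightarrow> real"
  \<comment> \<open>Barycentric weights from the cube: dividing by \<open>max 1 (s a)\<close>
    retracts it onto the simplex, and index \<open>n\<close> receives what is left. At the fixed
    point \<open>s a \<le> 1\<close>, so the first \<open>n\<close> weights are the coordinates
    themselves.\<close>
  define c where "c a i = (if i < n then a i / max 1 (s a) else 1 - s a / max 1 (s a))" for a i
  define p where "p a = (\<Sum>i\<le>n. c a i *\<^sub>R v i)" for a
  have C0: "a i \<ge> 0" if "a \<in> C" for a i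
    using that unfolding C_def by (auto simp: PiE_def Pi_def split: if_splits)
  have c0: "c a i \<ge> 0" if "a \<in> C" for a i
    using C0[OF that] by (auto simp: c_def divide_simps)
  have c1: "(\<Sum>i\<le>n. c a i) = 1" for a
  proof -
    have "(\<Sum>i\<le>n. c a i) = (\<Sum>i<n. a i / max 1 (s a)) + (1 - s a / max 1 (s a))"
      by (simp add: lessThan_Suc_atMost[symmetric] c_def)
    then show ?thesis
      by (simp add: s_def flip: sum_divide_distrib)
  qed
  have pK: "p a \<in> K" if "a \<in> C" for a
    unfolding p_def using K(1) c0[OF that] c1 vW by (intro convex_sum) auto
  have cont_coord: "continuous_on C (\<lambda>a. a i)" for i
    by (rule continuous_on_subset[OF continuous_on_product_coordinates]) auto
  have cont_c: "continuous_on C (\<lambda>a. c a i)" for i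
    unfolding c_def s_def
    by (cases "i < n") (auto intro!: continuous_intros cont_coord)
  have cont_p: "continuous_map (top_of_set C) X p"
    unfolding p_def by (rule lin) (use vW cont_c pK in \<open>auto simp: p_def\<close>)
  have cont_g: "continuous_on C (\<lambda>a. g i (p a))" if "i \<le> n" for i
  proof -
    have "continuous_on C (\<lambda>a. f (p a) (v i))"
      using continuous_map_compose[OF cont_p cont[OF vW[OF that]]] by (simp add: o_def)
    then show ?thesis
      unfolding g_def by (intro continuous_intros)
  qed
  have cont_F: "continuous_on C (\<lambda>a. g i (p a) / S (p a))" if "i < n" for i
    unfolding S_def
  proof (intro continuous_intros cont_g ballI)
    fix a assume "a \<in> C"
    then show "(\<Sum>i\<le>n. g i (p a)) \<noteq> 0"
      using S0[OF pK, of a] by (simp add: S_def)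
  qed (use that in auto)
  have gS: "g i x \<le> S x" if "i \<le> n" for i x
    unfolding S_def using that g0 by (intro member_le_sum) auto
  have "\<exists>a\<in>C. \<forall>i<n. g i (p a) / S (p a) = a i"
    unfolding C_def
  proof (rule brouwer_cube)
    show "continuous_on (PiE UNIV (\<lambda>i. if i < n then {0..1} else {0})) (\<lambda>a. g i (p a) / S (p a))" if "i < n" for i
      using cont_F[OF that] by (simp add: C_def)
    show "g i (p a) / S (p a) \<in> {0..1}" if "a \<in> PiE UNIV (\<lambda>i. if i < n then {0..1} else {0})" "i < n" for a i
      using that S0[OF pK, of a] g0 gS[of i] by (auto simp: C_def[symmetric] divide_simps)
  qed
  then obtain a where a: "a \<in> C" "\<And>i. i < n \<Longrightarrow> a i = g i (p a) / S (p a)"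
    by metis
  define x where "x = p a"
  have x: "x \<in> K" "S x > 0"
    using pK S0 a(1) by (auto simp: x_def)
  have S_split: "S x = (\<Sum>i<n. g i x) + g n x"
    by (simp add: S_def lessThan_Suc_atMost[symmetric])
  have "s a = (\<Sum>i<n. g i x) / S x"
    using a(2) by (simp add: s_def x_def flip: sum_divide_distrib)
  then have sa: "s a = (S x - g n x) / S x"
    by (simp add: S_split)
  then have sa1: "s a \<le> 1"
    using x g0[of n x] by (simp add: divide_le_eq_1)
  have c_eq: "c a i = g i x / S x" if "i \<le> n" for i
  proof -
    have "max 1 (s a) = 1"
      using sa1 by simp
    then show ?thesis
      using that a(2)[of i] sa x(2) by (cases "i < n") (auto simp: c_def x_def[symmetric] diff_divide_distrib)
  qed
  have "f x x \<le> (\<Sum>i\<le>n. c a i * f x (v i))"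
    using convex_on_sum[OF _ _ conv[OF x(1)], of "{..n}" "c a" v] c1 c0[OF a(1)] vW
    by (simp add: x_def p_def)
  \<comment> \<open>Where \<open>g i x\<close> vanishes so does the weight; elsewhere
    \<open>f x (v i) = - g i x\<close>.\<close>
  also have "\<dots> = (\<Sum>i\<le>n. - (g i x)\<^sup>2 / S x)"
    using x by (intro sum.cong) (auto simp: c_eq g_def max_def power2_eq_square)
  also have "\<dots> < 0"
  proof -
    obtain i where i: "i \<le> n" "f x (v i) < 0"
      using W(3)[OF x(1)] v by (auto simp: v_def)
    have "0 < (\<Sum>i\<le>n. (g i x)\<^sup>2 / S x)"
      using i x by (intro sum_pos2[of _ i]) (auto simp: g_def)
    then show ?thesis
      by (simp add: sum_negf)
  qed
  finally show False
    using diag[OF x(1)] by simp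
qed

section \<open>Separation of points and measures determined by characters\<close>

definition sublinear :: "('a::real_vector \<Rightarrow> real) \<Rightarrow> bool" where
  "sublinear q \<longleftrightarrow> (\<forall>x y. q (x + y) \<le> q x + q y) \<and> (\<forall>c\<ge>0. \<forall>x. q (c *\<^sub>R x) \<le> c * q x)"

lemma sublinear_add: "sublinear q \<Longrightarrow> q (x + y) \<le> q x + q y"
  and sublinear_scale_le: "sublinear q \<Longrightarrow> c \<ge> 0 \<Longrightarrow> q (c *\<^sub>R x) \<le> c * q x"
  by (auto simp: sublinear_def)

lemma sublinear_zero: "sublinear q \<Longrightarrow> q 0 = 0"
  using sublinear_add[of q 0 0] sublinear_scale_le[of q 0 0] by simp

lemma sublinear_scale:
  assumes "sublinear q" "c \<ge> 0"
  shows "q (c *\<^sub>R x) = c * q x"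
proof (cases "c = 0")
  case False
  then have "q x \<le> inverse c * q (c *\<^sub>R x)"
    using sublinear_scale_le[OF assms(1), of "inverse c" "c *\<^sub>R x"] assms(2) by simp
  then have "c * q x \<le> q (c *\<^sub>R x)"
    using False assms(2) by (simp add: field_simps)
  then show ?thesis
    using sublinear_scale_le[OF assms] by (intro antisym) auto
qed (use sublinear_zero[OF assms(1)] in simp)

lemma sublinear_minus: "sublinear q \<Longrightarrow> - q (- x) \<le> q x"
  using sublinear_add[of q x "- x"] sublinear_zero[of q] by simp

text \<open>For sublinear \<open>q\<close>, the greatest sublinear functional below \<open>q\<close>
  whose value at \<open>- y\<close> is at most \<open>- q y\<close>.\<close>

definition descend :: "('a::real_vector \<Rightarrow> real) \<Rightarrow> 'a \<Rightarrow> 'a \<Rightarrow> real" where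
  "descend q y x = (INF t\<in>{0..}. q (x + t *\<^sub>R y) - t * q y)"

context
  fixes q :: "'a::real_vector \<Rightarrow> real"
  assumes q: "sublinear q"
begin

lemma descend_le: "t \<ge> 0 \<Longrightarrow> descend q y x \<le> q (x + t *\<^sub>R y) - t * q y"
  unfolding descend_def
proof (rule cINF_lower)
  show "bdd_below ((\<lambda>t. q (x + t *\<^sub>R y) - t * q y) ` {0..})"
  proof (rule bdd_belowI2[where m = "- q (- x)"])
    fix t :: real assume "t \<in> {0..}"
    then show "- q (- x) \<le> q (x + t *\<^sub>R y) - t * q y"
      using sublinear_add[OF q, of "x + t *\<^sub>R y" "- x"] sublinear_scale[OF q, of t y] by simp
  qed
qed simp

lemma descend_greatest: "(\<And>t. t \<ge> 0 \<Longrightarrow> c \<le> q (x + t *\<^sub>R y) - t * q y) \<Longrightarrow> c \<le> descend q y x"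
  unfolding descend_def by (rule cINF_greatest) auto

lemma sublinear_descend: "sublinear (descend q y)"
  unfolding sublinear_def
proof (intro conjI allI impI)
  fix x z
  have 1: "descend q y (x + z) - (q (z + s *\<^sub>R y) - s * q y) \<le> q (x + t *\<^sub>R y) - t * q y"
    if "s \<ge> 0" "t \<ge> 0" for s t
    using descend_le[of "t + s" y "x + z"] sublinear_add[OF q, of "x + t *\<^sub>R y" "z + s *\<^sub>R y"] that
    by (simp add: algebra_simps)
  have "descend q y (x + z) - descend q y x \<le> q (z + s *\<^sub>R y) - s * q y" if "s \<ge> 0" for s
    using descend_greatest[OF 1[OF that]] by simp
  then have "descend q y (x + z) - descend q y x \<le> descend q y z"
    by (rule descend_greatest)
  then show "descend q y (x + z) \<le> descend q y x + descend q y z"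
    by simp
next
  fix c :: real and x assume c: "c \<ge> 0"
  show "descend q y (c *\<^sub>R x) \<le> c * descend q y x"
  proof (cases "c = 0")
    case True
    then show ?thesis
      using descend_le[of 0 y 0] sublinear_zero[OF q] by simp
  next
    case False
    then have c: "c > 0" using c by simp
    have "descend q y (c *\<^sub>R x) / c \<le> q (x + t *\<^sub>R y) - t * q y" if "t \<ge> 0" for t
    proof -
      have "descend q y (c *\<^sub>R x) \<le> q (c *\<^sub>R (x + t *\<^sub>R y)) - c * t * q y"
        using descend_le[of "c * t" y "c *\<^sub>R x"] c that by (simp add: algebra_simps)
      also have "\<dots> = c * (q (x + t *\<^sub>R y) - t * q y)"
        using sublinear_scale[OF q, of c "x + t *\<^sub>R y"] c by (simp add: right_diff_distrib)
      finally show ?thesis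
        using c by (simp add: field_simps)
    qed
    then have "descend q y (c *\<^sub>R x) / c \<le> descend q y x"
      by (rule descend_greatest)
    then show ?thesis
      using c by (simp add: field_simps)
  qed
qed

lemma descend_le_self: "descend q y x \<le> q x"
  using descend_le[of 0 y x] by simp

lemma descend_minus: "descend q y (- y) \<le> - q y"
  using descend_le[of 1 y "- y"] sublinear_zero[OF q] by simp

end

text \<open>A minimal sublinear functional coincides with all of its descents, which makes it additive.\<close>

lemma linear_below_sublinear:
  fixes q :: "'a::real_vector \<Rightarrow> real"
  assumes q: "sublinear q"
  shows "\<exists>f. linear f \<and> (\<forall>x. f x \<le> q x)"
proof -
  define S where "S = {p. sublinear p \<and> (\<forall>x. p x \<le> q x)}"
  \<comment> \<open>The order is reversed, so that the maximal element from Zorn's lemma is a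
    minimal functional.\<close>
  let ?P = "\<lambda>a u :: 'a \<Rightarrow> real. \<forall>x. u x \<le> a x"
  have "\<exists>m\<in>S. \<forall>a\<in>S. ?P m a \<longrightarrow> a = m"
  proof (rule predicate_Zorn)
    show "partial_order_on S (relation_of ?P S)"
      by (rule partial_order_on_relation_ofI) (auto intro: order_trans intro!: ext antisym)
  next
    fix C assume C: "C \<in> Chains (relation_of ?P S)"
    then have CS: "C \<subseteq> S"
      by (auto simp: Chains_def relation_of_def)
    have ch: "(\<forall>x. b x \<le> a x) \<or> (\<forall>x. a x \<le> b x)" if "a \<in> C" "b \<in> C" for a b
      using C that by (auto simp: Chains_def relation_of_def)
    show "\<exists>u\<in>S. \<forall>a\<in>C. ?P a u"
    proof (cases "C = {}")
      case True
      then show ?thesis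
        using q by (auto simp: S_def)
    next
      case False
      define u where "u x = (INF p\<in>C. p x)" for x
      have bdd: "bdd_below ((\<lambda>p. p x) ` C)" for x
      proof (rule bdd_belowI2[where m = "- q (- x)"])
        fix p assume "p \<in> C"
        then have "sublinear p" "p (- x) \<le> q (- x)"
          using CS by (auto simp: S_def)
        then show "- q (- x) \<le> p x"
          using sublinear_minus[of p x] by linarith
      qed
      have lower: "u x \<le> p x" if "p \<in> C" for p x
        unfolding u_def using bdd that by (rule cINF_lower)
      have greatest: "c \<le> u x" if "\<And>p. p \<in> C \<Longrightarrow> c \<le> p x" for c x
        unfolding u_def using False that by (rule cINF_greatest)
      have "sublinear u"
        unfolding sublinear_def
      proof (intro conjI allI impI)
        fix x y
        \<comment> \<open>Of two members of a chain the smaller one serves for both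
          arguments.\<close>
        have 1: "u (x + y) - r y \<le> p x" if pr: "p \<in> C" "r \<in> C" for p r
        proof -
          obtain w where w: "w \<in> C" "w x \<le> p x" "w y \<le> r y"
            using ch[OF pr] pr by (metis order_refl)
          then have "u (x + y) \<le> w x + w y"
            using lower[OF w(1), of "x + y"] sublinear_add[of w x y] CS by (fastforce simp: S_def)
          then show ?thesis
            using w by linarith
        qed
        have "u (x + y) - u x \<le> r y" if "r \<in> C" for r
          using greatest[of "u (x + y) - r y" x] 1[OF _ that] by (simp add: algebra_simps)
        then show "u (x + y) \<le> u x + u y"
          using greatest[of "u (x + y) - u x" y] by (simp add: algebra_simps)
      next
        fix c :: real and x assume c: "c \<ge> 0"
        obtain p0 where p0: "p0 \<in> C" using False by blast
        show "u (c *\<^sub>R x) \<le> c * u x"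
        proof (cases "c = 0")
          case True
          then show ?thesis
            using lower[OF p0, of 0] CS p0 sublinear_zero[of p0] by (auto simp: S_def)
        next
          case False
          then have c: "c > 0" using c by simp
          have "u (c *\<^sub>R x) / c \<le> p x" if "p \<in> C" for p
          proof -
            have "sublinear p" using CS that by (auto simp: S_def)
            then show ?thesis
              using lower[OF that, of "c *\<^sub>R x"] sublinear_scale[of p c x] c by (simp add: field_simps)
          qed
          then show ?thesis
            using c greatest[of "u (c *\<^sub>R x) / c" x] by (simp add: field_simps)
        qed
      qed
      moreover have "u x \<le> q x" for x
      proof -
        obtain r where r: "r \<in> C" using False by blast
        then have "r x \<le> q x"
          using CS by (auto simp: S_def)
        then show ?thesis
          using lower[OF r, of x] by linarith
      qed
      ultimately show ?thesis
        using lower by (auto simp: S_def)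
    qed
  qed
  then obtain m where m: "sublinear m" "\<And>x. m x \<le> q x"
    and min: "\<And>a. sublinear a \<Longrightarrow> (\<And>x. a x \<le> q x) \<Longrightarrow> (\<And>x. a x \<le> m x) \<Longrightarrow> a = m"
    unfolding S_def by blast
  \<comment> \<open>With \<open>t = 1\<close> in the infimum this says
    \<open>m x \<le> m (x + y) - m y\<close>, the missing half of additivity.\<close>
  have "descend m y = m" for y
    using sublinear_descend[OF m(1)] descend_le_self[OF m(1)] m(2) order_trans by (intro min) blast+
  then have "m x + m y \<le> m (x + y)" for x y
    using descend_le[OF m(1), of 1 y x] by simp
  then have add: "m (x + y) = m x + m y" for x y
    using sublinear_add[OF m(1)] by (intro antisym) auto
  have minus: "m (- x) = - m x" for x
    using add[of x "- x"] sublinear_zero[OF m(1)] by simp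
  have "m (c *\<^sub>R x) = c * m x" for c x
    using sublinear_scale[OF m(1), of c x] sublinear_scale[OF m(1), of "- c" x] minus[of "c *\<^sub>R x"]
    by (cases "c \<ge> 0") auto
  then have "linear m"
    using add by (intro linearI) auto
  then show ?thesis
    using m(2) by blast
qed

text \<open>The descent of the norm along \<open>x0\<close> forces
  \<open>f (- x0) \<le> - norm x0\<close>, while domination by the norm makes \<open>f\<close>
  bounded.\<close>

lemma separating_functional:
  fixes x0 :: "'a::real_normed_vector"
  assumes "x0 \<noteq> 0"
  shows "\<exists>f :: 'a \<Rightarrow>\<^sub>L real. blinfun_apply f x0 \<noteq> 0"
proof -
  have n: "sublinear (norm :: 'a \<Rightarrow> real)"
    by (auto simp: sublinear_def norm_triangle_ineq)
  obtain f where f: "linear f" "\<And>x. f x \<le> descend norm x0 x"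
    using linear_below_sublinear[OF sublinear_descend[OF n]] by blast
  have le: "f x \<le> norm x" for x
    using f(2)[of x] descend_le_self[OF n, of x0 x] by linarith
  have "f (- x0) \<le> - norm x0"
    using f(2)[of "- x0"] descend_minus[OF n, of x0] by linarith
  moreover have fm: "f (- x) = - f x" for x
    using f(1) by (rule linear_neg)
  ultimately have pos: "f x0 > 0"
    using assms zero_less_norm_iff[of x0] by (smt (verit))
  have "bounded_linear f"
  proof (rule bounded_linear_intro[where K = 1])
    show "norm (f x) \<le> norm x * 1" for x
      using le[of x] le[of "- x"] fm[of x] by (simp add: abs_le_iff)
  qed (use f(1) in \<open>auto simp: linear_add linear_scale\<close>)
  then show ?thesis
    using pos by (intro exI[of _ "Blinfun f"]) (simp add: bounded_linear_Blinfun_apply)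
qed

section \<open>Measures determined by trigonometric polynomials\<close>

inductive trig :: "('b::real_normed_vector \<Rightarrow> real) \<Rightarrow> bool" where
  trig_cos: "bounded_linear f \<Longrightarrow> trig (\<lambda>x. a * cos (f x + c))"
| trig_add: "trig g \<Longrightarrow> trig h \<Longrightarrow> trig (\<lambda>x. g x + h x)"

lemma trig_const: "trig (\<lambda>x. a)"
  using trig_cos[OF bounded_linear_zero, of a 0] by simp

text \<open>The phase in \<open>trig_cos\<close> is what keeps the class closed under products with
  cosines alone.\<close>

lemma trig_mult:
  assumes "trig g" "trig h"
  shows "trig (\<lambda>x. g x * h x)"
  using assms(1)
proof induction
  case (trig_cos f a c)
  show ?case
    using assms(2)
  proof induction
    case (trig_cos f' a' c')
    have eq: "(\<lambda>x. a * cos (f x + c) * (a' * cos (f' x + c')))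
      = (\<lambda>x. a * a' / 2 * cos ((f x - f' x) + (c - c')) + a * a' / 2 * cos ((f x + f' x) + (c + c')))"
    proof
      fix x
      show "a * cos (f x + c) * (a' * cos (f' x + c')) = a * a' / 2 * cos ((f x - f' x) + (c - c')) + a * a' / 2 * cos ((f x + f' x) + (c + c'))"
      proof -
        have "cos ((f x - f' x) + (c - c')) + cos ((f x + f' x) + (c + c')) = 2 * (cos (f x + c) * cos (f' x + c'))"
          using cos_times_cos[of "f x + c" "f' x + c'"] by (simp add: algebra_simps)
        then have "a * a' / 2 * (cos ((f x - f' x) + (c - c')) + cos ((f x + f' x) + (c + c')))
            = a * a' / 2 * (2 * (cos (f x + c) * cos (f' x + c')))"
          by simp
        then show ?thesis
          by (simp add: distrib_left mult_ac)
      qed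
    qed
    show ?case
      unfolding eq
      by (intro trig.intros bounded_linear_add bounded_linear_sub trig_cos \<open>bounded_linear f\<close>)
  next
    case (trig_add g h)
    then show ?case
      by (auto simp: distrib_left intro: trig.trig_add)
  qed
next
  case (trig_add g h)
  then show ?case
    by (auto simp: distrib_right intro: trig.trig_add)
qed

lemma trig_continuous: "trig h \<Longrightarrow> continuous_on S h"
proof (induction rule: trig.induct)
  case (trig_cos f a c)
  then have "continuous_on S f"
    by (rule linear_continuous_on)
  then show ?case
    by (intro continuous_intros)
qed (intro continuous_intros)

lemma trig_bounded: "trig h \<Longrightarrow> \<exists>M. \<forall>x. \<bar>h x\<bar> \<le> M"
proof (induction rule: trig.induct)
  case (trig_cos f a c)
  have "\<bar>a * cos (f x + c)\<bar> \<le> \<bar>a\<bar> * 1" for x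
    unfolding abs_mult by (intro mult_left_mono) auto
  then show ?case by blast
next
  case (trig_add g h)
  then obtain M N where "\<And>x. \<bar>g x\<bar> \<le> M" "\<And>x. \<bar>h x\<bar> \<le> N" by blast
  then have "\<bar>g x + h x\<bar> \<le> M + N" for x
    using abs_triangle_ineq[of "g x" "h x"] by (smt (verit))
  then show ?case by blast
qed

lemma trig_polynomial:
  assumes "real_polynomial_function p" "trig h"
  shows "trig (\<lambda>x. p (h x :: real))"
  using assms(1)
proof induction
  case (linear f)
  have "f y = f 1 * y" for y
    using linear_cmul[of f y 1] bounded_linear.linear[OF linear] by simp
  then have "(\<lambda>x. f (h x)) = (\<lambda>x. f 1 * h x)" by metis
  then show ?case
    using trig_mult[OF trig_const[of "f 1"] assms(2)] by simp
qed (auto intro: trig_const trig_add trig_mult)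


text \<open>On a compact set carrying almost all of both measures, Stone-Weierstrass approximates
  \<open>g\<close> by a trigonometric \<open>h\<close>, but \<open>h\<close> may be large elsewhere.
  Composing it with a polynomial that is close to the clamp to \<open>{0..1}\<close> on the range of
  \<open>h\<close> repairs this and stays in the class.\<close>

lemma integral_eq_if_trig_eq:
  fixes P Q :: "'b::{banach, second_countable_topology} measure"
  assumes P: "prob_space P" "sets P = sets borel" and Q: "prob_space Q" "sets Q = sets borel"
    and eq: "\<And>h. trig h \<Longrightarrow> (\<integral>x. h x \<partial>P) = (\<integral>x. h x \<partial>Q)"
    and g: "continuous_on UNIV g" "\<And>x. g x \<in> {0..1::real}"
  shows "(\<integral>x. g x \<partial>P) = (\<integral>x. g x \<partial>Q)"
proof -
  interpret P: prob_space P by fact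
  interpret Q: prob_space Q by fact
  have tight: "\<exists>C. compact C \<and> measure M (- C) < e"
    if "prob_space M" and sets: "sets M = sets borel" and e: "e > 0" for M :: "'b measure" and e
  proof -
    interpret M: prob_space M by fact
    have "(SUP K \<in> {K. K \<subseteq> UNIV \<and> compact K}. emeasure M K) = emeasure M UNIV"
      using inner_regular[of M UNIV] sets M.emeasure_space_1 by simp
    also have "\<dots> = 1"
      using M.emeasure_space_1 sets_eq_imp_space_eq[OF sets] by simp
    finally have "ennreal (1 - e) < (SUP K \<in> {K. K \<subseteq> UNIV \<and> compact K}. emeasure M K)"
      using e by (simp add: ennreal_less_one_iff)
    then obtain C where C: "compact C" "ennreal (1 - e) < emeasure M C"
      by (auto simp: less_SUP_iff)
    then have Cs: "C \<in> sets M"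
      using sets by (simp add: compact_imp_closed)
    have "1 - e < measure M C"
    proof (cases "1 - e \<ge> 0")
      case True
      then show ?thesis
        using C(2) by (simp add: M.emeasure_eq_measure ennreal_less_iff)
    next
      case False
      then show ?thesis
        using measure_nonneg[of M C] by linarith
    qed
    moreover have "measure M (- C) = 1 - measure M C"
      using M.prob_compl[OF Cs] sets_eq_imp_space_eq[OF sets] by (simp add: Compl_eq_Diff_UNIV)
    ultimately show ?thesis
      using C(1) by auto
  qed
  have gm: "g \<in> borel_measurable borel"
    using g(1) by (rule borel_measurable_continuous_onI)
  have "\<bar>(\<integral>x. g x \<partial>P) - (\<integral>x. g x \<partial>Q)\<bar> \<le> 8 * e" if e: "0 < e" "e < 1" for e
  proof -
    obtain C1 where C1: "compact C1" "measure P (- C1) < e"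
      using tight[OF P e(1)] by blast
    obtain C2 where C2: "compact C2" "measure Q (- C2) < e"
      using tight[OF Q e(1)] by blast
    define C where "C = C1 \<union> C2"
    have C: "compact C"
      using C1 C2 by (simp add: C_def compact_Un)
    have Cs: "- C \<in> sets borel" "- C1 \<in> sets borel" "- C2 \<in> sets borel"
      by (intro borel_comp borel_closed compact_imp_closed C C1(1) C2(1))+
    have PC: "measure P (- C) \<le> e"
      using P.finite_measure_mono[of "- C" "- C1"] Cs C1(2) P(2) by (auto simp: C_def)
    have QC: "measure Q (- C) \<le> e"
      using Q.finite_measure_mono[of "- C" "- C2"] Cs C2(2) Q(2) by (auto simp: C_def)
    have "\<exists>h. trig h \<and> (\<forall>x\<in>C. \<bar>g x - h x\<bar> < e)"
    proof (rule Stone_Weierstrass_HOL[OF C])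
      show "\<exists>f. trig f \<and> f x \<noteq> f y" if xy: "x \<in> C \<and> y \<in> C \<and> x \<noteq> y" for x y
      proof -
        obtain f :: "'b \<Rightarrow>\<^sub>L real" where f: "f (x - y) \<noteq> 0"
          using separating_functional[of "x - y"] xy by auto
        \<comment> \<open>Dividing by \<open>k\<close> makes the arguments of the cosine at
          \<open>x\<close> and \<open>y\<close> equal to 1 and 0.\<close>
        define k where "k = blinfun_apply f (x - y)"
        have bl: "bounded_linear (\<lambda>z. (1 / k) * f z)"
          by (intro bounded_linear_const_mult blinfun.bounded_linear_right)
        have "trig (\<lambda>z. 1 * cos ((1 / k) * f z + (- (1 / k) * f y)))"
          by (rule trig_cos[OF bl])
        moreover have "(1 / k) * f x + (- (1 / k) * f y) = 1"
        proof -
          have "(1 / k) * f x + (- (1 / k) * f y) = (1 / k) * (f x - f y)"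
            by (simp add: right_diff_distrib)
          also have "f x - f y = k"
            by (simp add: k_def blinfun.diff_right)
          finally show ?thesis
            using f by (simp add: k_def)
        qed
        moreover have "cos (1::real) \<noteq> 1"
          using cos_monotone_0_pi[of 0 1] pi_gt3 by simp
        ultimately show ?thesis
          by (intro exI[of _ "\<lambda>z. 1 * cos ((1 / k) * f z + (- (1 / k) * f y))"]) (simp del: mult_minus_left)
      qed
    qed (use g e in \<open>auto intro: trig_const trig_add trig_mult trig_continuous continuous_on_subset\<close>)
    then obtain h where h: "trig h" "\<And>x. x \<in> C \<Longrightarrow> \<bar>g x - h x\<bar> < e" by blast
    obtain M where M: "\<And>x. \<bar>h x\<bar> \<le> M"
      using trig_bounded[OF h(1)] by blast
    have "continuous_on {-M..M} (\<lambda>s::real. max 0 (min 1 s))"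
      by (intro continuous_intros)
    then obtain p where p: "real_polynomial_function p" "\<And>s. s \<in> {-M..M} \<Longrightarrow> \<bar>max 0 (min 1 s) - p s\<bar> < e"
      using Stone_Weierstrass_real_polynomial_function[OF compact_Icc _ e(1)] by metis
    define k where "k x = p (h x)" for x
    have k: "trig k"
      unfolding k_def by (rule trig_polynomial[OF p(1) h(1)])
    have pk: "\<bar>max 0 (min 1 (h x)) - k x\<bar> < e" for x
      using p(2)[of "h x"] M[of x] by (simp add: k_def abs_le_iff)
    \<comment> \<open>Off \<open>C\<close> both \<open>g\<close> and the clamped \<open>h\<close>
      lie in \<open>{0..1}\<close>, so the error there is at most \<open>1 + e < 2\<close>.\<close>
    have gk: "\<bar>g x - k x\<bar> \<le> 2 * e + 2 * indicator (- C) x" for x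
    proof (cases "x \<in> C")
      case True
      have "\<bar>g x - max 0 (min 1 (h x))\<bar> \<le> \<bar>g x - h x\<bar>"
        using g(2)[of x] by auto
      then show ?thesis
        using pk[of x] h(2)[OF True] True by simp
    next
      case False
      have "\<bar>g x - max 0 (min 1 (h x))\<bar> \<le> 1"
        using g(2)[of x] by auto
      then show ?thesis
        using pk[of x] False e by simp
    qed
    have km: "k \<in> borel_measurable borel"
      using trig_continuous[OF k] by (rule borel_measurable_continuous_onI)
    obtain N where N: "\<And>x. \<bar>k x\<bar> \<le> N"
      using trig_bounded[OF k] by blast
    have diff: "\<bar>(\<integral>x. g x \<partial>D) - (\<integral>x. k x \<partial>D)\<bar> \<le> 4 * e"
      if "prob_space D" and sets: "sets D = sets borel" and D: "measure D (- C) \<le> e" for D :: "'b measure"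
    proof -
      interpret D: prob_space D by fact
      have gD: "g \<in> borel_measurable D" and kD: "k \<in> borel_measurable D"
        using gm km measurable_cong_sets[OF sets refl] by auto
      have ig: "integrable D g"
        by (rule D.integrable_const_bound[where B = 1]) (use g gD in auto)
      have ik: "integrable D k"
        by (rule D.integrable_const_bound[where B = N]) (use N kD in auto)
      have iC: "integrable D (indicator (- C) :: _ \<Rightarrow> real)"
        using Cs sets by (intro integrable_real_indicator) (auto simp: D.emeasure_eq_measure)
      have "\<bar>(\<integral>x. g x \<partial>D) - (\<integral>x. k x \<partial>D)\<bar> = \<bar>\<integral>x. g x - k x \<partial>D\<bar>"
        using ig ik by simp
      also have "\<dots> \<le> (\<integral>x. \<bar>g x - k x\<bar> \<partial>D)"
        by (rule integral_abs_bound)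
      also have "\<dots> \<le> (\<integral>x. 2 * e + 2 * indicator (- C) x \<partial>D)"
        using ig ik iC by (intro integral_mono gk) auto
      also have "\<dots> = 2 * e + 2 * measure D (- C)"
        using iC D.prob_space sets_eq_imp_space_eq[OF sets] by simp
      finally show ?thesis
        using D by simp
    qed
    show ?thesis
      using diff[OF P PC] diff[OF Q QC] eq[OF k] by linarith
  qed
  note * = this
  have "\<bar>(\<integral>x. g x \<partial>P) - (\<integral>x. g x \<partial>Q)\<bar> \<le> 0 + e" if "e > 0" for e
  proof -
    have "8 * min (e / 8) (1 / 2) \<le> e" "0 < min (e / 8) (1 / 2)" "min (e / 8) (1 / 2) < 1"
      using that by (auto simp: min_def)
    then show ?thesis
      using *[of "min (e / 8) (1 / 2)"] by linarith
  qed
  then have "\<bar>(\<integral>x. g x \<partial>P) - (\<integral>x. g x \<partial>Q)\<bar> \<le> 0"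
    by (rule field_le_epsilon)
  then show ?thesis by simp
qed

lemma measure_closed_eq_if_trig_eq:
  fixes P Q :: "'b::{banach, second_countable_topology} measure"
  assumes P: "prob_space P" "sets P = sets borel" and Q: "prob_space Q" "sets Q = sets borel"
    and eq: "\<And>h. trig h \<Longrightarrow> (\<integral>x. h x \<partial>P) = (\<integral>x. h x \<partial>Q)"
    and A: "closed A"
  shows "measure P A = measure Q A"
proof (cases "A = {}")
  \<comment> \<open>The empty set is split off because \<open>infdist\<close> to it is 0 by
    convention.\<close>
  case False
  define g where "g n x = max 0 (1 - real n * infdist x A)" for n x
  have lim: "(\<lambda>n. \<integral>x. g n x \<partial>D) \<longlonglongrightarrow> measure D A"
    if "prob_space D" and sets: "sets D = sets borel" for D :: "'b measure"
  proof -
    interpret D: prob_space D by fact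
    have As: "A \<in> sets D"
      using A sets by simp
    have "(\<lambda>n. \<integral>x. g n x \<partial>D) \<longlonglongrightarrow> (\<integral>x. indicator A x \<partial>D)"
    proof (rule integral_dominated_convergence[where w = "\<lambda>_. 1"])
      show "AE x in D. (\<lambda>n. g n x) \<longlonglongrightarrow> indicator A x"
      proof (rule AE_I2)
        fix x
        show "(\<lambda>n. g n x) \<longlonglongrightarrow> indicator A x"
        proof (cases "x \<in> A")
          case False
          then have d: "infdist x A > 0"
            using A \<open>A \<noteq> {}\<close> infdist_pos_not_in_closed by blast
          have "\<forall>\<^sub>F n in sequentially. g n x = 0"
          proof -
            obtain N where N: "real N > 1 / infdist x A"
              using reals_Archimedean2 by blast
            have "g n x = 0" if "n \<ge> N" for n
            proof -
              have "real n > 1 / infdist x A" using N that by linarith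
              then show ?thesis
                using d by (simp add: g_def field_simps)
            qed
            then show ?thesis
              by (auto simp: eventually_sequentially)
          qed
          then show ?thesis
            using False by (simp add: tendsto_eventually)
        qed (simp add: g_def)
      qed
      show "g n \<in> borel_measurable D" for n
        unfolding g_def measurable_cong_sets[OF sets refl]
        by (intro borel_measurable_continuous_onI continuous_intros)
      show "AE x in D. norm (g n x) \<le> 1" for n
        by (rule AE_I2) (auto simp: g_def infdist_nonneg)
    qed (use As in auto)
    then show ?thesis
      using As by simp
  qed
  have "(\<integral>x. g n x \<partial>P) = (\<integral>x. g n x \<partial>Q)" for n
    by (rule integral_eq_if_trig_eq[OF P Q eq]) (auto simp: g_def infdist_nonneg intro!: continuous_intros)
  then show ?thesis
    using lim[OF P] lim[OF Q] LIMSEQ_unique by simp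
qed simp

section \<open>Gaussian measures: rotation invariance and Fernique's theorem\<close>

locale gaussian =
  fixes \<eta> :: "'a::{banach, second_countable_topology} measure"
  assumes gaussian: "centered_nondegenerate_gaussian \<eta>"
begin

sublocale prob_space \<eta>
  using gaussian by (simp add: centered_nondegenerate_gaussian_def)

lemma sets_eta [measurable_cong]: "sets \<eta> = sets borel"
  using gaussian by (simp add: centered_nondegenerate_gaussian_def)

lemma space_eta [simp]: "space \<eta> = UNIV"
  using sets_eq_imp_space_eq[OF sets_eta] by simp

lemma measurable_functional [measurable]: "blinfun_apply (\<mu> :: 'a \<Rightarrow>\<^sub>L real) \<in> borel_measurable \<eta>"
  unfolding measurable_cong_sets[OF sets_eta refl]
  by (intro borel_measurable_continuous_onI linear_continuous_on blinfun.bounded_linear_right)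

lemma functional_moment:
  fixes \<mu> :: "'a \<Rightarrow>\<^sub>L real"
  shows integrable_functional_sq: "integrable \<eta> (\<lambda>x. (\<mu> x)\<^sup>2)"
    and functional_nondegenerate: "(\<integral>x. (\<mu> x)\<^sup>2 \<partial>\<eta>) = 0 \<Longrightarrow> \<mu> = 0"
    and functional_char: "(\<integral>x. iexp (\<mu> x) \<partial>\<eta>) = complex_of_real (exp (- (\<integral>x. (\<mu> x)\<^sup>2 \<partial>\<eta>) / 2))"
proof -
  have "integrable \<eta> (\<lambda>x. (\<mu> x)\<^sup>2) \<and> ((\<integral>x. (\<mu> x)\<^sup>2 \<partial>\<eta>) = 0 \<longrightarrow> \<mu> = 0) \<and>
    (\<integral>x. iexp (\<mu> x) \<partial>\<eta>) = complex_of_real (exp (- (\<integral>x. (\<mu> x)\<^sup>2 \<partial>\<eta>) / 2))"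
  \<comment> \<open>Nondegeneracy speaks of nonzero functionals only; the law of 0 is a point
    mass.\<close>
  proof (cases "\<mu> = 0")
    case True
    then show ?thesis
      using prob_space by simp
  next
    case False
    then obtain \<sigma> where \<sigma>: "\<sigma> > 0"
        and dens: "distr \<eta> borel (blinfun_apply \<mu>) = density lborel (\<lambda>r. ennreal (normal_density 0 \<sigma> r))"
      using gaussian by (auto simp: centered_nondegenerate_gaussian_def)
    have D: "distributed \<eta> lborel (blinfun_apply \<mu>) (normal_density 0 \<sigma>)"
    proof -
      have "distr \<eta> lborel (blinfun_apply \<mu>) = distr \<eta> borel (blinfun_apply \<mu>)"
        by (intro distr_cong) auto
      then show ?thesis
        using dens by (simp add: distributed_def)
    qed
    have "has_bochner_integral lborel (\<lambda>x. normal_density 0 \<sigma> x * (x - 0) ^ (2 * 1)) (fact (2 * 1) / ((2 / \<sigma>\<^sup>2) ^ 1 * fact 1))"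
      using normal_moment_even[OF \<sigma>] by blast
    then have m: "has_bochner_integral lborel (\<lambda>x. normal_density 0 \<sigma> x * x\<^sup>2) (\<sigma>\<^sup>2)"
      by (simp add: numeral_2_eq_2)
    have int: "integrable \<eta> (\<lambda>x. (\<mu> x)\<^sup>2)"
      using distributed_integrable[OF D, of "\<lambda>r. r\<^sup>2"] m by (auto simp: has_bochner_integral_iff)
    have var: "(\<integral>x. (\<mu> x)\<^sup>2 \<partial>\<eta>) = \<sigma>\<^sup>2"
      using distributed_integral[OF D, of "\<lambda>r. r\<^sup>2"] m by (auto simp: has_bochner_integral_iff)
    have "distributed \<eta> lborel (\<lambda>x. (\<mu> x - 0) / \<sigma>) std_normal_density"
      using normal_standard_normal_convert[OF \<sigma>] D by blast
    then have "distr \<eta> lborel (\<lambda>x. \<mu> x / \<sigma>) = std_normal_distribution"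
      by (simp add: distributed_def)
    then have std: "distr \<eta> borel (\<lambda>x. \<mu> x / \<sigma>) = std_normal_distribution"
      by (metis distr_cong sets_lborel)
    have "complex_of_real (exp (- \<sigma>\<^sup>2 / 2)) = char std_normal_distribution \<sigma>"
      by (simp add: char_std_normal_distribution)
    also have "\<dots> = (\<integral>r. iexp (\<sigma> * r) \<partial>distr \<eta> borel (\<lambda>x. \<mu> x / \<sigma>))"
      by (simp add: char_def std)
    also have "\<dots> = (\<integral>x. iexp (\<sigma> * (\<mu> x / \<sigma>)) \<partial>\<eta>)"
      by (subst integral_distr) auto
    also have "\<dots> = (\<integral>x. iexp (\<mu> x) \<partial>\<eta>)"
      using \<sigma> by simp
    finally show ?thesis
      using int var \<sigma> by simp
  qed
  then show "integrable \<eta> (\<lambda>x. (\<mu> x)\<^sup>2)" "(\<integral>x. (\<mu> x)\<^sup>2 \<partial>\<eta>) = 0 \<Longrightarrow> \<mu> = 0"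
    "(\<integral>x. iexp (\<mu> x) \<partial>\<eta>) = complex_of_real (exp (- (\<integral>x. (\<mu> x)\<^sup>2 \<partial>\<eta>) / 2))"
    by auto
qed

lemma parallelogram:
  fixes a b :: "'a \<Rightarrow>\<^sub>L real" and c :: real
  assumes "c\<^sup>2 = 1 / 2"
  shows "(\<integral>x. ((c *\<^sub>R (a + b)) x)\<^sup>2 \<partial>\<eta>) + (\<integral>x. ((c *\<^sub>R (a - b)) x)\<^sup>2 \<partial>\<eta>)
    = (\<integral>x. (a x)\<^sup>2 \<partial>\<eta>) + (\<integral>x. (b x)\<^sup>2 \<partial>\<eta>)"
proof -
  have "(\<integral>x. ((c *\<^sub>R (a + b)) x)\<^sup>2 \<partial>\<eta>) + (\<integral>x. ((c *\<^sub>R (a - b)) x)\<^sup>2 \<partial>\<eta>)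
      = (\<integral>x. ((c *\<^sub>R (a + b)) x)\<^sup>2 + ((c *\<^sub>R (a - b)) x)\<^sup>2 \<partial>\<eta>)"
    by (intro Bochner_Integration.integral_add[symmetric] integrable_functional_sq)
  also have "(\<lambda>x. ((c *\<^sub>R (a + b)) x)\<^sup>2 + ((c *\<^sub>R (a - b)) x)\<^sup>2) = (\<lambda>x. (a x)\<^sup>2 + (b x)\<^sup>2)"
  proof
    fix x
    have "((c *\<^sub>R (a + b)) x)\<^sup>2 + ((c *\<^sub>R (a - b)) x)\<^sup>2 = c\<^sup>2 * (2 * ((a x)\<^sup>2 + (b x)\<^sup>2))"
      by (simp add: blinfun.bilinear_simps power_mult_distrib power2_sum power2_diff algebra_simps)
    then show "((c *\<^sub>R (a + b)) x)\<^sup>2 + ((c *\<^sub>R (a - b)) x)\<^sup>2 = (a x)\<^sup>2 + (b x)\<^sup>2"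
      using assms by simp
  qed
  also have "(\<integral>x. (a x)\<^sup>2 + (b x)\<^sup>2 \<partial>\<eta>) = (\<integral>x. (a x)\<^sup>2 \<partial>\<eta>) + (\<integral>x. (b x)\<^sup>2 \<partial>\<eta>)"
    by (intro Bochner_Integration.integral_add integrable_functional_sq)
  finally show ?thesis .
qed

section \<open>Rotation invariance of the product measure\<close>

sublocale pair: pair_prob_space \<eta> \<eta> ..

lemma sets_pair: "sets (\<eta> \<Otimes>\<^sub>M \<eta>) = sets (borel :: ('a \<times> 'a) measure)"
  unfolding borel_prod[symmetric] by (intro sets_pair_measure_cong sets_eta)

lemma char_pair:
  fixes a b :: "'a \<Rightarrow>\<^sub>L real"
  shows "(\<integral>z. iexp (a (fst z) + b (snd z)) \<partial>(\<eta> \<Otimes>\<^sub>M \<eta>))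
    = complex_of_real (exp (- ((\<integral>x. (a x)\<^sup>2 \<partial>\<eta>) + (\<integral>x. (b x)\<^sup>2 \<partial>\<eta>)) / 2))"
proof -
  have "(\<integral>z. iexp (a (fst z) + b (snd z)) \<partial>(\<eta> \<Otimes>\<^sub>M \<eta>)) = (\<integral>(x, y). iexp (a x) * iexp (b y) \<partial>(\<eta> \<Otimes>\<^sub>M \<eta>))"
    by (intro Bochner_Integration.integral_cong) (auto simp: algebra_simps exp_add)
  also have "\<dots> = (\<integral>x. \<integral>y. iexp (a x) * iexp (b y) \<partial>\<eta> \<partial>\<eta>)"
  proof -
    have "integrable (\<eta> \<Otimes>\<^sub>M \<eta>) (\<lambda>(x, y). iexp (a x) * iexp (b y))"
      by (rule pair.integrable_const_bound[where B = 1]) (auto simp: norm_mult)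
    from pair.integral_fst'[OF this] show ?thesis by simp
  qed
  also have "\<dots> = (\<integral>x. iexp (a x) \<partial>\<eta>) * (\<integral>y. iexp (b y) \<partial>\<eta>)"
    by simp
  also have "\<dots> = complex_of_real (exp (- ((\<integral>x. (a x)\<^sup>2 \<partial>\<eta>) + (\<integral>x. (b x)\<^sup>2 \<partial>\<eta>)) / 2))"
    unfolding functional_char
    by (simp add: exp_add[symmetric] add_divide_distrib flip: of_real_mult)
  finally show ?thesis .
qed

definition rotation :: "'a \<times> 'a \<Rightarrow> 'a \<times> 'a" where
  "rotation z = ((1 / sqrt 2) *\<^sub>R (fst z + snd z), (1 / sqrt 2) *\<^sub>R (fst z - snd z))"

lemma continuous_rotation: "continuous_on UNIV rotation"
  unfolding rotation_def by (intro continuous_intros)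

lemma measurable_rotation: "rotation \<in> (\<eta> \<Otimes>\<^sub>M \<eta>) \<rightarrow>\<^sub>M borel"
  unfolding measurable_cong_sets[OF sets_pair refl]
  by (intro borel_measurable_continuous_onI continuous_rotation)

text \<open>Every functional on the product is some \<open>a\<close> on the first factor plus some
  \<open>b\<close> on the second, and rotating turns these into \<open>(a + b) / sqrt 2\<close> and
  \<open>(a - b) / sqrt 2\<close>. The characteristic functional depends only on the sum of the two
  second moments, which the parallelogram law preserves.\<close>

lemma rotation_cos:
  fixes f :: "'a \<times> 'a \<Rightarrow> real"
  assumes f: "bounded_linear f"
  shows "(\<integral>z. cos (f z + c) \<partial>(\<eta> \<Otimes>\<^sub>M \<eta>)) = (\<integral>z. cos (f (rotation z) + c) \<partial>(\<eta> \<Otimes>\<^sub>M \<eta>))"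
proof -
  have ba: "bounded_linear (\<lambda>x. f (x, 0))" and bb: "bounded_linear (\<lambda>y. f (0, y))"
    by (intro bounded_linear_compose[OF f] bounded_linear_Pair bounded_linear_ident bounded_linear_zero)+
  define a where "a = Blinfun (\<lambda>x. f (x, 0))"
  define b where "b = Blinfun (\<lambda>y. f (0, y))"
  have a: "blinfun_apply a x = f (x, 0)" and b: "blinfun_apply b x = f (0, x)" for x
    by (simp_all add: a_def b_def bounded_linear_Blinfun_apply ba bb)
  have fz: "f z = a (fst z) + b (snd z)" for z
    using linear_add[OF bounded_linear.linear[OF f], of "(fst z, 0)" "(0, snd z)"] by (simp add: a b)
  let ?s = "1 / sqrt 2 :: real"
  have frot: "f (rotation z) = (?s *\<^sub>R (a + b)) (fst z) + (?s *\<^sub>R (a - b)) (snd z)" for z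
    unfolding fz rotation_def by (simp add: blinfun.bilinear_simps algebra_simps)
  have Re: "(\<integral>z. cos (u (fst z) + v (snd z) + c) \<partial>(\<eta> \<Otimes>\<^sub>M \<eta>)) =
      Re (iexp c * (\<integral>z. iexp (u (fst z) + v (snd z)) \<partial>(\<eta> \<Otimes>\<^sub>M \<eta>)))" for u v :: "'a \<Rightarrow>\<^sub>L real"
  proof -
    have int: "integrable (\<eta> \<Otimes>\<^sub>M \<eta>) (\<lambda>z. iexp c * iexp (u (fst z) + v (snd z)))"
      by (intro pair.integrable_const_bound[where B = 1]) (auto simp: norm_mult)
    have "Re (iexp c * (\<integral>z. iexp (u (fst z) + v (snd z)) \<partial>(\<eta> \<Otimes>\<^sub>M \<eta>)))
        = Re (\<integral>z. iexp c * iexp (u (fst z) + v (snd z)) \<partial>(\<eta> \<Otimes>\<^sub>M \<eta>))"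
      by (simp only: integral_mult_right_zero)
    also have "\<dots> = (\<integral>z. Re (iexp c * iexp (u (fst z) + v (snd z))) \<partial>(\<eta> \<Otimes>\<^sub>M \<eta>))"
      using integral_Re[OF int] by simp
    also have "\<dots> = (\<integral>z. cos (u (fst z) + v (snd z) + c) \<partial>(\<eta> \<Otimes>\<^sub>M \<eta>))"
    proof (intro Bochner_Integration.integral_cong refl)
      fix z
      have "iexp c * iexp (u (fst z) + v (snd z)) = cis (u (fst z) + v (snd z) + c)"
        by (simp add: cis_conv_exp exp_add[symmetric] algebra_simps)
      then show "Re (iexp c * iexp (u (fst z) + v (snd z))) = cos (u (fst z) + v (snd z) + c)"
        by simp
    qed
    finally show ?thesis by simp
  qed
  have "?s\<^sup>2 = 1 / 2"
    by (simp add: power_divide)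
  from parallelogram[OF this, of a b] show ?thesis
    unfolding frot unfolding fz Re char_pair by simp
qed

lemma rotation_trig:
  assumes "trig h"
  shows "(\<integral>z. h z \<partial>(\<eta> \<Otimes>\<^sub>M \<eta>)) = (\<integral>z. h (rotation z) \<partial>(\<eta> \<Otimes>\<^sub>M \<eta>))"
  using assms
proof induction
  case (trig_cos f a c)
  then show ?case
    using rotation_cos by simp
next
  case (trig_add g h)
  have int: "integrable (\<eta> \<Otimes>\<^sub>M \<eta>) k \<and> integrable (\<eta> \<Otimes>\<^sub>M \<eta>) (\<lambda>z. k (rotation z))" if k: "trig k" for k
  proof -
    obtain M where M: "\<And>x. \<bar>k x\<bar> \<le> M"
      using trig_bounded[OF k] by blast
    have "k \<in> borel_measurable borel"
      using trig_continuous[OF k] by (rule borel_measurable_continuous_onI)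
    then have "k \<in> borel_measurable (\<eta> \<Otimes>\<^sub>M \<eta>)" "(\<lambda>z. k (rotation z)) \<in> borel_measurable (\<eta> \<Otimes>\<^sub>M \<eta>)"
      using measurable_compose[OF measurable_rotation] measurable_cong_sets[OF sets_pair refl] by auto
    then show ?thesis
      by (intro conjI pair.integrable_const_bound[where B = M] AE_I2) (simp_all add: M)
  qed
  show ?case
    using int[OF trig_add.hyps(1)] int[OF trig_add.hyps(2)] trig_add.IH by simp
qed

lemma rotation_closed:
  assumes A: "closed A"
  shows "measure (\<eta> \<Otimes>\<^sub>M \<eta>) A = measure (\<eta> \<Otimes>\<^sub>M \<eta>) (rotation -` A)"
proof -
  have "measure (\<eta> \<Otimes>\<^sub>M \<eta>) A = measure (distr (\<eta> \<Otimes>\<^sub>M \<eta>) borel rotation) A"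
  proof (rule measure_closed_eq_if_trig_eq[OF pair.prob_space_axioms sets_pair _ _ _ A])
    show "prob_space (distr (\<eta> \<Otimes>\<^sub>M \<eta>) borel rotation)"
      by (intro pair.prob_space_distr measurable_rotation)
    show "(\<integral>x. h x \<partial>(\<eta> \<Otimes>\<^sub>M \<eta>)) = (\<integral>x. h x \<partial>distr (\<eta> \<Otimes>\<^sub>M \<eta>) borel rotation)" if h: "trig h" for h
    proof -
      have "h \<in> borel_measurable borel"
        using trig_continuous[OF h] by (rule borel_measurable_continuous_onI)
      then show ?thesis
        using rotation_trig[OF h] by (subst integral_distr) (auto intro: measurable_rotation)
    qed
  qed simp
  also have "\<dots> = measure (\<eta> \<Otimes>\<^sub>M \<eta>) (rotation -` A)"
    using A by (subst measure_distr) (auto intro: measurable_rotation simp: space_pair_measure)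
  finally show ?thesis .
qed

lemma measure_pair_times:
  "U \<in> sets \<eta> \<Longrightarrow> V \<in> sets \<eta> \<Longrightarrow> measure (\<eta> \<Otimes>\<^sub>M \<eta>) (U \<times> V) = prob U * prob V"
  by (simp add: measure_def emeasure_pair_measure_Times enn2real_mult)

section \<open>Tails of the norm\<close>

definition tail :: "real \<Rightarrow> real" where "tail t = prob {x. norm x \<ge> t}"

text \<open>After rotation the event on the left reads \<open>norm (x + y) \<le> sqrt 2 * s\<close>
  and \<open>norm (x - y) \<ge> sqrt 2 * t\<close>; by the triangle inequality both \<open>x\<close>
  and \<open>y\<close> then have norm at least \<open>(t - s) / sqrt 2\<close>.\<close>

lemma tail_rotation:
  "prob {x. norm x \<le> s} * tail t \<le> (tail ((t - s) / sqrt 2))\<^sup>2"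
proof -
  let ?r = "(t - s) / sqrt 2"
  have A: "closed ({x::'a. norm x \<le> s} \<times> {x::'a. norm x \<ge> t})"
    by (intro closed_Times closed_Collect_le continuous_intros)
  have m [measurable]: "{x. norm x \<le> u} \<in> sets \<eta>" "{x. norm x \<ge> u} \<in> sets \<eta>" for u
    unfolding sets_eta by measurable
  have "prob {x. norm x \<le> s} * tail t = measure (\<eta> \<Otimes>\<^sub>M \<eta>) ({x. norm x \<le> s} \<times> {x. norm x \<ge> t})"
    unfolding tail_def by (subst measure_pair_times) auto
  also have "\<dots> = measure (\<eta> \<Otimes>\<^sub>M \<eta>) (rotation -` ({x. norm x \<le> s} \<times> {x. norm x \<ge> t}))"
    by (rule rotation_closed[OF A])
  also have "\<dots> \<le> measure (\<eta> \<Otimes>\<^sub>M \<eta>) ({x. norm x \<ge> ?r} \<times> {x. norm x \<ge> ?r})"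
  proof (rule pair.finite_measure_mono)
    show "{x. norm x \<ge> ?r} \<times> {x. norm x \<ge> ?r} \<in> sets (\<eta> \<Otimes>\<^sub>M \<eta>)"
      by measurable
    show "rotation -` ({x. norm x \<le> s} \<times> {x. norm x \<ge> t}) \<subseteq> {x. norm x \<ge> ?r} \<times> {x. norm x \<ge> ?r}"
    proof
      fix z assume "z \<in> rotation -` ({x. norm x \<le> s} \<times> {x. norm x \<ge> t})"
      moreover obtain x y where z: "z = (x, y)" by (cases z)
      ultimately have "norm (x + y) / sqrt 2 \<le> s" "norm (x - y) / sqrt 2 \<ge> t"
        by (auto simp: rotation_def simp del: scaleR_right_diff_distrib scaleR_add_right)
      then have "norm (x + y) \<le> sqrt 2 * s" "norm (x - y) \<ge> sqrt 2 * t"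
        by (simp_all add: field_simps)
      moreover have "norm (x - y) \<le> 2 * norm x + norm (x + y)"
      proof -
        have eq: "x - y = 2 *\<^sub>R x - (x + y)"
          by (simp add: scaleR_2)
        show ?thesis
          unfolding eq using norm_triangle_ineq4[of "2 *\<^sub>R x" "x + y"] by simp
      qed
      moreover have "norm (x - y) \<le> norm (x + y) + 2 * norm y"
      proof -
        have eq: "x - y = x + y - 2 *\<^sub>R y"
          by (simp add: scaleR_2)
        show ?thesis
          unfolding eq using norm_triangle_ineq4[of "x + y" "2 *\<^sub>R y"] by simp
      qed
      moreover have "sqrt 2 * (t - s) = 2 * ?r"
        by (simp add: field_simps)
      ultimately have "?r \<le> norm x" "?r \<le> norm y"
        unfolding right_diff_distrib by linarith+
      then show "z \<in> {x. norm x \<ge> ?r} \<times> {x. norm x \<ge> ?r}"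
        unfolding z by blast
    qed
  qed
  also have "\<dots> = (tail ?r)\<^sup>2"
    unfolding tail_def by (subst measure_pair_times) (auto simp: power2_eq_square)
  finally show ?thesis .
qed

text \<open>Fernique's argument: the tail bound at \<open>t\<close> is squared when passing to \<open>s + \<surd>2 t\<close>, so the tails
  along a sequence growing like \<open>2\<^bsup>n/2\<^esup>\<close> decay doubly exponentially.\<close>

theorem integrable_norm_sq: "integrable \<eta> (\<lambda>x. (norm x)\<^sup>2)"
proof -
  have m [measurable]: "{x. norm x \<le> u} \<in> sets \<eta>" "{x. norm x \<ge> u} \<in> sets \<eta>" for u
    unfolding sets_eta by measurable
  have "(\<lambda>n. prob {x. norm x \<le> real n}) \<longlonglongrightarrow> prob (\<Union>n. {x. norm x \<le> real n})"
    by (intro finite_Lim_measure_incseq) (auto simp: incseq_def)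
  moreover have "(\<Union>n. {x::'a. norm x \<le> real n}) = UNIV"
    using real_arch_simple by blast
  ultimately have "(\<lambda>n. prob {x. norm x \<le> real n}) \<longlonglongrightarrow> 1"
    using prob_space by simp
  then have "\<forall>\<^sub>F n in sequentially. prob {x. norm x \<le> real n} > 4 / 5"
    by (rule order_tendstoD) simp
  \<comment> \<open>With mass above 4/5 in the ball, \<open>tail s < 1 / 5 \<le> p / 4\<close>,
    which starts the induction in \<open>tail_t\<close> with ratio 1/4.\<close>
  then obtain n0 where n0: "prob {x. norm x \<le> real n0} > 4 / 5"
    by (auto simp: eventually_sequentially)
  \<comment> \<open>The shift by 1 separates the ball of radius \<open>n0\<close> from the tail at
    \<open>s\<close> and makes \<open>s\<close> positive.\<close>
  define s where "s = real n0 + 1"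
  have s: "s > 0" by (simp add: s_def)
  define p where "p = prob {x. norm x \<le> s}"
  have p: "p \<ge> 4 / 5" "p \<le> 1"
    using finite_measure_mono[of "{x. norm x \<le> real n0}" "{x. norm x \<le> s}"] n0
    by (auto simp: p_def s_def subset_eq)
  have "tail s \<le> prob (UNIV - {x. norm x \<le> real n0})"
    unfolding tail_def by (intro finite_measure_mono) (auto simp: s_def)
  also have "\<dots> < 1 / 5"
    using prob_compl[of "{x. norm x \<le> real n0}"] n0 by simp
  finally have ts: "tail s < 1 / 5" .
  \<comment> \<open>Solves \<open>(t (Suc n) - s) / sqrt 2 = t n\<close>, so that
    \<open>tail_rotation\<close> relates consecutive tails.\<close>
  define t where "t = rec_nat s (\<lambda>_ u. s + sqrt 2 * u)"
  have t0: "t 0 = s" and tS: "t (Suc n) = s + sqrt 2 * t n" for n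
    by (simp_all add: t_def)
  have t_lower: "t n \<ge> s * real (Suc n)" for n
  proof (induction n)
    case (Suc n)
    then have "t n \<ge> 0"
      using s by (auto intro: order_trans[rotated])
    then have "t n \<le> sqrt 2 * t n"
      by (simp add: mult_le_cancel_right1)
    then show ?case
      using Suc by (simp add: tS algebra_simps)
  qed (simp add: t0)
  \<comment> \<open>The bound equals \<open>s\<close> at \<open>n = 0\<close>; the subtracted
    \<open>3 * s\<close> absorbs the summand \<open>s\<close> of the recursion because
    \<open>4 / 3 \<le> sqrt 2\<close>.\<close>
  have t_upper: "t n \<le> 4 * s * sqrt 2 ^ n - 3 * s" for n
  proof (induction n)
    case (Suc n)
    have "4 / 3 \<le> sqrt 2"
      by (rule real_le_rsqrt) (simp add: power2_eq_square)
    then have "s * (4 / 3) \<le> s * sqrt 2"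
      using s by (intro mult_left_mono) auto
    moreover have "t (Suc n) \<le> s + sqrt 2 * (4 * s * sqrt 2 ^ n - 3 * s)"
      using Suc by (simp add: tS mult_left_mono)
    ultimately show ?case
      by (simp add: algebra_simps)
  qed (simp add: t0)
  have tail_t: "tail (t n) \<le> p * (1 / 4) ^ (2 ^ n)" for n
  proof (induction n)
    case 0
    then show ?case
      using ts p(1) by (simp add: t0)
  next
    case (Suc n)
    have "p * tail (t (Suc n)) \<le> (tail (t n))\<^sup>2"
      using tail_rotation[of s "t (Suc n)"] by (simp add: p_def tS)
    also have "\<dots> \<le> (p * (1 / 4) ^ (2 ^ n))\<^sup>2"
      using Suc by (intro power_mono) (auto simp: tail_def)
    also have "\<dots> = p * (p * (1 / 4) ^ (2 ^ Suc n))"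
      by (simp add: power2_eq_square power_mult_distrib mult_2 power_add)
    finally show ?case
      using p(1) by simp
  qed
  \<comment> \<open>The square is at most \<open>16 * s\<^sup>2 * 2 ^ Suc n\<close>; using only
    \<open>(1 / 4) ^ n\<close> out of the doubly exponential decay already leaves a geometric
    series.\<close>
  have summand: "(t (Suc n))\<^sup>2 * tail (t n) \<le> 32 * s\<^sup>2 * (1 / 2) ^ n" for n
  proof -
    have "0 \<le> t (Suc n)"
      using t_lower[of "Suc n"] s by (auto intro: order_trans[rotated])
    moreover have "t (Suc n) \<le> 4 * s * sqrt 2 ^ Suc n"
      using t_upper[of "Suc n"] s by linarith
    ultimately have "(t (Suc n))\<^sup>2 \<le> (4 * s * sqrt 2 ^ Suc n)\<^sup>2"
      by (intro power_mono)
    also have "\<dots> = 32 * s\<^sup>2 * 2 ^ n"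
    proof -
      have "(sqrt 2 ^ n)\<^sup>2 = (2::real) ^ n"
        by (metis power_mult mult.commute real_sqrt_pow2 zero_le_numeral)
      then show ?thesis
        by (simp add: power_mult_distrib)
    qed
    finally have 1: "(t (Suc n))\<^sup>2 \<le> 32 * s\<^sup>2 * 2 ^ n" .
    have "tail (t n) \<le> 1 * (1 / 4) ^ (2 ^ n)"
      using tail_t[of n] p(2) by (auto intro: order_trans mult_right_mono)
    also have "\<dots> \<le> (1 / 4) ^ n"
      using less_exp[of n] by (simp add: power_decreasing less_imp_le)
    finally have 2: "tail (t n) \<le> (1 / 4) ^ n" .
    have "(t (Suc n))\<^sup>2 * tail (t n) \<le> 32 * s\<^sup>2 * 2 ^ n * (1 / 4) ^ n"
      using 1 2 by (intro mult_mono) (auto simp: tail_def)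
    also have "(2::real) ^ n * (1 / 4) ^ n = (1 / 2) ^ n"
      by (simp flip: power_mult_distrib)
    then have "32 * s\<^sup>2 * 2 ^ n * (1 / 4) ^ n = 32 * s\<^sup>2 * (1 / 2) ^ n"
      by (simp add: mult.assoc)
    finally show ?thesis .
  qed
  \<comment> \<open>A point outside the ball of radius \<open>s\<close> lies in a shell
    \<open>t n \<le> norm x < t (Suc n)\<close>, and the summand of that shell alone
    suffices.\<close>
  have pointwise: "ennreal ((norm x)\<^sup>2) \<le> ennreal (s\<^sup>2) + (\<Sum>n. ennreal ((t (Suc n))\<^sup>2) * indicator {x. norm x \<ge> t n} x)"
    for x :: 'a
  proof (cases "norm x \<le> s")
    case True
    then have "(norm x)\<^sup>2 \<le> s\<^sup>2"
      by (intro power_mono) auto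
    then have "ennreal ((norm x)\<^sup>2) \<le> ennreal (s\<^sup>2)"
      by (rule ennreal_leI)
    then show ?thesis
      by (rule order_trans) simp
  next
    case False
    obtain k :: nat where "real k > norm x / s"
      using reals_Archimedean2 by blast
    then have "norm x < s * real k"
      using s by (simp add: field_simps)
    also have "\<dots> \<le> s * real (Suc k)"
      using s by simp
    also have "\<dots> \<le> t k" by (rule t_lower)
    finally have ex: "norm x < t k" .
    define j where "j = (LEAST k. norm x < t k)"
    have j: "norm x < t j" "\<And>i. i < j \<Longrightarrow> \<not> norm x < t i"
      unfolding j_def using LeastI[of _ k] ex not_less_Least by auto
    then obtain n where n: "j = Suc n"
      using False t0 by (cases j) auto
    have "(norm x)\<^sup>2 \<le> (t (Suc n))\<^sup>2"
      using j(1) n by (intro power_mono) auto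
    then have "ennreal ((norm x)\<^sup>2) \<le> ennreal ((t (Suc n))\<^sup>2) * indicator {x. norm x \<ge> t n} x"
      using j(2)[of n] n by (simp add: ennreal_leI)
    also have "\<dots> \<le> (\<Sum>n. ennreal ((t (Suc n))\<^sup>2) * indicator {x. norm x \<ge> t n} x)"
      using sum_le_suminf[of "\<lambda>n. ennreal ((t (Suc n))\<^sup>2) * indicator {x. norm x \<ge> t n} x" "{n}"]
      by (simp only: sum.insert sum.empty finite.intros empty_iff simp_thms add_0_right) simp
    finally show ?thesis
      by (rule order_trans) simp
  qed
  have "(\<integral>\<^sup>+x. ennreal ((norm x)\<^sup>2) \<partial>\<eta>)
      \<le> (\<integral>\<^sup>+x. ennreal (s\<^sup>2) + (\<Sum>n. ennreal ((t (Suc n))\<^sup>2) * indicator {x. norm x \<ge> t n} x) \<partial>\<eta>)"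
    by (intro nn_integral_mono pointwise)
  also have "\<dots> = ennreal (s\<^sup>2) + (\<Sum>n. \<integral>\<^sup>+x. ennreal ((t (Suc n))\<^sup>2) * indicator {x. norm x \<ge> t n} x \<partial>\<eta>)"
    using emeasure_space_1 by (simp add: nn_integral_add nn_integral_suminf)
  also have "\<dots> = ennreal (s\<^sup>2) + (\<Sum>n. ennreal ((t (Suc n))\<^sup>2 * tail (t n)))"
    by (simp add: nn_integral_cmult_indicator emeasure_eq_measure tail_def ennreal_mult)
  also have "\<dots> \<le> ennreal (s\<^sup>2) + (\<Sum>n. ennreal (32 * s\<^sup>2 * (1 / 2) ^ n))"
    by (intro add_left_mono suminf_le ennreal_leI summand) auto
  also have "\<dots> = ennreal (s\<^sup>2) + ennreal (\<Sum>n. 32 * s\<^sup>2 * (1 / 2) ^ n)"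
    by (subst suminf_ennreal2) (auto intro!: summable_mult summable_geometric)
  also have "\<dots> < \<infinity>"
    by simp
  finally show ?thesis
    by (intro integrableI_bounded) auto
qed

end

section \<open>The space \<open>L\<^sup>2(\<eta>)\<close> and the map \<open>J\<close>\<close>

definition L2 :: "'b measure \<Rightarrow> ('b \<Rightarrow> real) set" where
  "L2 M = {f \<in> borel_measurable M. integrable M (\<lambda>x. (f x)\<^sup>2)}"

lemma L2_measurable [measurable_dest]: "f \<in> L2 M \<Longrightarrow> f \<in> borel_measurable M"
  and L2_sq: "f \<in> L2 M \<Longrightarrow> integrable M (\<lambda>x. (f x)\<^sup>2)"
  by (auto simp: L2_def)

lemma L2_mult:
  assumes "f \<in> L2 M" "g \<in> L2 M"
  shows "integrable M (\<lambda>x. f x * g x)"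
proof (rule Bochner_Integration.integrable_bound)
  show "integrable M (\<lambda>x. (f x)\<^sup>2 + (g x)\<^sup>2)"
    using assms by (intro Bochner_Integration.integrable_add L2_sq)
  have "\<bar>a * b\<bar> \<le> a\<^sup>2 + b\<^sup>2" for a b :: real
  proof -
    have "2 * (\<bar>a\<bar> * \<bar>b\<bar>) \<le> a\<^sup>2 + b\<^sup>2" "0 \<le> \<bar>a\<bar> * \<bar>b\<bar>"
      using sum_squares_bound[of "\<bar>a\<bar>" "\<bar>b\<bar>"] by simp_all
    then show ?thesis
      unfolding abs_mult by linarith
  qed
  then show "AE x in M. norm (f x * g x) \<le> norm ((f x)\<^sup>2 + (g x)\<^sup>2)"
    by (intro AE_I2) (simp only: real_norm_def abs_of_nonneg sum_power2_ge_zero)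
qed (use assms in measurable)

lemma L2_scale: "f \<in> L2 M \<Longrightarrow> (\<lambda>x. c * f x) \<in> L2 M"
  by (auto simp: L2_def power_mult_distrib)

lemma L2_add:
  assumes "f \<in> L2 M" "g \<in> L2 M"
  shows "(\<lambda>x. f x + g x) \<in> L2 M"
proof -
  have "integrable M (\<lambda>x. (f x)\<^sup>2 + (g x)\<^sup>2 + 2 * (f x * g x))"
    using assms by (intro Bochner_Integration.integrable_add integrable_mult_right L2_sq L2_mult)
  then show ?thesis
    using assms by (auto simp: L2_def power2_sum mult.assoc)
qed

lemma L2_diff: "f \<in> L2 M \<Longrightarrow> g \<in> L2 M \<Longrightarrow> (\<lambda>x. f x - g x) \<in> L2 M"
  using L2_add[of f M "\<lambda>x. - 1 * g x"] L2_scale[of g M "- 1"] by simp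

lemma L2_minus: "f \<in> L2 M \<Longrightarrow> (\<lambda>x. - f x) \<in> L2 M"
  using L2_scale[of f M "- 1"] by simp

lemma H_inner_self: "H_inner M f f = (\<integral>x. (f x)\<^sup>2 \<partial>M)"
  by (simp add: H_inner_def power2_eq_square)

lemma H_inner_commute: "H_inner M f g = H_inner M g f"
  by (simp add: H_inner_def mult.commute)

lemma H_inner_nonneg: "0 \<le> H_inner M f f"
  by (simp add: H_inner_self)

lemma H_inner_add: "f \<in> L2 M \<Longrightarrow> g \<in> L2 M \<Longrightarrow> h \<in> L2 M \<Longrightarrow>
    H_inner M (\<lambda>x. f x + g x) h = H_inner M f h + H_inner M g h"
  by (simp add: H_inner_def distrib_right L2_mult)

lemma H_inner_diff: "f \<in> L2 M \<Longrightarrow> g \<in> L2 M \<Longrightarrow> h \<in> L2 M \<Longrightarrow>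
    H_inner M (\<lambda>x. f x - g x) h = H_inner M f h - H_inner M g h"
  by (simp add: H_inner_def left_diff_distrib L2_mult)

lemma H_inner_scale: "H_inner M (\<lambda>x. c * f x) g = c * H_inner M f g"
  by (simp add: H_inner_def mult.assoc)

lemma H_norm_nonneg [simp]: "0 \<le> H_norm M f"
  by (simp add: H_norm_def H_inner_nonneg)

lemma H_norm_sq: "(H_norm M f)\<^sup>2 = H_inner M f f"
  by (simp add: H_norm_def H_inner_nonneg)

lemma H_inner_add_self:
  assumes "f \<in> L2 M" "g \<in> L2 M"
  shows "H_inner M (\<lambda>x. f x + g x) (\<lambda>x. f x + g x) = H_inner M f f + 2 * H_inner M f g + H_inner M g g"
proof -
  have "H_inner M (\<lambda>x. f x + g x) (\<lambda>x. f x + g x) = (\<integral>x. f x * f x + 2 * (f x * g x) + g x * g x \<partial>M)"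
    unfolding H_inner_def by (intro Bochner_Integration.integral_cong) (auto simp: algebra_simps)
  then show ?thesis
    using assms by (simp add: H_inner_def L2_mult)
qed

text \<open>Cauchy-Schwarz is proved again outside \<open>inner_form\<close>: a representative of
  norm 0 vanishes only almost everywhere, so definiteness fails for functions.\<close>

lemma H_inner_le:
  assumes f: "f \<in> L2 M" and g: "g \<in> L2 M"
  shows "H_inner M f g \<le> H_norm M f * H_norm M g"
proof (cases "H_norm M f = 0 \<or> H_norm M g = 0")
  case True
  have AE0: "AE x in M. h x = 0" if "h \<in> L2 M" "H_norm M h = 0" for h
  proof -
    have "(\<integral>x. (h x)\<^sup>2 \<partial>M) = 0"
      using that(2) H_norm_sq[of M h] by (simp add: H_inner_self)
    then show ?thesis
      using integral_nonneg_eq_0_iff_AE[OF L2_sq[OF that(1)]] by simp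
  qed
  have "AE x in M. f x * g x = 0"
    using True AE0[OF f] AE0[OF g] by (auto elim: AE_mp)
  then have "H_inner M f g = 0"
    unfolding H_inner_def by (rule integral_eq_zero_AE)
  then show ?thesis
    using True by auto
next
  case False
  then have p: "H_norm M f > 0" "H_norm M g > 0"
    using H_norm_nonneg less_le by metis+
  let ?a = "H_norm M f" and ?b = "H_norm M g"
  have L: "(\<lambda>x. ?b * f x) \<in> L2 M" "(\<lambda>x. - ?a * g x) \<in> L2 M"
    by (rule L2_scale[OF f], rule L2_scale[OF g])
  have "0 \<le> H_inner M (\<lambda>x. ?b * f x + - ?a * g x) (\<lambda>x. ?b * f x + - ?a * g x)"
    by (rule H_inner_nonneg)
  also have "\<dots> = ?b * ?b * H_inner M f f - 2 * (?a * ?b * H_inner M f g) + ?a * ?a * H_inner M g g"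
  proof -
    have sc: "H_inner M (\<lambda>x. c * p x) (\<lambda>x. d * q x) = c * d * H_inner M p q" for c d p q
    proof -
      have "(\<lambda>x. c * p x * (d * q x)) = (\<lambda>x. c * d * (p x * q x))"
        by (simp add: mult_ac)
      then show ?thesis
        by (simp add: H_inner_def)
    qed
    show ?thesis
      unfolding H_inner_add_self[OF L] sc by (simp add: algebra_simps)
  qed
  also have "\<dots> = 2 * (?a * ?b) * (?a * ?b - H_inner M f g)"
    unfolding H_norm_sq[symmetric] by (simp add: algebra_simps power2_eq_square)
  finally have "0 \<le> ?a * ?b - H_inner M f g"
    using mult_pos_pos[OF p] by (simp only: zero_le_mult_iff) auto
  then show ?thesis by simp
qed

lemma H_norm_minus [simp]: "H_norm M (\<lambda>x. - f x) = H_norm M f"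
  by (simp add: H_norm_def H_inner_def)

lemma abs_H_inner_le:
  assumes "f \<in> L2 M" "g \<in> L2 M"
  shows "\<bar>H_inner M f g\<bar> \<le> H_norm M f * H_norm M g"
  using H_inner_le[OF assms] H_inner_le[OF L2_minus[OF assms(1)] assms(2)] H_inner_scale[of M "-1" f g]
  by simp

lemma H_norm_triangle:
  assumes f: "f \<in> L2 M" and g: "g \<in> L2 M"
  shows "H_norm M (\<lambda>x. f x + g x) \<le> H_norm M f + H_norm M g"
proof (rule power2_le_imp_le)
  have "(H_norm M (\<lambda>x. f x + g x))\<^sup>2 = H_inner M f f + 2 * H_inner M f g + H_inner M g g"
    by (simp add: H_norm_sq H_inner_add_self f g)
  also have "\<dots> \<le> (H_norm M f + H_norm M g)\<^sup>2"
    using H_inner_le[OF f g] by (simp add: power2_sum H_norm_sq)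
  finally show "(H_norm M (\<lambda>x. f x + g x))\<^sup>2 \<le> (H_norm M f + H_norm M g)\<^sup>2" .
qed simp

lemma H_norm_diff_triangle:
  assumes "f \<in> L2 M" "g \<in> L2 M" "h \<in> L2 M"
  shows "H_norm M (\<lambda>x. f x - h x) \<le> H_norm M (\<lambda>x. f x - g x) + H_norm M (\<lambda>x. g x - h x)"
  using H_norm_triangle[OF L2_diff[OF assms(1,2)] L2_diff[OF assms(2,3)]] by simp

text \<open>Riesz-Fischer with a prescribed rate. On a probability space \<open>L^2\<close>
  increments bound \<open>L^1\<close> increments, so their sum is finite almost everywhere and the
  sequence converges there; Fatou's lemma carries the rate to the limit.\<close>

lemma (in prob_space) L2_complete:
  fixes f :: "nat \<Rightarrow> 'a \<Rightarrow> real"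
  assumes f: "\<And>n. f n \<in> L2 M"
    and cauchy: "\<And>m n. n \<le> m \<Longrightarrow> H_norm M (\<lambda>x. f m x - f n x) \<le> (1 / 2) ^ n"
  shows "\<exists>g\<in>L2 M. \<forall>n. H_norm M (\<lambda>x. g x - f n x) \<le> (1 / 2) ^ n"
proof -
  have [measurable]: "f n \<in> borel_measurable M" for n
    using f by (auto simp: L2_def)
  have one: "(\<lambda>_. 1) \<in> L2 M"
    by (simp add: L2_def)
  have L1: "(\<integral>\<^sup>+x. ennreal \<bar>f (Suc n) x - f n x\<bar> \<partial>M) \<le> ennreal ((1 / 2) ^ n)" for n
  proof -
    have d: "(\<lambda>x. \<bar>f (Suc n) x - f n x\<bar>) \<in> L2 M"
      using L2_diff[OF f[of "Suc n"] f[of n]] by (auto simp: L2_def)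
    have "integrable M (\<lambda>x. \<bar>f (Suc n) x - f n x\<bar>)"
      using L2_mult[OF d one] by simp
    then have "(\<integral>\<^sup>+x. ennreal \<bar>f (Suc n) x - f n x\<bar> \<partial>M) = ennreal (\<integral>x. \<bar>f (Suc n) x - f n x\<bar> \<partial>M)"
      by (intro nn_integral_eq_integral) auto
    also have "(\<integral>x. \<bar>f (Suc n) x - f n x\<bar> \<partial>M) \<le> H_norm M (\<lambda>x. \<bar>f (Suc n) x - f n x\<bar>) * H_norm M (\<lambda>_. 1)"
      using H_inner_le[OF d one] by (simp add: H_inner_def)
    also have "\<dots> = H_norm M (\<lambda>x. f (Suc n) x - f n x)"
      by (simp add: H_norm_def H_inner_def prob_space)
    finally show ?thesis
      using cauchy[of n "Suc n"] by (auto intro: order_trans ennreal_leI)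
  qed
  have "(\<integral>\<^sup>+x. (\<Sum>n. ennreal \<bar>f (Suc n) x - f n x\<bar>) \<partial>M) = (\<Sum>n. \<integral>\<^sup>+x. ennreal \<bar>f (Suc n) x - f n x\<bar> \<partial>M)"
    by (intro nn_integral_suminf) simp
  also have "\<dots> \<le> (\<Sum>n. ennreal ((1 / 2) ^ n))"
    by (intro suminf_le L1) auto
  also have "\<dots> = ennreal (\<Sum>n. (1 / 2) ^ n)"
    by (subst suminf_ennreal2) (auto intro!: summable_geometric)
  also have "\<dots> < \<infinity>" by simp
  finally have "AE x in M. (\<Sum>n. ennreal \<bar>f (Suc n) x - f n x\<bar>) \<noteq> \<infinity>"
    by (intro nn_integral_noteq_infinite) auto
  then have conv: "AE x in M. convergent (\<lambda>n. f n x)"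
  proof eventually_elim
    fix x assume "(\<Sum>n. ennreal \<bar>f (Suc n) x - f n x\<bar>) \<noteq> \<infinity>"
    then have "summable (\<lambda>n. \<bar>f (Suc n) x - f n x\<bar>)"
      by (intro summable_suminf_not_top) auto
    then have "summable (\<lambda>n. f (Suc n) x - f n x)"
      by (rule summable_rabs_cancel)
    then have "(\<lambda>n. \<Sum>i<n. f (Suc i) x - f i x) \<longlonglongrightarrow> (\<Sum>n. f (Suc n) x - f n x)"
      by (rule summable_LIMSEQ)
    then have "(\<lambda>n. f 0 x + (f n x - f 0 x)) \<longlonglongrightarrow> f 0 x + (\<Sum>n. f (Suc n) x - f n x)"
      by (intro tendsto_add tendsto_const) (simp add: sum_lessThan_telescope[of "\<lambda>n. f n x"])
    then show "convergent (\<lambda>n. f n x)"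
      by (simp add: convergent_def) blast
  qed
  define g where "g x = lim (\<lambda>n. f n x)" for x
  have [measurable]: "g \<in> borel_measurable M"
    unfolding g_def by (rule borel_measurable_lim_metric) simp
  have lim: "AE x in M. (\<lambda>n. f n x) \<longlonglongrightarrow> g x"
    using conv by eventually_elim (simp add: g_def convergent_LIMSEQ_iff)
  have fatou: "(\<integral>\<^sup>+x. ennreal ((g x - f n x)\<^sup>2) \<partial>M) \<le> ennreal (((1 / 2) ^ n)\<^sup>2)" for n
  proof -
    have "(\<integral>\<^sup>+x. ennreal ((g x - f n x)\<^sup>2) \<partial>M) = (\<integral>\<^sup>+x. liminf (\<lambda>m. ennreal ((f m x - f n x)\<^sup>2)) \<partial>M)"
    proof (rule nn_integral_cong_AE)
      show "AE x in M. ennreal ((g x - f n x)\<^sup>2) = liminf (\<lambda>m. ennreal ((f m x - f n x)\<^sup>2))"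
        using lim
      proof eventually_elim
        fix x assume "(\<lambda>n. f n x) \<longlonglongrightarrow> g x"
        then have "(\<lambda>m. ennreal ((f m x - f n x)\<^sup>2)) \<longlonglongrightarrow> ennreal ((g x - f n x)\<^sup>2)"
          by (intro tendsto_ennrealI tendsto_intros)
        then show "ennreal ((g x - f n x)\<^sup>2) = liminf (\<lambda>m. ennreal ((f m x - f n x)\<^sup>2))"
          using lim_imp_Liminf[OF trivial_limit_sequentially] by metis
      qed
    qed
    also have "\<dots> \<le> liminf (\<lambda>m. \<integral>\<^sup>+x. ennreal ((f m x - f n x)\<^sup>2) \<partial>M)"
      by (rule nn_integral_liminf) simp
    also have "\<dots> \<le> ennreal (((1 / 2) ^ n)\<^sup>2)"
    proof (rule Liminf_le)
      have "(\<integral>\<^sup>+x. ennreal ((f m x - f n x)\<^sup>2) \<partial>M) \<le> ennreal (((1 / 2) ^ n)\<^sup>2)" if "n \<le> m" for m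
      proof -
        have "(\<integral>\<^sup>+x. ennreal ((f m x - f n x)\<^sup>2) \<partial>M) = ennreal (\<integral>x. (f m x - f n x)\<^sup>2 \<partial>M)"
          using L2_sq[OF L2_diff[OF f f]] by (intro nn_integral_eq_integral) auto
        also have "(\<integral>x. (f m x - f n x)\<^sup>2 \<partial>M) = (H_norm M (\<lambda>x. f m x - f n x))\<^sup>2"
          by (simp add: H_norm_sq H_inner_self)
        also have "\<dots> \<le> ((1 / 2) ^ n)\<^sup>2"
          using cauchy[OF that] by (intro power_mono) auto
        finally show ?thesis
          by (simp add: ennreal_leI)
      qed
      then show "\<forall>\<^sub>F m in sequentially. (\<integral>\<^sup>+x. ennreal ((f m x - f n x)\<^sup>2) \<partial>M) \<le> ennreal (((1 / 2) ^ n)\<^sup>2)"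
        by (auto simp: eventually_sequentially)
    qed simp
    finally show ?thesis .
  qed
  have gf: "(\<lambda>x. g x - f n x) \<in> L2 M" for n
    unfolding L2_def using fatou[of n]
    by (auto intro!: integrableI_bounded simp: less_top[symmetric] top_unique intro: le_less_trans[OF _ ennreal_less_top])
  have "g \<in> L2 M"
    using L2_add[OF gf[of 0] f[of 0]] by simp
  moreover have "H_norm M (\<lambda>x. g x - f n x) \<le> (1 / 2) ^ n" for n
  proof (rule power2_le_imp_le)
    have "ennreal (\<integral>x. (g x - f n x)\<^sup>2 \<partial>M) \<le> ennreal (((1 / 2) ^ n)\<^sup>2)"
      using fatou[of n] nn_integral_eq_integral[OF L2_sq[OF gf[of n]]] by simp
    then show "(H_norm M (\<lambda>x. g x - f n x))\<^sup>2 \<le> ((1 / 2) ^ n)\<^sup>2"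
      by (subst (asm) ennreal_le_iff) (auto simp: H_norm_sq H_inner_self)
  qed simp
  ultimately show ?thesis by blast
qed

section \<open>The dual space inside \<open>L^2\<close> and the map \<open>J\<close>\<close>

context gaussian
begin

lemma functional_L2: "blinfun_apply (\<mu> :: 'a \<Rightarrow>\<^sub>L real) \<in> L2 \<eta>"
  by (simp add: L2_def integrable_functional_sq)

lemma gaussian_H_L2: "\<xi> \<in> gaussian_H \<eta> \<Longrightarrow> \<xi> \<in> L2 \<eta>"
  by (simp add: gaussian_H_def L2_def)

sublocale inner_form "\<lambda>\<mu> \<nu> :: 'a \<Rightarrow>\<^sub>L real. H_inner \<eta> (blinfun_apply \<mu>) (blinfun_apply \<nu>)"
proof
  fix \<mu> \<nu> \<rho> :: "'a \<Rightarrow>\<^sub>L real" and c :: real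
  show "H_inner \<eta> (blinfun_apply (\<mu> + \<nu>)) \<rho> = H_inner \<eta> \<mu> \<rho> + H_inner \<eta> \<nu> \<rho>"
    using H_inner_add[OF functional_L2 functional_L2 functional_L2] by (simp add: plus_blinfun.rep_eq)
  show "H_inner \<eta> (blinfun_apply (c *\<^sub>R \<mu>)) \<nu> = c * H_inner \<eta> \<mu> \<nu>"
    using H_inner_scale by (simp add: scaleR_blinfun.rep_eq)
  show "H_inner \<eta> \<mu> \<nu> = H_inner \<eta> \<nu> \<mu>"
    by (rule H_inner_commute)
  show "0 \<le> H_inner \<eta> \<mu> \<mu>"
    by (rule H_inner_nonneg)
  show "H_inner \<eta> \<mu> \<mu> = 0 \<Longrightarrow> \<mu> = 0"
    using functional_nondegenerate by (simp add: H_inner_self)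
qed

lemma H_norm_functional: "H_norm \<eta> (blinfun_apply \<mu>) = nrm \<mu>" for \<mu> :: "'a \<Rightarrow>\<^sub>L real"
  by (simp add: H_norm_def nrm_def)

lemma H_norm_functional_diff: "H_norm \<eta> (\<lambda>x. \<mu> x - \<nu> x) = nrm (\<mu> - \<nu>)" for \<mu> \<nu> :: "'a \<Rightarrow>\<^sub>L real"
  using H_norm_functional[of "\<mu> - \<nu>"] by (simp add: minus_blinfun.rep_eq)

definition second_moment :: real where "second_moment = (\<integral>x. (norm x)\<^sup>2 \<partial>\<eta>)"

lemma norm_L2: "norm \<in> L2 \<eta>"
  by (simp add: L2_def integrable_norm_sq)

lemma J_integrable:
  assumes "\<xi> \<in> L2 \<eta>"
  shows "integrable \<eta> (\<lambda>x. \<xi> x *\<^sub>R x)"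
proof (rule Bochner_Integration.integrable_bound)
  show "integrable \<eta> (\<lambda>x. \<xi> x * norm x)"
    using assms norm_L2 by (rule L2_mult)
qed (use assms in \<open>auto simp: abs_mult\<close>)

lemma functional_J:
  assumes "\<xi> \<in> L2 \<eta>"
  shows "blinfun_apply \<mu> (gaussian_J \<eta> \<xi>) = H_inner \<eta> \<mu> \<xi>"
  using integral_bounded_linear[OF blinfun.bounded_linear_right J_integrable[OF assms], of \<mu>]
  by (simp add: gaussian_J_def H_inner_def blinfun.scaleR_right mult.commute)

lemma J_diff:
  assumes "\<xi> \<in> L2 \<eta>" "\<xi>' \<in> L2 \<eta>"
  shows "gaussian_J \<eta> (\<lambda>x. \<xi> x - \<xi>' x) = gaussian_J \<eta> \<xi> - gaussian_J \<eta> \<xi>'"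
  using assms J_integrable by (simp add: gaussian_J_def scaleR_left_diff_distrib)

lemma J_minus: "gaussian_J \<eta> (\<lambda>x. - \<xi> x) = - gaussian_J \<eta> \<xi>"
  by (simp add: gaussian_J_def)

lemma norm_J_le:
  assumes "\<xi> \<in> L2 \<eta>"
  shows "norm (gaussian_J \<eta> \<xi>) \<le> H_norm \<eta> \<xi> * sqrt second_moment"
proof -
  have a: "(\<lambda>x. \<bar>\<xi> x\<bar>) \<in> L2 \<eta>"
    using assms by (auto simp: L2_def)
  have "norm (gaussian_J \<eta> \<xi>) \<le> (\<integral>x. norm (\<xi> x *\<^sub>R x) \<partial>\<eta>)"
    unfolding gaussian_J_def by (rule integral_norm_bound)
  also have "\<dots> = H_inner \<eta> (\<lambda>x. \<bar>\<xi> x\<bar>) norm"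
    by (simp add: H_inner_def)
  also have "\<dots> \<le> H_norm \<eta> (\<lambda>x. \<bar>\<xi> x\<bar>) * H_norm \<eta> norm"
    by (rule H_inner_le[OF a norm_L2])
  also have "\<dots> = H_norm \<eta> \<xi> * sqrt second_moment"
    by (simp add: H_norm_def H_inner_self second_moment_def)
  finally show ?thesis .
qed

end

section \<open>Weak* compact sets and resolvents of the game\<close>

text \<open>Evaluations are weak* continuous, so \<open>K\<close> is pointwise bounded; Baire's
  theorem for the closed sets \<open>F n\<close> gives a ball where the bound is uniform, and
  homogeneity spreads it to the whole space.\<close>

lemma weak_star_compact_bounded:
  fixes K :: "('a::banach \<Rightarrow>\<^sub>L real) set"
  assumes K: "compactin weak_star_topology K"
  shows "\<exists>C>0. \<forall>\<mu>\<in>K. norm \<mu> \<le> C"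
proof -
  have pw: "\<exists>c. \<forall>\<mu>\<in>K. \<bar>\<mu> x\<bar> \<le> c" for x
  proof -
    have "compactin euclideanreal ((\<lambda>\<mu>. blinfun_apply \<mu> x) ` K)"
      by (rule image_compactin[OF K strong_operator_topology_continuous_evaluation])
    then have "bounded ((\<lambda>\<mu>. blinfun_apply \<mu> x) ` K)"
      by (simp add: compact_imp_bounded)
    then show ?thesis
      by (auto simp: bounded_iff)
  qed
  define F where "F n = {x. \<forall>\<mu>\<in>K. \<bar>blinfun_apply \<mu> x\<bar> \<le> real n}" for n :: nat
  have "closed (F n)" for n
  proof -
    have "F n = (\<Inter>\<mu>\<in>K. {x. \<bar>blinfun_apply \<mu> x\<bar> \<le> real n})"
      by (auto simp: F_def)
    moreover have "closed {x. \<bar>blinfun_apply \<mu> x\<bar> \<le> real n}" for \<mu> :: "'a \<Rightarrow>\<^sub>L real"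
      by (intro closed_Collect_le continuous_intros)
    ultimately show ?thesis by auto
  qed
  moreover have "(\<Union>n. F n) = UNIV"
  proof safe
    fix x
    obtain c where c: "\<forall>\<mu>\<in>K. \<bar>blinfun_apply \<mu> x\<bar> \<le> c" using pw by blast
    obtain n where "c \<le> real n" using real_arch_simple by blast
    then have "x \<in> F n" using c by (auto simp: F_def intro: order_trans)
    then show "x \<in> (\<Union>n. F n)" by blast
  qed simp
  ultimately have "\<exists>n. interior (F n) \<noteq> {}"
    using Baire_category_alt[of "euclidean :: 'a topology" "range F"] completely_metrizable_space_euclidean
    by auto
  then obtain n x0 where "x0 \<in> interior (F n)" by blast
  then obtain r where r: "r > 0" "ball x0 r \<subseteq> F n"
    by (meson interior_subset open_contains_ball open_interior order_trans)
  have x0: "x0 \<in> F n" using r by auto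
  have "norm \<mu> \<le> 4 * (real n + 1) / r" if \<mu>: "\<mu> \<in> K" for \<mu>
  proof (rule norm_blinfun_bound)
    show "0 \<le> 4 * (real n + 1) / r" using r by simp
    fix y
    show "norm (blinfun_apply \<mu> y) \<le> 4 * (real n + 1) / r * norm y"
    proof (cases "y = 0")
      case False
      \<comment> \<open>Half the radius, so that \<open>x0 + c *\<^sub>R y\<close> stays in the
        ball; \<open>c\<close> times the value at \<open>y\<close> is then a difference of two
        values bounded by \<open>n\<close>.\<close>
      define c where "c = r / (2 * norm y)"
      have c: "c > 0" using r False by (simp add: c_def)
      have "x0 + c *\<^sub>R y \<in> ball x0 r"
        using r False by (simp add: c_def dist_norm)
      then have "x0 + c *\<^sub>R y \<in> F n" using r by blast
      then have "\<bar>\<mu> (x0 + c *\<^sub>R y)\<bar> \<le> real n" "\<bar>\<mu> x0\<bar> \<le> real n"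
        using x0 \<mu> by (auto simp: F_def)
      then have "\<bar>c * \<mu> y\<bar> \<le> 2 * (real n + 1)"
        by (simp add: blinfun.bilinear_simps)
      then have "c * \<bar>\<mu> y\<bar> \<le> 2 * (real n + 1)"
        using c by (simp add: abs_mult)
      then have "\<bar>\<mu> y\<bar> \<le> 2 * (real n + 1) / c"
        using c by (simp add: field_simps)
      also have "\<dots> = 4 * (real n + 1) / r * norm y"
        by (simp add: c_def)
      finally show ?thesis by simp
    qed simp
  qed
  then show ?thesis
    using r by (intro exI[of _ "4 * (real n + 1) / r"]) auto
qed

section \<open>The game; weak* and \<open>L^2\<close> topology on \<open>K\<close>\<close>

locale game = gaussian \<eta>
  for \<eta> :: "'a::{banach, second_countable_topology} measure" +
  fixes K :: "('a \<Rightarrow>\<^sub>L real) set" and G :: "('a \<Rightarrow>\<^sub>L real) \<Rightarrow> ('a \<Rightarrow>\<^sub>L real) \<Rightarrow> real"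
  assumes K_nonempty: "K \<noteq> {}" and K_convex: "convex K" and K_compact: "compactin weak_star_topology K"
    and G_cont: "continuous_map
           (prod_topology (subtopology weak_star_topology K) (subtopology weak_star_topology K))
           euclideanreal (\<lambda>(\<mu>, \<nu>). G \<mu> \<nu>)"
    and G_convex: "\<forall>\<mu>\<in>K. convex_on K (G \<mu>)"
    and G_mono: "monotone_game K G"
begin

abbreviation BH :: "('a \<Rightarrow>\<^sub>L real) \<Rightarrow> ('a \<Rightarrow>\<^sub>L real) \<Rightarrow> real" where
  "BH \<mu> \<nu> \<equiv> H_inner \<eta> (blinfun_apply \<mu>) (blinfun_apply \<nu>)"

abbreviation T :: "('a \<Rightarrow>\<^sub>L real) topology" where "T \<equiv> subtopology weak_star_topology K"

lemma topspace_weak_star [simp]: "topspace (weak_star_topology :: ('a \<Rightarrow>\<^sub>L real) topology) = UNIV"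
  by (rule strong_operator_topology_topspace)

lemma topspace_T: "topspace T = K"
  by simp

lemma compact_T: "compact_space T"
  using K_compact by (simp add: compactin_subspace)

lemma continuous_eval: "continuous_map T euclideanreal (\<lambda>\<mu>. blinfun_apply \<mu> x)"
  by (intro continuous_map_from_subtopology strong_operator_topology_continuous_evaluation)

definition bound :: real where "bound = (SOME C. C > 0 \<and> (\<forall>\<mu>\<in>K. norm \<mu> \<le> C))"

lemma bound: "bound > 0" "\<mu> \<in> K \<Longrightarrow> norm \<mu> \<le> bound"
  using someI_ex[of "\<lambda>C. C > 0 \<and> (\<forall>\<mu>\<in>K. norm \<mu> \<le> C)"] weak_star_compact_bounded[OF K_compact]
  unfolding bound_def by blast+

lemma abs_apply_le:
  assumes "\<mu> \<in> K" "\<nu> \<in> K"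
  shows "\<bar>blinfun_apply (\<mu> - \<nu>) x\<bar> \<le> 2 * bound * norm x"
proof -
  have "norm (\<mu> - \<nu>) \<le> 2 * bound"
    using norm_triangle_ineq4[of \<mu> \<nu>] bound(2)[OF assms(1)] bound(2)[OF assms(2)] by linarith
  then show ?thesis
    using norm_blinfun[of "\<mu> - \<nu>" x] mult_right_mono[of "norm (\<mu> - \<nu>)" "2 * bound" "norm x"] by simp
qed

text \<open>Finitely many balls of radius \<open>\<delta>\<close> around points of a countable dense
  set leave out a set carrying little of the second moment. Inside the balls \<open>K\<close> is
  equicontinuous, so closeness at the centres suffices; outside, the bound
  \<open>4 * bound\<^sup>2 * (norm x)\<^sup>2\<close> does.\<close>

lemma weak_star_controls_nrm:
  assumes "\<epsilon> > 0"
  shows "\<exists>F \<delta>. finite F \<and> \<delta> > 0 \<and> (\<forall>\<mu>\<in>K. \<forall>\<nu>\<in>K. (\<forall>x\<in>F. \<bar>blinfun_apply (\<mu> - \<nu>) x\<bar> < \<delta>) \<longrightarrow> nrm (\<mu> - \<nu>) < \<epsilon>)"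
proof -
  obtain D :: "'a set" where D: "countable D" "\<And>U. open U \<Longrightarrow> U \<noteq> {} \<Longrightarrow> \<exists>d\<in>D. d \<in> U"
    using countable_dense_setE by blast
  have "D \<noteq> {}" using D(2)[of UNIV] by auto
  define d where "d = from_nat_into D"
  \<comment> \<open>Gives \<open>\<delta> * (1 + 2 * bound) = \<epsilon> / 2\<close>; with the
    threshold for the second moment below, the two contributions add up to
    \<open>3 / 4 * \<epsilon>\<^sup>2\<close>.\<close>
  define \<delta> where "\<delta> = \<epsilon> / (2 * (1 + 2 * bound))"
  have \<delta>: "\<delta> > 0" using assms bound(1) by (simp add: \<delta>_def)
  define U where "U n = (\<Union>i<n. ball (d i) \<delta>)" for n :: nat
  have openU: "open (U n)" for n by (auto simp: U_def)
  have ex: "\<exists>i. x \<in> ball (d i) \<delta>" for x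
  proof -
    obtain e where "e \<in> D" "e \<in> ball x \<delta>" using D(2)[of "ball x \<delta>"] \<delta> by auto
    then show ?thesis
      using from_nat_into_surj[OF D(1)] by (force simp: d_def dist_commute)
  qed
  have m [measurable]: "- U n \<in> sets \<eta>" for n
    unfolding sets_eta using openU by (auto simp: borel_comp)
  have int: "integrable \<eta> (\<lambda>x. (norm x)\<^sup>2 * indicator (- U n) x)" for n
    using integrable_norm_sq m by (intro integrable_real_mult_indicator)
  have "(\<lambda>n. \<integral>x. (norm x)\<^sup>2 * indicator (- U n) x \<partial>\<eta>) \<longlonglongrightarrow> (\<integral>x. 0 \<partial>\<eta>)"
  proof (rule integral_dominated_convergence[where w = "\<lambda>x. (norm x)\<^sup>2"])
    show "AE x in \<eta>. (\<lambda>n. (norm x)\<^sup>2 * indicator (- U n) x) \<longlonglongrightarrow> 0"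
    proof (rule AE_I2)
      fix x
      obtain i where "x \<in> ball (d i) \<delta>" using ex by blast
      then have "x \<in> U n" if "n \<ge> Suc i" for n
        using that by (auto simp: U_def)
      then have "\<forall>\<^sub>F n in sequentially. (norm x)\<^sup>2 * indicator (- U n) x = 0"
        by (auto simp: eventually_sequentially intro!: exI[of _ "Suc i"])
      then show "(\<lambda>n. (norm x)\<^sup>2 * indicator (- U n) x) \<longlonglongrightarrow> 0"
        by (rule tendsto_eventually)
    qed
    show "AE x in \<eta>. norm ((norm x)\<^sup>2 * indicator (- U n) x) \<le> (norm x)\<^sup>2" for n
      by (rule AE_I2) (auto simp: indicator_def)
  qed (use integrable_norm_sq in auto)
  then have "\<forall>\<^sub>F n in sequentially. (\<integral>x. (norm x)\<^sup>2 * indicator (- U n) x \<partial>\<eta>) < \<epsilon>\<^sup>2 / (8 * bound\<^sup>2)"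
    using assms bound(1) by (intro order_tendstoD) auto
  then obtain n where n: "(\<integral>x. (norm x)\<^sup>2 * indicator (- U n) x \<partial>\<eta>) < \<epsilon>\<^sup>2 / (8 * bound\<^sup>2)"
    by (auto simp: eventually_sequentially)
  have "nrm (\<mu> - \<nu>) < \<epsilon>" if K: "\<mu> \<in> K" "\<nu> \<in> K" and close: "\<And>x. x \<in> d ` {..<n} \<Longrightarrow> \<bar>blinfun_apply (\<mu> - \<nu>) x\<bar> < \<delta>" for \<mu> \<nu>
  proof -
    let ?\<rho> = "\<mu> - \<nu>"
    have pw: "(?\<rho> x)\<^sup>2 \<le> (\<epsilon> / 2)\<^sup>2 + 4 * bound\<^sup>2 * ((norm x)\<^sup>2 * indicator (- U n) x)" for x
    proof (cases "x \<in> U n")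
      case True
      then obtain i where i: "i < n" "x \<in> ball (d i) \<delta>" by (auto simp: U_def)
      have "?\<rho> x = ?\<rho> (d i) + ?\<rho> (x - d i)"
        by (simp add: blinfun.bilinear_simps)
      moreover have "\<bar>?\<rho> (x - d i)\<bar> \<le> 2 * bound * \<delta>"
      proof -
        have "norm (x - d i) \<le> \<delta>"
          using i(2) by (simp add: dist_norm norm_minus_commute)
        then have "2 * bound * norm (x - d i) \<le> 2 * bound * \<delta>"
          using bound(1) by (intro mult_left_mono) auto
        then show ?thesis
          using abs_apply_le[OF K, of "x - d i"] by linarith
      qed
      moreover have "\<bar>?\<rho> (d i)\<bar> < \<delta>" using close i by blast
      ultimately have "\<bar>?\<rho> x\<bar> \<le> \<delta> * (1 + 2 * bound)"
        by (simp add: algebra_simps)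
      also have "\<dots> = \<epsilon> / 2" using bound(1) by (simp add: \<delta>_def field_simps)
      finally have "\<bar>?\<rho> x\<bar>\<^sup>2 \<le> (\<epsilon> / 2)\<^sup>2" by (intro power_mono) auto
      then show ?thesis using True by simp
    next
      case False
      have "\<bar>?\<rho> x\<bar>\<^sup>2 \<le> (2 * bound * norm x)\<^sup>2"
        using abs_apply_le[OF K, of x] by (intro power_mono) auto
      then have "(?\<rho> x)\<^sup>2 \<le> 4 * bound\<^sup>2 * (norm x)\<^sup>2"
        by (simp add: power_mult_distrib)
      then show ?thesis
        using False by (simp add: add_increasing)
    qed
    have "(nrm ?\<rho>)\<^sup>2 = (\<integral>x. (?\<rho> x)\<^sup>2 \<partial>\<eta>)"
      by (simp only: nrm_sq H_inner_self)
    also have "\<dots> \<le> (\<integral>x. (\<epsilon> / 2)\<^sup>2 + 4 * bound\<^sup>2 * ((norm x)\<^sup>2 * indicator (- U n) x) \<partial>\<eta>)"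
      using int[of n] by (intro integral_mono pw integrable_functional_sq Bochner_Integration.integrable_add integrable_mult_right) auto
    also have "\<dots> = (\<epsilon> / 2)\<^sup>2 + 4 * bound\<^sup>2 * (\<integral>x. (norm x)\<^sup>2 * indicator (- U n) x \<partial>\<eta>)"
      using int[of n] prob_space by simp
    also have "\<dots> \<le> (\<epsilon> / 2)\<^sup>2 + 4 * bound\<^sup>2 * (\<epsilon>\<^sup>2 / (8 * bound\<^sup>2))"
      using n by (intro add_left_mono mult_left_mono) auto
    also have "\<dots> = 3 / 4 * \<epsilon>\<^sup>2"
      using bound(1) by (simp add: power2_eq_square field_simps)
    also have "\<dots> < \<epsilon>\<^sup>2"
      using assms by simp
    finally show ?thesis
      using assms by (auto intro: power2_less_imp_less)
  qed
  then show ?thesis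
    using \<delta> by (intro exI[of _ "d ` {..<n}"] exI[of _ \<delta>]) auto
qed

lemma continuous_nrm_diff: "continuous_map T euclideanreal (\<lambda>\<nu>. nrm (\<nu> - \<rho>))"
  unfolding mtopology_is_euclidean[symmetric] Met_TC.continuous_map_to_metric
proof (intro ballI allI impI)
  fix \<mu> and \<epsilon> :: real assume \<mu>: "\<mu> \<in> topspace T" and "\<epsilon> > 0"
  obtain F \<delta> where F: "finite F" "\<delta> > 0"
    "\<And>\<nu>. \<nu> \<in> K \<Longrightarrow> (\<forall>x\<in>F. \<bar>blinfun_apply (\<nu> - \<mu>) x\<bar> < \<delta>) \<Longrightarrow> nrm (\<nu> - \<mu>) < \<epsilon>"
    using weak_star_controls_nrm[OF \<open>\<epsilon> > 0\<close>] \<mu> by (metis topspace_T)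
  define V where "V = {\<nu> \<in> topspace T. \<forall>x\<in>F. blinfun_apply \<nu> x \<in> ball (blinfun_apply \<mu> x) \<delta>}"
  have "V = topspace T \<inter> \<Inter>((\<lambda>x. {\<nu> \<in> topspace T. blinfun_apply \<nu> x \<in> ball (blinfun_apply \<mu> x) \<delta>}) ` F)"
    by (auto simp: V_def)
  moreover have "openin T (topspace T \<inter> \<Inter>((\<lambda>x. {\<nu> \<in> topspace T. blinfun_apply \<nu> x \<in> ball (blinfun_apply \<mu> x) \<delta>}) ` F))"
  proof (rule openin_Int_Inter)
    show "openin T X" if X: "X \<in> (\<lambda>x. {\<nu> \<in> topspace T. blinfun_apply \<nu> x \<in> ball (blinfun_apply \<mu> x) \<delta>}) ` F" for X
    proof -
      obtain x where "X = {\<nu> \<in> topspace T. blinfun_apply \<nu> x \<in> ball (blinfun_apply \<mu> x) \<delta>}" using X by blast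
      then show ?thesis
        using openin_continuous_map_preimage[OF continuous_eval, of "ball (blinfun_apply \<mu> x) \<delta>" x] by simp
    qed
  qed (use F openin_topspace[of T] in auto)
  ultimately have "openin T V" by simp
  moreover have "\<mu> \<in> V" using \<mu> F(2) by (auto simp: V_def)
  moreover have "nrm (\<nu> - \<rho>) \<in> Met_TC.mball (nrm (\<mu> - \<rho>)) \<epsilon>" if "\<nu> \<in> V" for \<nu>
  proof -
    have "nrm (\<nu> - \<mu>) < \<epsilon>"
      using that F(3)[of \<nu>] by (auto simp: V_def dist_real_def blinfun.diff_left abs_minus_commute)
    then show ?thesis
      using nrm_diff_le[of "\<mu> - \<rho>" "\<nu> - \<rho>"] nrm_minus_commute[of \<mu> \<nu>] by (simp add: dist_real_def)
  qed
  ultimately show "\<exists>U. openin T U \<and> \<mu> \<in> U \<and> (\<forall>y\<in>U. nrm (y - \<rho>) \<in> Met_TC.mball (nrm (\<mu> - \<rho>)) \<epsilon>)"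
    by blast
qed

text \<open>Converse of \<open>weak_star_controls_nrm\<close>: on the compact set
  \<open>K - U\<close> the continuous function \<open>nrm (\<nu> - \<mu>)\<close> avoids 0, hence
  stays away from it.\<close>

lemma nrm_controls_weak_star:
  assumes U: "openin T U" "\<mu> \<in> U"
  shows "\<exists>\<delta>>0. \<forall>\<nu>\<in>K. nrm (\<nu> - \<mu>) < \<delta> \<longrightarrow> \<nu> \<in> U"
proof -
  have "closedin T (topspace T - U)"
    using U(1) by (intro closedin_diff) auto
  then have "compactin T (K - U)"
    using compact_T by (intro closedin_compact_space) auto
  then have "compactin euclideanreal ((\<lambda>\<nu>. nrm (\<nu> - \<mu>)) ` (K - U))"
    by (rule image_compactin[OF _ continuous_nrm_diff])
  then have "closed ((\<lambda>\<nu>. nrm (\<nu> - \<mu>)) ` (K - U))"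
    by (simp add: compact_imp_closed)
  moreover have "0 \<notin> (\<lambda>\<nu>. nrm (\<nu> - \<mu>)) ` (K - U)"
    using U(2) by (auto simp: image_iff)
  ultimately obtain \<delta> where "\<delta> > 0" "ball 0 \<delta> \<subseteq> - ((\<lambda>\<nu>. nrm (\<nu> - \<mu>)) ` (K - U))"
    using open_contains_ball[of "- ((\<lambda>\<nu>. nrm (\<nu> - \<mu>)) ` (K - U))"] open_Compl by blast
  then show ?thesis
    by (intro exI[of _ \<delta>]) (auto simp: subset_eq)
qed

lemma limitin_T:
  assumes "((\<lambda>n. nrm (f n - \<mu>)) \<longlongrightarrow> 0) F" "\<forall>\<^sub>F n in F. f n \<in> K" "\<mu> \<in> K"
  shows "limitin T f \<mu> F"
  unfolding limitin_def
proof (intro conjI allI impI)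
  fix U assume U: "openin T U \<and> \<mu> \<in> U"
  then obtain \<delta> where d: "\<delta> > 0" "\<forall>\<nu>\<in>K. nrm (\<nu> - \<mu>) < \<delta> \<longrightarrow> \<nu> \<in> U"
    using nrm_controls_weak_star by blast
  have "\<forall>\<^sub>F n in F. nrm (f n - \<mu>) < \<delta>"
    using assms(1) d(1) by (rule order_tendstoD)
  then show "\<forall>\<^sub>F n in F. f n \<in> U"
    using assms(2) by eventually_elim (use d in auto)
qed (use assms in simp)

lemma tendsto_eval:
  assumes "((\<lambda>n. nrm (f n - \<mu>)) \<longlongrightarrow> 0) F" "\<forall>\<^sub>F n in F. f n \<in> K" "\<mu> \<in> K"
  shows "((\<lambda>n. blinfun_apply (f n) x) \<longlongrightarrow> blinfun_apply \<mu> x) F"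
  using continuous_map_limit[OF continuous_eval limitin_T[OF assms], of x] by (simp add: o_def)

lemma tendsto_G:
  assumes f: "((\<lambda>n. nrm (f n - \<mu>)) \<longlongrightarrow> 0) F" "\<forall>\<^sub>F n in F. f n \<in> K" "\<mu> \<in> K"
    and g: "((\<lambda>n. nrm (g n - \<nu>)) \<longlongrightarrow> 0) F" "\<forall>\<^sub>F n in F. g n \<in> K" "\<nu> \<in> K"
  shows "((\<lambda>n. G (f n) (g n)) \<longlongrightarrow> G \<mu> \<nu>) F"
proof -
  have "limitin (prod_topology T T) (\<lambda>n. (f n, g n)) (\<mu>, \<nu>) F"
    using limitin_T[OF f] limitin_T[OF g] by (simp add: limitin_pairwise o_def)
  from continuous_map_limit[OF G_cont this] show ?thesis
    by (simp add: o_def)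
qed

text \<open>Only subgradients that are images under \<open>J\<close> of functionals are recorded, so
  that the relation fits \<open>inner_form\<close>; general elements of \<open>gaussian_H\<close>
  enter through \<open>monotone_pairing\<close>.\<close>

definition A :: "(('a \<Rightarrow>\<^sub>L real) \<times> ('a \<Rightarrow>\<^sub>L real)) set" where
  "A = {(\<mu>, y). \<mu> \<in> K \<and> gaussian_J \<eta> (blinfun_apply y) \<in> diag_subdiff K G \<mu>}"

lemma apply_J: "blinfun_apply \<mu> (gaussian_J \<eta> (blinfun_apply y)) = BH \<mu> y" for y :: "'a \<Rightarrow>\<^sub>L real"
  by (rule functional_J[OF functional_L2])

lemma A_iff: "(\<mu>, y) \<in> A \<longleftrightarrow> \<mu> \<in> K \<and> (\<forall>\<nu>\<in>K. G \<mu> \<nu> \<ge> G \<mu> \<mu> + BH (\<nu> - \<mu>) y)"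
  by (simp add: A_def diag_subdiff_def apply_J)

text \<open>Stated for arbitrary square-integrable representatives, since the initial point and
  competing solutions come with elements of \<open>gaussian_H\<close> rather than
  functionals.\<close>

lemma monotone_pairing:
  assumes "\<mu> \<in> K" "\<nu> \<in> K" "\<xi> \<in> L2 \<eta>" "\<xi>' \<in> L2 \<eta>"
    and "gaussian_J \<eta> \<xi> \<in> diag_subdiff K G \<mu>" "gaussian_J \<eta> \<xi>' \<in> diag_subdiff K G \<nu>"
  shows "0 \<le> H_inner \<eta> (blinfun_apply (\<mu> - \<nu>)) (\<lambda>x. \<xi> x - \<xi>' x)"
  using G_mono assms(1,2,5,6) unfolding monotone_game_def
  by (simp add: J_diff[OF assms(3,4)] flip: functional_J[OF L2_diff[OF assms(3,4)]])

lemma continuous_G_right: "\<mu> \<in> K \<Longrightarrow> continuous_map T euclideanreal (\<lambda>x. G x \<mu>)"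
  and continuous_G_diag: "continuous_map T euclideanreal (\<lambda>x. G x x)"
proof -
  have *: "continuous_map T euclideanreal (\<lambda>x. G x (h x))" if "continuous_map T T h" for h
  proof -
    have "continuous_map T (prod_topology T T) (\<lambda>x. (x, h x))"
      using that by (intro continuous_map_pairedI) auto
    from continuous_map_compose[OF this G_cont] show ?thesis
      by (simp add: o_def)
  qed
  show "\<mu> \<in> K \<Longrightarrow> continuous_map T euclideanreal (\<lambda>x. G x \<mu>)"
    by (rule *) simp
  show "continuous_map T euclideanreal (\<lambda>x. G x x)"
    by (rule *) simp
qed

lemma resolvent_exists:
  assumes l: "l > 0" and \<nu>: "\<nu> \<in> K"
  shows "\<exists>x\<in>K. (x, (1 / l) *\<^sub>R (\<nu> - x)) \<in> A"
proof -
  define f where "f x w = G x w - G x x - BH (w - x) ((1 / l) *\<^sub>R (\<nu> - x))" for x w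
  have "\<exists>x\<in>K. \<forall>w\<in>K. f x w \<ge> 0"
  proof (rule ky_fan[where X = T])
    show "compact_space T" by (rule compact_T)
    show "topspace T = K" by simp
    show "convex K" by (rule K_convex)
    show "K \<noteq> {}" by (rule K_nonempty)
    show "f x x \<ge> 0" for x by (simp add: f_def)
    show "continuous_map T euclideanreal (\<lambda>x. f x w)" if "w \<in> K" for w
    proof -
      \<comment> \<open>Polarization expresses the pairing through distances to fixed points, whose
        weak* continuity is \<open>continuous_nrm_diff\<close>.\<close>
      have "BH (w - x) (\<nu> - x) = ((nrm (x - w))\<^sup>2 + (nrm (x - \<nu>))\<^sup>2 - (nrm (w - \<nu>))\<^sup>2) / 2" for x
        using B_commute[of x w] B_commute[of x \<nu>] B_commute[of w \<nu>] by (simp add: nrm_sq bilin)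
      then have "(\<lambda>x. f x w) = (\<lambda>x. G x w - G x x - (1 / l) * (((nrm (x - w))\<^sup>2 + (nrm (x - \<nu>))\<^sup>2 - (nrm (w - \<nu>))\<^sup>2) / 2))"
        unfolding f_def B_scale2 by presburger
      then show ?thesis
        by (simp only:) (intro continuous_intros continuous_G_right continuous_G_diag continuous_nrm_diff that, simp_all)
    qed
    show "convex_on K (f x)" if x: "x \<in> K" for x
    proof (rule convex_onI)
      fix t :: real and u v assume t: "0 < t" "t < 1" and uv: "u \<in> K" "v \<in> K"
      have "G x ((1 - t) *\<^sub>R u + t *\<^sub>R v) \<le> (1 - t) * G x u + t * G x v"
        using convex_onD[of K "G x" t u v] G_convex x t uv by auto
      moreover have "BH ((1 - t) *\<^sub>R u + t *\<^sub>R v - x) ((1 / l) *\<^sub>R (\<nu> - x)) =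
          (1 - t) * BH (u - x) ((1 / l) *\<^sub>R (\<nu> - x)) + t * BH (v - x) ((1 / l) *\<^sub>R (\<nu> - x))"
        by (simp only: B_diff B_add B_scale) (simp add: algebra_simps)
      ultimately show "f x ((1 - t) *\<^sub>R u + t *\<^sub>R v) \<le> (1 - t) * f x u + t * f x v"
        by (simp add: f_def algebra_simps)
    qed (rule K_convex)
    \<comment> \<open>Weak* continuity is tested at one vector at a time, where the combination is a
      finite sum of scalars.\<close>
    show "continuous_map (top_of_set C) T (\<lambda>a. \<Sum>i\<le>n. c a i *\<^sub>R v i)"
      if "\<And>i. i \<le> n \<Longrightarrow> v i \<in> K" "\<And>i. i \<le> n \<Longrightarrow> continuous_on C (\<lambda>a. c a i)"
        "\<And>a. a \<in> C \<Longrightarrow> (\<Sum>i\<le>n. c a i *\<^sub>R v i) \<in> K"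
      for v :: "nat \<Rightarrow> 'a \<Rightarrow>\<^sub>L real" and n and C :: "(nat \<Rightarrow> real) set" and c
      unfolding continuous_map_in_subtopology continuous_on_strong_operator_topo_iff_coordinatewise
      using that by (auto simp: blinfun.sum_left blinfun.scaleR_left intro!: continuous_intros)
  qed
  then obtain x where "x \<in> K" "\<And>w. w \<in> K \<Longrightarrow> G x x + BH (w - x) ((1 / l) *\<^sub>R (\<nu> - x)) \<le> G x w"
    by (fastforce simp: f_def)
  then have "(x, (1 / l) *\<^sub>R (\<nu> - x)) \<in> A"
    unfolding A_iff by blast
  with \<open>x \<in> K\<close> show ?thesis by blast
qed

definition R :: "real \<Rightarrow> ('a \<Rightarrow>\<^sub>L real) \<Rightarrow> ('a \<Rightarrow>\<^sub>L real)" where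
  "R l \<nu> = (SOME x. x \<in> K \<and> (x, (1 / l) *\<^sub>R (\<nu> - x)) \<in> A)"

sublocale monotone_resolvent "\<lambda>\<mu> \<nu>. H_inner \<eta> (blinfun_apply \<mu>) (blinfun_apply \<nu>)" K A R
proof
  have *: "R l x \<in> K \<and> (R l x, (1 / l) *\<^sub>R (x - R l x)) \<in> A" if "l > 0" "x \<in> K" for l x
    using someI_ex[of "\<lambda>z. z \<in> K \<and> (z, (1 / l) *\<^sub>R (x - z)) \<in> A"] resolvent_exists[OF that] by (auto simp: R_def)
  show "l > 0 \<Longrightarrow> x \<in> K \<Longrightarrow> R l x \<in> K" "l > 0 \<Longrightarrow> x \<in> K \<Longrightarrow> (R l x, (1 / l) *\<^sub>R (x - R l x)) \<in> A" for l x
    using * by auto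
  show "(x, y) \<in> A \<Longrightarrow> (x', y') \<in> A \<Longrightarrow> BH (x - x') (y - y') \<ge> 0" for x y x' y'
    using monotone_pairing[of x x' "blinfun_apply y" "blinfun_apply y'"] functional_L2
    by (auto simp: A_def minus_blinfun.rep_eq)
qed

text \<open>Counterpart of \<open>Y_le\<close> for the initial point, whose subgradient may come
  from an element of \<open>H\<close> outside the dual space; the same test of monotonicity
  works.\<close>

lemma Y_le_H_norm:
  assumes x: "x \<in> K" and \<xi>: "\<xi> \<in> L2 \<eta>" "gaussian_J \<eta> \<xi> \<in> diag_subdiff K G x" and l: "l > 0"
  shows "nrm (Y l x) \<le> H_norm \<eta> \<xi>"
proof -
  have RA: "R l x \<in> K" "gaussian_J \<eta> (blinfun_apply (Y l x)) \<in> diag_subdiff K G (R l x)"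
    using Y_A[OF l x] by (auto simp: A_def)
  have "0 \<le> H_inner \<eta> (blinfun_apply (x - R l x)) (\<lambda>z. \<xi> z - Y l x z)"
    using monotone_pairing[OF x RA(1) \<xi>(1) functional_L2 \<xi>(2) RA(2)] .
  also have "\<dots> = H_inner \<eta> \<xi> (blinfun_apply (x - R l x)) - BH (Y l x) (x - R l x)"
    using H_inner_diff[OF \<xi>(1) functional_L2 functional_L2] H_inner_commute by metis
  also have "x - R l x = l *\<^sub>R Y l x"
    using l by (simp add: R_eq)
  also have "H_inner \<eta> \<xi> (blinfun_apply (l *\<^sub>R Y l x)) = l * H_inner \<eta> \<xi> (Y l x)"
    using H_inner_scale[of \<eta> l "blinfun_apply (Y l x)" \<xi>] H_inner_commute[of \<eta> \<xi>]
    by (simp add: scaleR_blinfun.rep_eq)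
  finally have "0 \<le> l * (H_inner \<eta> \<xi> (Y l x) - BH (Y l x) (Y l x))"
    by (simp add: B_scale2 algebra_simps)
  then have "nrm (Y l x) * nrm (Y l x) \<le> H_norm \<eta> \<xi> * nrm (Y l x)"
    using l H_inner_le[OF \<xi>(1) functional_L2, of "Y l x"] nrm_sq[of "Y l x"] H_norm_functional[of "Y l x"]
    by (simp add: zero_le_mult_iff power2_eq_square)
  then show ?thesis
    using nrm_nonneg[of "Y l x"] H_norm_nonneg[of \<eta> \<xi>] mult_le_cancel_right[of "nrm (Y l x)" "nrm (Y l x)" "H_norm \<eta> \<xi>"]
    by linarith
qed

text \<open>Tychonoff's theorem for all times at once: \<open>u\<close> lies in the closure of every
  tail of the sequence of curves, and prescribing two coordinates up to \<open>e\<close> is an open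
  condition by weak* continuity of \<open>nrm\<close>.\<close>

lemma euler_cluster:
  assumes x: "x \<in> K"
  shows "\<exists>u. (\<forall>t. u t \<in> K) \<and> (\<forall>s t e N. e > 0 \<longrightarrow>
      (\<exists>n\<ge>N. nrm (euler_curve x n s - u s) < e \<and> nrm (euler_curve x n t - u t) < e))"
proof -
  define P where "P = product_topology (\<lambda>_::real. T) UNIV"
  have comp: "compact_space P"
    unfolding P_def by (simp add: compact_space_product_topology compact_T)
  define E where "E N = (\<lambda>n. euler_curve x n) ` {N..}" for N :: nat
  have EP: "E N \<subseteq> topspace P" for N
    using euler_curve_in[OF x] by (auto simp: E_def P_def)
  have "\<Inter>(range (\<lambda>N. P closure_of E N)) \<noteq> {}"
  proof (rule compact_space_imp_nest[OF comp])
    show "closedin P (P closure_of E N)" for N by simp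
    show "P closure_of E N \<noteq> {}" for N
      using closure_of_subset[OF EP, of N] by (auto simp: E_def)
    show "decseq (\<lambda>N. P closure_of E N)"
      by (auto simp: decseq_def E_def intro!: closure_of_mono)
  qed
  then obtain u where u: "\<And>N. u \<in> P closure_of E N" by blast
  have uK: "u t \<in> K" for t
    using u[of 0] by (auto simp: in_closure_of P_def)
  have "\<exists>n\<ge>N. nrm (euler_curve x n s - u s) < e \<and> nrm (euler_curve x n t - u t) < e" if e: "e > 0" for s t e N
  proof -
    define W where "W r = {g \<in> topspace P. g r \<in> {\<nu> \<in> topspace T. nrm (\<nu> - u r) \<in> {..<e}}}" for r
    have "openin P (W r)" for r
      unfolding W_def
    proof (rule openin_continuous_map_preimage)
      show "continuous_map P T (\<lambda>g. g r)"
        unfolding P_def by (rule continuous_map_product_projection) simp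
      show "openin T {\<nu> \<in> topspace T. nrm (\<nu> - u r) \<in> {..<e}}"
        by (rule openin_continuous_map_preimage[OF continuous_nrm_diff]) auto
    qed
    then have "openin P (W s \<inter> W t)" by auto
    moreover have "u \<in> W s \<inter> W t"
      using uK e by (auto simp: W_def P_def)
    ultimately obtain g where "g \<in> E N" "g \<in> W s \<inter> W t"
      using u[of N] unfolding in_closure_of by blast
    then show ?thesis
      by (auto simp: E_def W_def)
  qed
  then show ?thesis
    using uK by blast
qed

end

section \<open>Existence of the flow\<close>

context game
begin

text \<open>The Yosida approximations converge in \<open>L^2\<close> to some \<open>\<xi>\<close>,
  which need not lie in the dual space. The subgradient inequality at \<open>R l x\<close> passes to
  the limit because \<open>R l x\<close> tends to \<open>x\<close> within \<open>K\<close>,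
  \<open>G\<close> is weak* continuous and \<open>J\<close> is bounded on
  \<open>L^2\<close>.\<close>

lemma minimal_section:
  assumes x: "x \<in> K" and M: "\<And>l. l > 0 \<Longrightarrow> nrm (Y l x) \<le> M"
  shows "\<exists>\<xi>\<in>gaussian_H \<eta>. gaussian_J \<eta> \<xi> \<in> diag_subdiff K G x \<and>
    (\<forall>e>0. \<exists>l0>0. \<forall>l. 0 < l \<and> l \<le> l0 \<longrightarrow> H_norm \<eta> (\<lambda>z. \<xi> z - blinfun_apply (Y l x) z) \<le> e)"
proof -
  have "\<forall>n. \<exists>l0>0. \<forall>l l'. 0 < l' \<and> l' \<le> l \<and> l \<le> l0 \<longrightarrow> nrm (Y l x - Y l' x) \<le> (1 / 2) ^ n"
    using Y_cauchy_at_0[OF x M] by simp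
  then obtain L where L: "\<And>n. L n > 0"
    "\<And>n l l'. 0 < l' \<Longrightarrow> l' \<le> l \<Longrightarrow> l \<le> L n \<Longrightarrow> nrm (Y l x - Y l' x) \<le> (1 / 2) ^ n"
    by metis
  \<comment> \<open>A nonincreasing sequence of parameters with \<open>0 < a n \<le> L n\<close>,
    forced to 0 by the first argument of \<open>min\<close>.\<close>
  define a where "a n = min (1 / real (Suc n)) (Min (L ` {..n}))" for n
  have a0: "a n > 0" for n
    using L(1) by (simp add: a_def)
  have aL: "a n \<le> L n" for n
    by (simp add: a_def min.coboundedI2)
  have adec: "a m \<le> a n" if "n \<le> m" for m n
  proof -
    have "1 / real (Suc m) \<le> 1 / real (Suc n)"
      using that by (intro divide_left_mono) auto
    moreover have "Min (L ` {..m}) \<le> Min (L ` {..n})"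
      using that by (intro Min_antimono) auto
    ultimately show ?thesis
      unfolding a_def by (rule min.mono)
  qed
  have a_lim: "a \<longlonglongrightarrow> 0"
  proof (rule Lim_null_comparison[OF always_eventually])
    show "\<forall>n. norm (a n) \<le> 1 / real (Suc n)"
    proof
      fix n
      have "norm (a n) = a n" using a0[of n] by simp
      also have "\<dots> \<le> 1 / real (Suc n)" unfolding a_def by (rule min.cobounded1)
      finally show "norm (a n) \<le> 1 / real (Suc n)" .
    qed
    show "(\<lambda>n. 1 / real (Suc n)) \<longlonglongrightarrow> 0"
      using LIMSEQ_inverse_real_of_nat by (simp add: inverse_eq_divide)
  qed
  define f where "f n = Y (a n) x" for n
  have "\<exists>\<xi>\<in>L2 \<eta>. \<forall>n. H_norm \<eta> (\<lambda>z. \<xi> z - f n z) \<le> (1 / 2) ^ n"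
  proof (rule L2_complete)
    show "blinfun_apply (f n) \<in> L2 \<eta>" for n by (rule functional_L2)
    show "H_norm \<eta> (\<lambda>z. f m z - f n z) \<le> (1 / 2) ^ n" if "n \<le> m" for m n
      using L(2)[OF a0[of m] adec[OF that] aL] nrm_minus_commute[of "f m" "f n"]
      by (simp add: H_norm_functional_diff f_def)
  qed
  then obtain \<xi> where \<xi>: "\<xi> \<in> L2 \<eta>" "\<And>n. H_norm \<eta> (\<lambda>z. \<xi> z - f n z) \<le> (1 / 2) ^ n"
    by blast
  have small: "\<exists>n. (1 / 2) ^ n < e" if "e > 0" for e :: real
    using real_arch_pow_inv[of e "1 / 2"] that by auto
  have "\<xi> \<in> gaussian_H \<eta>"
    using \<xi> small unfolding gaussian_H_def L2_def by (blast intro: le_less_trans)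
  moreover have "\<exists>l0>0. \<forall>l. 0 < l \<and> l \<le> l0 \<longrightarrow> H_norm \<eta> (\<lambda>z. \<xi> z - Y l x z) \<le> e" if e: "e > 0" for e
  proof -
    obtain n where n: "(1 / 2) ^ n < e / 2"
      using small[of "e / 2"] e by auto
    have "H_norm \<eta> (\<lambda>z. \<xi> z - Y l x z) \<le> e" if l: "0 < l" "l \<le> a n" for l
    proof -
      have "H_norm \<eta> (\<lambda>z. \<xi> z - Y l x z) \<le> H_norm \<eta> (\<lambda>z. \<xi> z - f n z) + H_norm \<eta> (\<lambda>z. f n z - Y l x z)"
        by (intro H_norm_diff_triangle \<xi> functional_L2)
      also have "\<dots> \<le> (1 / 2) ^ n + (1 / 2) ^ n"
        using \<xi>(2) L(2)[OF l aL] by (intro add_mono) (auto simp: H_norm_functional_diff f_def)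
      finally show ?thesis using n by simp
    qed
    then show ?thesis
      using a0 by blast
  qed
  moreover have "gaussian_J \<eta> \<xi> \<in> diag_subdiff K G x"
    unfolding diag_subdiff_def
  proof (clarify)
    fix \<nu> assume \<nu>: "\<nu> \<in> K"
    define r where "r n = R (a n) x" for n
    have rK: "r n \<in> K" for n
      unfolding r_def using R_in a0 x by simp
    have r_lim: "(\<lambda>n. nrm (r n - x)) \<longlonglongrightarrow> 0"
    proof (rule Lim_null_comparison[OF always_eventually])
      show "\<forall>n. norm (nrm (r n - x)) \<le> a n * M"
      proof
        fix n
        have "r n - x = - (a n *\<^sub>R Y (a n) x)"
          using a0[of n] by (simp add: r_def R_eq)
        then have "nrm (r n - x) = a n * nrm (Y (a n) x)"
          using a0[of n] by (simp add: nrm_scale)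
        then show "norm (nrm (r n - x)) \<le> a n * M"
          using M[OF a0[of n]] a0[of n] by (simp add: mult_left_mono)
      qed
      show "(\<lambda>n. a n * M) \<longlonglongrightarrow> 0"
        using tendsto_mult_left_zero[OF a_lim] .
    qed
    let ?J = "\<lambda>n. gaussian_J \<eta> (blinfun_apply (f n))"
    have J_lim: "(\<lambda>n. norm (?J n - gaussian_J \<eta> \<xi>)) \<longlonglongrightarrow> 0"
    proof (rule Lim_null_comparison[OF always_eventually])
      show "\<forall>n. norm (norm (?J n - gaussian_J \<eta> \<xi>)) \<le> (1 / 2) ^ n * sqrt second_moment"
      proof
        fix n
        have "norm (?J n - gaussian_J \<eta> \<xi>) = norm (gaussian_J \<eta> (\<lambda>z. \<xi> z - f n z))"
          by (simp add: J_diff[OF \<xi>(1) functional_L2] norm_minus_commute)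
        also have "\<dots> \<le> H_norm \<eta> (\<lambda>z. \<xi> z - f n z) * sqrt second_moment"
          by (intro norm_J_le L2_diff \<xi> functional_L2)
        also have "\<dots> \<le> (1 / 2) ^ n * sqrt second_moment"
          using \<xi>(2) by (intro mult_right_mono) (auto simp: second_moment_def)
        finally show "norm (norm (?J n - gaussian_J \<eta> \<xi>)) \<le> (1 / 2) ^ n * sqrt second_moment"
          by simp
      qed
      have "(\<lambda>n. (1 / 2 :: real) ^ n) \<longlonglongrightarrow> 0"
        by (rule LIMSEQ_realpow_zero) auto
      then show "(\<lambda>n. (1 / 2) ^ n * sqrt second_moment) \<longlonglongrightarrow> 0"
        by (rule tendsto_mult_left_zero)
    qed
    have const: "(\<lambda>n. nrm (\<nu> - \<nu>)) \<longlonglongrightarrow> 0" for \<nu> :: "'a \<Rightarrow>\<^sub>L real"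
      by simp
    have evK: "\<forall>\<^sub>F n in sequentially. r n \<in> K"
      using rK by simp
    have G1: "(\<lambda>n. G (r n) \<nu>) \<longlonglongrightarrow> G x \<nu>"
      by (rule tendsto_G[OF r_lim evK x const]) (use \<nu> in auto)
    have G2: "(\<lambda>n. G (r n) (r n)) \<longlonglongrightarrow> G x x"
      by (rule tendsto_G[OF r_lim evK x r_lim evK x])
    \<comment> \<open>Both arguments vary: the error in \<open>J\<close> is handled by norm
      convergence and boundedness of \<open>K\<close>, the error in the functional by evaluating at
      the fixed limit.\<close>
    have P: "(\<lambda>n. blinfun_apply (\<nu> - r n) (?J n)) \<longlonglongrightarrow> blinfun_apply (\<nu> - x) (gaussian_J \<eta> \<xi>)"
    proof -
      have "(\<lambda>n. blinfun_apply (\<nu> - r n) (?J n - gaussian_J \<eta> \<xi>)) \<longlonglongrightarrow> 0"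
      proof (rule Lim_null_comparison[OF always_eventually])
        show "\<forall>n. norm (blinfun_apply (\<nu> - r n) (?J n - gaussian_J \<eta> \<xi>)) \<le> 2 * bound * norm (?J n - gaussian_J \<eta> \<xi>)"
          using abs_apply_le[OF \<nu> rK] by simp
        show "(\<lambda>n. 2 * bound * norm (?J n - gaussian_J \<eta> \<xi>)) \<longlonglongrightarrow> 0"
          using tendsto_mult_right_zero[OF J_lim] .
      qed
      moreover have "(\<lambda>n. blinfun_apply \<nu> (gaussian_J \<eta> \<xi>) - blinfun_apply (r n) (gaussian_J \<eta> \<xi>))
          \<longlonglongrightarrow> blinfun_apply \<nu> (gaussian_J \<eta> \<xi>) - blinfun_apply x (gaussian_J \<eta> \<xi>)"
        by (intro tendsto_diff tendsto_const tendsto_eval[OF r_lim evK x])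
      ultimately have "(\<lambda>n. blinfun_apply (\<nu> - r n) (?J n - gaussian_J \<eta> \<xi>) +
          (blinfun_apply \<nu> (gaussian_J \<eta> \<xi>) - blinfun_apply (r n) (gaussian_J \<eta> \<xi>)))
          \<longlonglongrightarrow> 0 + (blinfun_apply \<nu> (gaussian_J \<eta> \<xi>) - blinfun_apply x (gaussian_J \<eta> \<xi>))"
        by (rule tendsto_add)
      then show ?thesis
        by (simp add: blinfun.diff_left blinfun.diff_right)
    qed
    have "G (r n) (r n) + blinfun_apply (\<nu> - r n) (?J n) \<le> G (r n) \<nu>" for n
      using Y_A[OF a0 x, of n] \<nu> by (auto simp: A_def diag_subdiff_def r_def f_def)
    then show "G x x + blinfun_apply (\<nu> - x) (gaussian_J \<eta> \<xi>) \<le> G x \<nu>"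
      by (intro LIMSEQ_le[OF tendsto_add[OF G2 P] G1]) auto
  qed
  ultimately show ?thesis by blast
qed

lemma gaussian_H_minus:
  assumes "\<xi> \<in> gaussian_H \<eta>"
  shows "(\<lambda>x. - \<xi> x) \<in> gaussian_H \<eta>"
proof -
  have "\<exists>\<mu>::'a \<Rightarrow>\<^sub>L real. H_norm \<eta> (\<lambda>x. - \<xi> x - \<mu> x) < e" if e: "e > 0" for e
  proof -
    obtain \<mu> :: "'a \<Rightarrow>\<^sub>L real" where "H_norm \<eta> (\<lambda>x. \<xi> x - \<mu> x) < e"
      using assms e by (auto simp: gaussian_H_def)
    then have "H_norm \<eta> (\<lambda>x. - (\<xi> x - \<mu> x)) < e"
      by (subst H_norm_minus)
    then show ?thesis
      by (intro exI[of _ "- \<mu>"]) (simp add: uminus_blinfun.rep_eq add.commute)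
  qed
  then show ?thesis
    using assms by (auto simp: gaussian_H_def)
qed

lemma nrm_diff_bound: "\<exists>C>0. \<forall>\<mu>\<in>K. \<forall>\<nu>\<in>K. nrm (\<mu> - \<nu>) \<le> C"
proof -
  have "nrm (\<mu> - \<nu>) \<le> sqrt (4 * bound\<^sup>2 * second_moment)" if K: "\<mu> \<in> K" "\<nu> \<in> K" for \<mu> \<nu>
  proof (rule real_le_rsqrt)
    have pw: "(blinfun_apply (\<mu> - \<nu>) x)\<^sup>2 \<le> 4 * bound\<^sup>2 * (norm x)\<^sup>2" for x
    proof -
      have "\<bar>blinfun_apply (\<mu> - \<nu>) x\<bar>\<^sup>2 \<le> (2 * bound * norm x)\<^sup>2"
        using abs_apply_le[OF K, of x] by (intro power_mono) auto
      then show ?thesis by (simp add: power_mult_distrib)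
    qed
    have "(nrm (\<mu> - \<nu>))\<^sup>2 = (\<integral>x. (blinfun_apply (\<mu> - \<nu>) x)\<^sup>2 \<partial>\<eta>)"
      by (simp only: nrm_sq H_inner_self)
    also have "\<dots> \<le> (\<integral>x. 4 * bound\<^sup>2 * (norm x)\<^sup>2 \<partial>\<eta>)"
      by (intro integral_mono pw integrable_functional_sq integrable_mult_right integrable_norm_sq)
    finally show "(nrm (\<mu> - \<nu>))\<^sup>2 \<le> 4 * bound\<^sup>2 * second_moment"
      by (simp add: second_moment_def)
  qed
  then show ?thesis
    by (intro exI[of _ "sqrt (4 * bound\<^sup>2 * second_moment) + 1"] conjI ballI)
       (auto simp: second_moment_def add_nonneg_pos intro: add_increasing2)
qed

lemma lipschitz_imp_absolutely_continuous:
  assumes "M \<ge> 0" "\<And>s t. 0 \<le> s \<Longrightarrow> s \<le> t \<Longrightarrow> nrm (u t - u s) \<le> M * (t - s)"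
  shows "H_absolutely_continuous \<eta> (\<lambda>t. blinfun_apply (u t))"
  unfolding H_absolutely_continuous_def
proof (intro allI impI)
  fix T \<epsilon> :: real assume "T > 0" "\<epsilon> > 0"
  show "\<exists>\<delta>>0. \<forall>(n::nat) a b. (\<forall>i<n. 0 \<le> a i \<and> a i \<le> b i \<and> b i \<le> T) \<longrightarrow>
      disjoint_family_on (\<lambda>i. {a i<..<b i}) {..<n} \<longrightarrow> (\<Sum>i<n. b i - a i) < \<delta> \<longrightarrow>
      (\<Sum>i<n. H_norm \<eta> (\<lambda>x. u (b i) x - u (a i) x)) < \<epsilon>"
  proof (intro exI[of _ "\<epsilon> / (M + 1)"] conjI allI impI)
    show "\<epsilon> / (M + 1) > 0" using \<open>\<epsilon> > 0\<close> assms(1) by simp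
    fix n :: nat and a b :: "nat \<Rightarrow> real"
    assume ab: "\<forall>i<n. 0 \<le> a i \<and> a i \<le> b i \<and> b i \<le> T" and s: "(\<Sum>i<n. b i - a i) < \<epsilon> / (M + 1)"
    have "(\<Sum>i<n. H_norm \<eta> (\<lambda>x. u (b i) x - u (a i) x)) \<le> (\<Sum>i<n. M * (b i - a i))"
      using ab by (intro sum_mono) (auto simp: H_norm_functional_diff intro!: assms(2))
    also have "\<dots> = M * (\<Sum>i<n. b i - a i)"
      by (simp add: sum_distrib_left)
    also have "\<dots> \<le> M * (\<epsilon> / (M + 1))"
      using s assms(1) by (intro mult_left_mono) auto
    also have "\<dots> < \<epsilon>"
      using \<open>\<epsilon> > 0\<close> assms(1) by (simp add: field_simps)
    finally show "(\<Sum>i<n. H_norm \<eta> (\<lambda>x. u (b i) x - u (a i) x)) < \<epsilon>" .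
  qed
qed

lemma evolution_exists:
  assumes "\<mu>0 \<in> flow_domain \<eta> K G"
  shows "\<exists>u M. evolution (\<lambda>\<mu> \<nu>. H_inner \<eta> (blinfun_apply \<mu>) (blinfun_apply \<nu>)) K A R u M \<and> u 0 = \<mu>0"
proof -
  obtain \<xi> where \<xi>: "\<mu>0 \<in> K" "\<xi> \<in> gaussian_H \<eta>" "gaussian_J \<eta> \<xi> \<in> diag_subdiff K G \<mu>0"
    using assms by (auto simp: flow_domain_def)
  have M: "nrm (Y l \<mu>0) \<le> H_norm \<eta> \<xi>" if "l > 0" for l
    by (intro Y_le_H_norm \<xi> gaussian_H_L2 that)
  obtain u where u: "\<And>t. u t \<in> K" "\<And>s t e N. e > 0 \<Longrightarrow>
      \<exists>n\<ge>N. nrm (euler_curve \<mu>0 n s - u s) < e \<and> nrm (euler_curve \<mu>0 n t - u t) < e"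
    using euler_cluster[OF \<xi>(1)] by blast
  show ?thesis
    using evolution_from_euler[OF \<xi>(1) M u] by blast
qed

lemma evolution_is_flow_solution:
  assumes "evolution (\<lambda>\<mu> \<nu>. H_inner \<eta> (blinfun_apply \<mu>) (blinfun_apply \<nu>)) K A R u M"
  shows "is_flow_solution \<eta> K G (u 0) u"
proof -
  interpret u: evolution "\<lambda>\<mu> \<nu>. H_inner \<eta> (blinfun_apply \<mu>) (blinfun_apply \<nu>)" K A R u M
    by fact
  have sect: "\<exists>\<xi>\<in>gaussian_H \<eta>. gaussian_J \<eta> \<xi> \<in> diag_subdiff K G (u t) \<and>
    (\<forall>e>0. \<exists>l0>0. \<forall>l. 0 < l \<and> l \<le> l0 \<longrightarrow> H_norm \<eta> (\<lambda>z. \<xi> z - blinfun_apply (Y l (u t)) z) \<le> e)"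
    if "t \<ge> 0" for t
    using minimal_section[OF u.u_in u.Y_u_le] that by blast
  \<comment> \<open>Countable, hence null. Time 0 is added since \<open>two_sided_quotient\<close>
    is about positive times.\<close>
  define N where "N = insert 0 {t \<in> {0..}. \<not> continuous (at t within {0..}) u.speed}"
  have "countable N"
    unfolding N_def using u.countable_speed_discontinuities by simp
  then have "N \<in> null_sets lborel"
    by (rule countable_imp_null_set_lborel)
  then have "AE t in lborel. t \<notin> N"
    by (rule AE_not_in)
  then have "AE t in lborel. t \<ge> 0 \<longrightarrow>
      (\<exists>\<xi>\<in>gaussian_H \<eta>. has_H_derivative \<eta> (\<lambda>s. blinfun_apply (u s)) \<xi> t \<and>
         - gaussian_J \<eta> \<xi> \<in> diag_subdiff K G (u t))"
  proof (eventually_elim, intro impI)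
    fix t assume "t \<notin> N" "t \<ge> 0"
    then have t: "t > 0" "continuous (at t within {0..}) u.speed"
      by (auto simp: N_def)
    obtain \<xi> where \<xi>: "\<xi> \<in> gaussian_H \<eta>" "gaussian_J \<eta> \<xi> \<in> diag_subdiff K G (u t)"
      and approx: "\<And>e. e > 0 \<Longrightarrow> \<exists>l0>0. \<forall>l. 0 < l \<and> l \<le> l0 \<longrightarrow> H_norm \<eta> (\<lambda>z. \<xi> z - Y l (u t) z) \<le> e"
      using sect[OF \<open>t \<ge> 0\<close>] by blast
    \<comment> \<open>The quotient and \<open>- \<xi>\<close> are compared through
      \<open>- Y l (u t)\<close>, for one \<open>l\<close> small enough for both
      approximations.\<close>
    have "has_H_derivative \<eta> (\<lambda>s. blinfun_apply (u s)) (\<lambda>x. - \<xi> x) t"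
      unfolding has_H_derivative_def
    proof (rule tendstoI)
      fix e :: real assume e: "e > 0"
      obtain l1 where l1: "l1 > 0" "\<And>l. 0 < l \<Longrightarrow> l \<le> l1 \<Longrightarrow> H_norm \<eta> (\<lambda>z. \<xi> z - Y l (u t) z) \<le> e / 3"
        using approx[of "e / 3"] e by auto
      obtain l2 where l2: "l2 > 0" "\<And>l. 0 < l \<Longrightarrow> l \<le> l2 \<Longrightarrow> (\<exists>d>0. \<forall>s\<ge>0. s \<noteq> t \<and> \<bar>s - t\<bar> < d \<longrightarrow>
          nrm ((1 / (s - t)) *\<^sub>R (u s - u t) + Y l (u t)) \<le> e / 3)"
        using u.two_sided_quotient[OF t, of "e / 3"] e by auto
      define l where "l = min l1 l2"
      have l: "l > 0" "l \<le> l1" "l \<le> l2" using l1 l2 by (auto simp: l_def)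
      obtain d where d: "d > 0" "\<And>s. s \<ge> 0 \<Longrightarrow> s \<noteq> t \<Longrightarrow> \<bar>s - t\<bar> < d \<Longrightarrow>
          nrm ((1 / (s - t)) *\<^sub>R (u s - u t) + Y l (u t)) \<le> e / 3"
        using l2(2)[OF l(1,3)] by auto
      have "H_norm \<eta> (\<lambda>x. (u s x - u t x) / (s - t) - - \<xi> x) < e" if s: "s \<ge> 0" "s \<noteq> t" "\<bar>s - t\<bar> < d" for s
      proof -
        let ?q = "(1 / (s - t)) *\<^sub>R (u s - u t) + Y l (u t)"
        have "(\<lambda>x. (u s x - u t x) / (s - t) - - \<xi> x) = (\<lambda>x. ?q x + (\<xi> x - Y l (u t) x))"
          by (simp add: blinfun.bilinear_simps)
        then have "H_norm \<eta> (\<lambda>x. (u s x - u t x) / (s - t) - - \<xi> x) \<le> nrm ?q + H_norm \<eta> (\<lambda>x. \<xi> x - Y l (u t) x)"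
          using H_norm_triangle[OF functional_L2[of ?q] L2_diff[OF gaussian_H_L2[OF \<xi>(1)] functional_L2[of "Y l (u t)"]]]
          by (simp only: H_norm_functional)
        also have "\<dots> \<le> e / 3 + e / 3"
          using d(2)[OF s] l1(2)[OF l(1,2)] by (rule add_mono)
        finally show ?thesis using e by simp
      qed
      then show "\<forall>\<^sub>F s in at t within {0..}. dist (H_norm \<eta> (\<lambda>x. (u s x - u t x) / (s - t) - - \<xi> x)) 0 < e"
        using d(1) by (auto simp: eventually_at dist_real_def)
    qed
    then show "\<exists>\<xi>\<in>gaussian_H \<eta>. has_H_derivative \<eta> (\<lambda>s. blinfun_apply (u s)) \<xi> t \<and>
         - gaussian_J \<eta> \<xi> \<in> diag_subdiff K G (u t)"
      using gaussian_H_minus[OF \<xi>(1)] \<xi>(2) by (intro bexI[of _ "\<lambda>x. - \<xi> x"]) (auto simp: J_minus)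
  qed
  moreover have "u t \<in> flow_domain \<eta> K G" if "t \<ge> 0" for t
    using sect[OF that] u.u_in[OF that] by (auto simp: flow_domain_def)
  moreover have "H_absolutely_continuous \<eta> (\<lambda>t. blinfun_apply (u t))"
    using u.M_nonneg u.u_lipschitz' by (rule lipschitz_imp_absolutely_continuous)
  ultimately show ?thesis
    by (simp add: is_flow_solution_def)
qed

end

text \<open>Cousin's lemma supplies a tagged division that is fine enough at the good points; the intervals
  tagged by the exceptional null set are controlled by absolute continuity.\<close>

lemma absolutely_continuous_nonincreasing:
  fixes \<phi> :: "real \<Rightarrow> real"
  assumes "T > 0"
    and ac: "\<And>\<epsilon>. \<epsilon> > 0 \<Longrightarrow> \<exists>\<delta>>0. \<forall>(n::nat) a b.
        (\<forall>i<n. 0 \<le> a i \<and> a i \<le> b i \<and> b i \<le> T) \<longrightarrow> disjoint_family_on (\<lambda>i. {a i<..<b i}) {..<n} \<longrightarrow>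
        (\<Sum>i<n. b i - a i) < \<delta> \<longrightarrow> (\<Sum>i<n. \<bar>\<phi> (b i) - \<phi> (a i)\<bar>) < \<epsilon>"
    and deriv: "AE t in lborel. 0 \<le> t \<longrightarrow> (\<exists>c\<le>0. (\<phi> has_real_derivative c) (at t within {0..}))"
  shows "\<phi> T \<le> \<phi> 0"
proof (rule field_le_epsilon)
  fix e :: real assume e: "e > 0"
  define \<epsilon> where "\<epsilon> = e / (2 * T)"
  have \<epsilon>: "\<epsilon> > 0" using e assms(1) by (simp add: \<epsilon>_def)
  obtain N where N: "N \<in> null_sets lborel"
    "\<And>t. t \<notin> N \<Longrightarrow> 0 \<le> t \<Longrightarrow> \<exists>c\<le>0. (\<phi> has_real_derivative c) (at t within {0..})"
  proof (rule AE_E3[OF deriv], goal_cases)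
    case (1 N)
    show ?case
      by (rule 1(1)[OF 1(3)]) (use 1(2) in auto)
  qed
  obtain \<delta> where \<delta>: "\<delta> > 0" and ac': "\<And>(n::nat) a b.
        (\<forall>i<n. 0 \<le> a i \<and> a i \<le> b i \<and> b i \<le> T) \<Longrightarrow> disjoint_family_on (\<lambda>i. {a i<..<b i}) {..<n} \<Longrightarrow>
        (\<Sum>i<n. b i - a i) < \<delta> \<Longrightarrow> (\<Sum>i<n. \<bar>\<phi> (b i) - \<phi> (a i)\<bar>) < e / 2"
    using ac[of "e / 2"] e by auto
  \<comment> \<open>Intervals tagged in \<open>N\<close> will be subsets of \<open>U\<close>, so
    their total length is below \<open>\<delta>\<close> however many there are.\<close>
  obtain U where U: "open U" "N \<subseteq> U" "emeasure lborel (U - N) < ennreal \<delta>"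
    using outer_regular_lborel[of N \<delta>] N(1) \<delta> by (auto simp: null_sets_def)
  have Um: "emeasure lborel U < ennreal \<delta>"
  proof -
    have "emeasure lborel U = emeasure lborel (U - N)"
      using N(1) U(1) by (intro emeasure_Diff_null_set[symmetric]) auto
    then show ?thesis using U(3) by simp
  qed
  \<comment> \<open>Straddle estimate: as \<open>t\<close> lies between \<open>a\<close> and
    \<open>b\<close>, the two one-sided errors add up to \<open>\<epsilon> * (b - a)\<close>, and
    the linear term has the right sign because \<open>c \<le> 0\<close>.\<close>
  have "\<exists>d>0. t \<notin> N \<longrightarrow> 0 \<le> t \<longrightarrow> (\<forall>a b. 0 \<le> a \<longrightarrow> a \<le> t \<longrightarrow> t \<le> b \<longrightarrow> {a..b} \<subseteq> ball t d \<longrightarrow> \<phi> b - \<phi> a \<le> \<epsilon> * (b - a))" for t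
  proof (cases "t \<notin> N \<and> 0 \<le> t")
    case True
    then obtain c where c: "c \<le> 0" "(\<phi> has_real_derivative c) (at t within {0..})"
      using N(2) by blast
    then have "(\<phi> has_derivative (\<lambda>x. x * c)) (at t within {0..})"
      by (simp add: has_field_derivative_def mult_commute_abs)
    then obtain d where d: "d > 0" "\<And>s. s \<ge> 0 \<Longrightarrow> \<bar>s - t\<bar> < d \<Longrightarrow> \<bar>\<phi> s - \<phi> t - (s - t) * c\<bar> \<le> \<epsilon> * \<bar>s - t\<bar>"
      using \<epsilon> True unfolding has_derivative_within_alt by (fastforce simp: real_norm_def)
    have "\<phi> b - \<phi> a \<le> \<epsilon> * (b - a)" if ab: "0 \<le> a" "a \<le> t" "t \<le> b" "{a..b} \<subseteq> ball t d" for a b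
    proof -
      have "a \<in> ball t d" "b \<in> ball t d" using ab by (auto simp: subset_eq)
      then have "\<bar>a - t\<bar> < d" "\<bar>b - t\<bar> < d" by (auto simp: dist_real_def abs_minus_commute)
      then have 1: "\<bar>\<phi> a - \<phi> t - (a - t) * c\<bar> \<le> \<epsilon> * (t - a)" and 2: "\<bar>\<phi> b - \<phi> t - (b - t) * c\<bar> \<le> \<epsilon> * (b - t)"
        using d(2)[of a] d(2)[of b] ab by auto
      have "(a - t) * c \<ge> 0" "(b - t) * c \<le> 0"
        using ab c(1) by (auto simp: mult_nonpos_nonpos mult_nonneg_nonpos)
      then show ?thesis
        using 1 2 by (simp add: right_diff_distrib)
    qed
    then show ?thesis using d(1) by blast
  qed (auto intro: exI[of _ 1])
  from this[THEN allI, unfolded choice_iff] obtain d where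
    d': "\<forall>t. d t > 0 \<and> (t \<notin> N \<longrightarrow> 0 \<le> t \<longrightarrow> (\<forall>a b. 0 \<le> a \<longrightarrow> a \<le> t \<longrightarrow> t \<le> b \<longrightarrow> {a..b} \<subseteq> ball t (d t) \<longrightarrow> \<phi> b - \<phi> a \<le> \<epsilon> * (b - a)))" ..
  have d: "d t > 0" "t \<notin> N \<Longrightarrow> 0 \<le> a \<Longrightarrow> a \<le> t \<Longrightarrow> t \<le> b \<Longrightarrow> {a..b} \<subseteq> ball t (d t) \<Longrightarrow> \<phi> b - \<phi> a \<le> \<epsilon> * (b - a)" for t a b
    using d'[THEN spec[of _ t]] by simp_all
  define g where "g t = (if t \<in> N then U else ball t (d t))" for t
  have "gauge g"
    using U d(1) by (auto simp: gauge_def g_def)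
  then obtain p where p: "p tagged_division_of {0..T}" "g fine p"
    using fine_division_exists_real by blast
  have fin: "finite p" using p(1) by (rule tagged_division_of_finite)
  define lo where "lo k = Inf k" for k :: "real set"
  define hi where "hi k = Sup k" for k :: "real set"
  have k: "k = {lo k..hi k}" "lo k \<le> x" "x \<le> hi k" "0 \<le> lo k" "hi k \<le> T" "k \<subseteq> g x" if xk: "(x, k) \<in> p" for x k
  proof -
    obtain a b where ab: "k = {a..b}" using tagged_division_ofD(4)[OF p(1) xk] by auto
    have x: "x \<in> k" "k \<subseteq> {0..T}" using tagged_division_ofD(2,3)[OF p(1) xk] by auto
    then have "a \<le> b" using ab by auto
    then have "lo k = a" "hi k = b" using ab by (auto simp: lo_def hi_def)
    then show "k = {lo k..hi k}" "lo k \<le> x" "x \<le> hi k" "0 \<le> lo k" "hi k \<le> T"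
      using ab x \<open>a \<le> b\<close> by auto
    show "k \<subseteq> g x" using p(2) xk by (auto simp: fine_def)
  qed
  define p2 where "p2 = {q \<in> p. fst q \<in> N}"
  define p1 where "p1 = {q \<in> p. fst q \<notin> N}"
  have p12: "p = p1 \<union> p2" "p1 \<inter> p2 = {}" "finite p1" "finite p2"
    using fin by (auto simp: p1_def p2_def)
  have "\<phi> T - \<phi> 0 = (\<Sum>(x, k)\<in>p. \<phi> (hi k) - \<phi> (lo k))"
    using additive_tagged_division_1[of 0 T p \<phi>] p(1) assms(1) by (simp add: hi_def lo_def)
  also have "\<dots> = (\<Sum>(x, k)\<in>p1. \<phi> (hi k) - \<phi> (lo k)) + (\<Sum>(x, k)\<in>p2. \<phi> (hi k) - \<phi> (lo k))"
    unfolding p12(1) by (rule sum.union_disjoint[OF p12(3,4,2)])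
  also have "(\<Sum>(x, k)\<in>p1. \<phi> (hi k) - \<phi> (lo k)) \<le> (\<Sum>(x, k)\<in>p1. \<epsilon> * (hi k - lo k))"
  proof (rule sum_mono, clarify)
    fix x k assume "(x, k) \<in> p1"
    then have xk: "(x, k) \<in> p" "x \<notin> N" by (auto simp: p1_def)
    show "\<phi> (hi k) - \<phi> (lo k) \<le> \<epsilon> * (hi k - lo k)"
    proof (rule d(2)[of x])
      show "{lo k..hi k} \<subseteq> ball x (d x)"
        using k(6)[OF xk(1)] xk(2) unfolding k(1)[OF xk(1), symmetric] by (simp add: g_def)
    qed (use k[OF xk(1)] xk(2) in auto)
  qed
  also have "\<dots> \<le> (\<Sum>(x, k)\<in>p. \<epsilon> * (hi k - lo k))"
    using k(2,3) \<epsilon> fin by (intro sum_mono2) (force simp: p1_def)+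
  also have "\<dots> = \<epsilon> * (\<Sum>(x, k)\<in>p. hi k - lo k)"
    by (simp add: sum_distrib_left case_prod_unfold)
  also have "(\<Sum>(x, k)\<in>p. hi k - lo k) = T"
    using additive_tagged_division_1[of 0 T p "\<lambda>x. x"] p(1) assms(1) by (simp add: hi_def lo_def)
  also have "\<epsilon> * T = e / 2"
    using assms(1) by (simp add: \<epsilon>_def)
  also have "(\<Sum>(x, k)\<in>p2. \<phi> (hi k) - \<phi> (lo k)) \<le> e / 2"
  proof -
    \<comment> \<open>Absolute continuity is stated for indexed intervals, so the tagged ones are
      numbered.\<close>
    obtain f where f: "bij_betw f {..<card p2} p2"
      using ex_bij_betw_nat_finite[OF p12(4)] by (auto simp: lessThan_atLeast0)
    define a where "a i = lo (snd (f i))" for i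
    define b where "b i = hi (snd (f i))" for i
    have fp: "f i \<in> p2" if "i < card p2" for i
      using f that by (auto simp: bij_betw_def)
    then have fp': "(fst (f i), snd (f i)) \<in> p" "fst (f i) \<in> N" if "i < card p2" for i
      using that by (auto simp: p2_def)
    have ab: "\<forall>i<card p2. 0 \<le> a i \<and> a i \<le> b i \<and> b i \<le> T"
      using k(2-5)[OF fp'(1)] order_trans by (fastforce simp: a_def b_def)
    have int: "interior (snd (f i)) = {a i<..<b i}" if "i < card p2" for i
      using k(1)[OF fp'(1)[OF that]] interior_atLeastAtMost_real by (metis a_def b_def)
    have disj: "disjoint_family_on (\<lambda>i. {a i<..<b i}) {..<card p2}"
      unfolding disjoint_family_on_def
    proof (intro ballI impI)
      fix i j assume ij: "i \<in> {..<card p2}" "j \<in> {..<card p2}" "i \<noteq> j"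
      then have "f i \<noteq> f j"
        using f by (auto simp: bij_betw_def inj_on_def)
      then show "{a i<..<b i} \<inter> {a j<..<b j} = {}"
        using tagged_division_ofD(5)[OF p(1) fp'(1)[of i] fp'(1)[of j]] int[of i] int[of j] ij by (simp add: prod_eq_iff)
    qed
    have len: "(\<Sum>i<card p2. b i - a i) < \<delta>"
    proof -
      have "ennreal (\<Sum>i<card p2. b i - a i) = (\<Sum>i<card p2. ennreal (b i - a i))"
        using ab by (subst sum_ennreal) auto
      also have "\<dots> = (\<Sum>i<card p2. emeasure lborel {a i<..<b i})"
        using ab by (intro sum.cong) auto
      also have "\<dots> = emeasure lborel (\<Union>i<card p2. {a i<..<b i})"
        using disj by (intro sum_emeasure) auto
      also have "\<dots> \<le> emeasure lborel U"
      proof (rule emeasure_mono)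
        have "{a i<..<b i} \<subseteq> U" if i: "i < card p2" for i
          using k(1,6)[OF fp'(1)[OF i]] fp'(2)[OF i] greaterThanLessThan_subseteq_atLeastAtMost_iff[of "a i" "b i" "a i" "b i"]
          unfolding a_def b_def g_def by auto
        then show "(\<Union>i<card p2. {a i<..<b i}) \<subseteq> U" by blast
      qed (use U in auto)
      also have "\<dots> < ennreal \<delta>" by (rule Um)
      finally have "ennreal (\<Sum>i<card p2. b i - a i) < ennreal \<delta>" .
      moreover have "0 \<le> (\<Sum>i<card p2. b i - a i)"
        using ab by (intro sum_nonneg) auto
      ultimately show ?thesis
        by (simp only: ennreal_less_iff)
    qed
    have "(\<Sum>(x, k)\<in>p2. \<phi> (hi k) - \<phi> (lo k)) = (\<Sum>i<card p2. \<phi> (b i) - \<phi> (a i))"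
      using sum.reindex_bij_betw[OF f, of "\<lambda>(x, k). \<phi> (hi k) - \<phi> (lo k)"]
      by (simp add: a_def b_def case_prod_unfold)
    also have "\<dots> \<le> (\<Sum>i<card p2. \<bar>\<phi> (b i) - \<phi> (a i)\<bar>)"
      by (intro sum_mono) auto
    also have "\<dots> < e / 2"
      by (rule ac'[OF ab disj len])
    finally show ?thesis by simp
  qed
  finally show "\<phi> T \<le> \<phi> 0 + e" by simp
qed

section \<open>Uniqueness of the flow\<close>

text \<open>On each piece \<open>f\<close> differs from its value at the tag by at most
  \<open>L * \<delta>\<close>. The bound depends on \<open>f\<close> only through \<open>L\<close>,
  as \<open>riemann_sum_weak_integral\<close> applies it to a function built from the division
  itself.\<close>

lemma riemann_sum_lipschitz:
  fixes f :: "real \<Rightarrow> real"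
  assumes "a \<le> b" and lip: "\<And>s t. s \<in> {a..b} \<Longrightarrow> t \<in> {a..b} \<Longrightarrow> \<bar>f s - f t\<bar> \<le> L * \<bar>s - t\<bar>"
    and "L \<ge> 0" and p: "p tagged_division_of {a..b}" "(\<lambda>x. ball x \<delta>) fine p"
  shows "\<bar>(\<Sum>(s, k)\<in>p. measure lborel k * f s) - integral {a..b} f\<bar> \<le> L * \<delta> * (b - a)"
proof -
  have "continuous_on {a..b} f"
    by (rule lipschitz_on_continuous_on[of L]) (use lip \<open>L \<ge> 0\<close> in \<open>auto intro!: lipschitz_onI simp: dist_real_def\<close>)
  then have int: "f integrable_on {a..b}"
    by (rule integrable_continuous_real)
  have "(\<Sum>(s, k)\<in>p. measure lborel k * f s) - integral {a..b} f = (\<Sum>(s, k)\<in>p. measure lborel k * f s - integral k f)"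
    using integral_combine_tagged_division_topdown[of f a b p] int p(1)
    by (simp add: sum_subtractf case_prod_unfold)
  also have "\<bar>\<dots>\<bar> \<le> (\<Sum>(s, k)\<in>p. L * \<delta> * measure lborel k)"
  proof (rule order_trans[OF sum_abs sum_mono], clarify)
    fix s k assume sk: "(s, k) \<in> p"
    then obtain u v where k: "k = {u..v}"
      using tagged_division_ofD(4)[OF p(1)] by fastforce
    have s: "s \<in> k" "k \<subseteq> {a..b}" "k \<subseteq> ball s \<delta>"
      using tagged_division_ofD(2,3)[OF p(1) sk] p(2) sk by (auto simp: fine_def)
    then have uv: "u \<le> v" using k by auto
    have fk: "f integrable_on k"
      using int s(2) integrable_on_subinterval k by metis
    have "norm (integral {u..v} (\<lambda>\<tau>. f s - f \<tau>)) \<le> (L * \<delta>) * (v - u)"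
    proof (rule integral_bound[OF uv])
      show "continuous_on {u..v} (\<lambda>\<tau>. f s - f \<tau>)"
        using \<open>continuous_on {a..b} f\<close> s(2) k by (intro continuous_intros) (auto intro: continuous_on_subset)
      show "norm (f s - f \<tau>) \<le> L * \<delta>" if "\<tau> \<in> {u..v}" for \<tau>
      proof -
        have "\<bar>f s - f \<tau>\<bar> \<le> L * \<bar>s - \<tau>\<bar>"
          using lip[of s \<tau>] s that k by auto
        also have "\<dots> \<le> L * \<delta>"
          using s(3) that k \<open>L \<ge> 0\<close> by (intro mult_left_mono) (auto simp: subset_eq dist_real_def intro: less_imp_le)
        finally show ?thesis by simp
      qed
    qed
    moreover have "integral {u..v} (\<lambda>\<tau>. f s - f \<tau>) = measure lborel k * f s - integral k f"
      using fk uv Henstock_Kurzweil_Integration.integral_diff[OF integrable_const_ivl, of f u v "f s"]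
      by (simp add: k)
    ultimately show "\<bar>measure lborel k * f s - integral k f\<bar> \<le> L * \<delta> * measure lborel k"
      using uv by (simp add: k)
  qed
  also have "\<dots> = L * \<delta> * (\<Sum>(s, k)\<in>p. measure lborel k)"
    by (simp add: sum_distrib_left case_prod_unfold)
  also have "(\<Sum>(s, k)\<in>p. measure lborel k) = b - a"
    using additive_content_tagged_division[of p a b] p(1) assms(1) by simp
  finally show ?thesis .
qed

context game
begin

text \<open>With the difference quotient \<open>q s\<close>, the quotient of the squared norms is
  \<open>2 * H_inner \<eta> (d t) (q s) + (s - t) * (nrm (q s))\<^sup>2\<close>. The first term
  converges by Cauchy-Schwarz, and \<open>q s\<close> stays bounded near \<open>t\<close>.\<close>

lemma has_H_derivative_norm_sq:
  fixes d :: "real \<Rightarrow> 'a \<Rightarrow>\<^sub>L real"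
  assumes d: "has_H_derivative \<eta> (\<lambda>s. blinfun_apply (d s)) \<xi> t" and \<xi>: "\<xi> \<in> L2 \<eta>"
  shows "((\<lambda>s. (nrm (d s))\<^sup>2) has_real_derivative 2 * H_inner \<eta> (d t) \<xi>) (at t within {0..})"
proof -
  define q where "q s = (1 / (s - t)) *\<^sub>R (d s - d t)" for s
  have q_eq: "(\<lambda>x. (d s x - d t x) / (s - t) - \<xi> x) = (\<lambda>x. q s x - \<xi> x)" for s
    by (simp add: q_def blinfun.bilinear_simps)
  have lim: "((\<lambda>s. H_norm \<eta> (\<lambda>x. q s x - \<xi> x)) \<longlongrightarrow> 0) (at t within {0..})"
    using d unfolding has_H_derivative_def q_eq .
  have 1: "((\<lambda>s. H_inner \<eta> (d t) (q s)) \<longlongrightarrow> H_inner \<eta> (d t) \<xi>) (at t within {0..})"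
  proof (rule LIM_zero_cancel, rule Lim_null_comparison[OF always_eventually])
    show "\<forall>s. norm (H_inner \<eta> (d t) (q s) - H_inner \<eta> (d t) \<xi>) \<le> nrm (d t) * H_norm \<eta> (\<lambda>x. q s x - \<xi> x)"
    proof
      fix s
      have "H_inner \<eta> (d t) (q s) - H_inner \<eta> (d t) \<xi> = H_inner \<eta> (\<lambda>x. q s x - \<xi> x) (d t)"
        using H_inner_diff[OF functional_L2 \<xi> functional_L2, of "q s" "d t"]
          H_inner_commute[of \<eta> "d t" "q s"] H_inner_commute[of \<eta> "d t" \<xi>] by simp
      then show "norm (H_inner \<eta> (d t) (q s) - H_inner \<eta> (d t) \<xi>) \<le> nrm (d t) * H_norm \<eta> (\<lambda>x. q s x - \<xi> x)"
        using abs_H_inner_le[OF L2_diff[OF functional_L2 \<xi>] functional_L2, of "q s" "d t"]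
        by (simp add: H_norm_functional mult.commute)
    qed
    show "((\<lambda>s. nrm (d t) * H_norm \<eta> (\<lambda>x. q s x - \<xi> x)) \<longlongrightarrow> 0) (at t within {0..})"
      using tendsto_mult_right_zero[OF lim] .
  qed
  have 2: "((\<lambda>s. (s - t) * (nrm (q s))\<^sup>2) \<longlongrightarrow> 0) (at t within {0..})"
  proof (rule Lim_null_comparison[OF always_eventually])
    show "\<forall>s. norm ((s - t) * (nrm (q s))\<^sup>2) \<le> \<bar>s - t\<bar> * (H_norm \<eta> (\<lambda>x. q s x - \<xi> x) + H_norm \<eta> \<xi>)\<^sup>2"
    proof
      fix s
      have "nrm (q s) \<le> H_norm \<eta> (\<lambda>x. q s x - \<xi> x) + H_norm \<eta> \<xi>"
        using H_norm_triangle[OF L2_diff[OF functional_L2 \<xi>] \<xi>, of "q s"] by (simp add: H_norm_functional)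
      then have "(nrm (q s))\<^sup>2 \<le> (H_norm \<eta> (\<lambda>x. q s x - \<xi> x) + H_norm \<eta> \<xi>)\<^sup>2"
        by (intro power_mono) auto
      then show "norm ((s - t) * (nrm (q s))\<^sup>2) \<le> \<bar>s - t\<bar> * (H_norm \<eta> (\<lambda>x. q s x - \<xi> x) + H_norm \<eta> \<xi>)\<^sup>2"
        by (simp add: abs_mult mult_left_mono)
    qed
    have "((\<lambda>s. \<bar>s - t\<bar> * (H_norm \<eta> (\<lambda>x. q s x - \<xi> x) + H_norm \<eta> \<xi>)\<^sup>2) \<longlongrightarrow> \<bar>t - t\<bar> * (0 + H_norm \<eta> \<xi>)\<^sup>2) (at t within {0..})"
      by (intro tendsto_intros lim)
    then show "((\<lambda>s. \<bar>s - t\<bar> * (H_norm \<eta> (\<lambda>x. q s x - \<xi> x) + H_norm \<eta> \<xi>)\<^sup>2) \<longlongrightarrow> 0) (at t within {0..})"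
      by simp
  qed
  have "((\<lambda>s. 2 * H_inner \<eta> (d t) (q s) + (s - t) * (nrm (q s))\<^sup>2) \<longlongrightarrow> 2 * H_inner \<eta> (d t) \<xi> + 0) (at t within {0..})"
    by (intro tendsto_add tendsto_mult tendsto_const 1 2)
  moreover have "\<forall>\<^sub>F s in at t within {0..}. 2 * H_inner \<eta> (d t) (q s) + (s - t) * (nrm (q s))\<^sup>2
      = ((nrm (d s))\<^sup>2 - (nrm (d t))\<^sup>2) / (s - t)"
    unfolding eventually_at_filter
  proof (intro always_eventually allI impI)
    fix s :: real assume "s \<noteq> t"
    then have ds: "d s = d t + (s - t) *\<^sub>R q s"
      by (simp add: q_def)
    have "(nrm (d s))\<^sup>2 - (nrm (d t))\<^sup>2 = (s - t) * (2 * BH (d t) (q s) + (s - t) * (nrm (q s))\<^sup>2)"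
      unfolding ds nrm_sq using B_commute[of "q s" "d t"] by (simp only: bilin) (simp add: algebra_simps)
    then show "2 * H_inner \<eta> (d t) (q s) + (s - t) * (nrm (q s))\<^sup>2 = ((nrm (d s))\<^sup>2 - (nrm (d t))\<^sup>2) / (s - t)"
      using \<open>s \<noteq> t\<close> by simp
  qed
  ultimately show ?thesis
    unfolding has_field_derivative_iff by (auto elim: Lim_transform_eventually)
qed

text \<open>The squared distance of two solutions is absolutely continuous because \<open>K\<close>
  is bounded in \<open>nrm\<close>, and by \<open>monotone_pairing\<close> its derivative is
  nonpositive almost everywhere; it starts at 0.\<close>

lemma flow_unique:
  assumes \<zeta>: "is_flow_solution \<eta> K G \<mu>0 \<zeta>" and \<zeta>': "is_flow_solution \<eta> K G \<mu>0 \<zeta>'" and "t \<ge> 0"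
  shows "\<zeta>' t = \<zeta> t"
proof (cases "t = 0")
  case True
  then show ?thesis using \<zeta> \<zeta>' by (simp add: is_flow_solution_def)
next
  case False
  then have t: "t > 0" using \<open>t \<ge> 0\<close> by simp
  have K: "\<zeta> s \<in> K" "\<zeta>' s \<in> K" if "s \<ge> 0" for s
    using \<zeta> \<zeta>' that by (auto simp: is_flow_solution_def flow_domain_def)
  obtain C where C: "C > 0" "\<And>\<mu> \<nu>. \<mu> \<in> K \<Longrightarrow> \<nu> \<in> K \<Longrightarrow> nrm (\<mu> - \<nu>) \<le> C"
    using nrm_diff_bound by blast
  define \<phi> where "\<phi> s = (nrm (\<zeta> s - \<zeta>' s))\<^sup>2" for s
  have "\<phi> t \<le> \<phi> 0"
  proof (rule absolutely_continuous_nonincreasing[OF t])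
    fix \<epsilon> :: real assume \<epsilon>: "\<epsilon> > 0"
    define e where "e = \<epsilon> / (4 * C)"
    have e: "e > 0" using \<epsilon> C by (simp add: e_def)
    have ac: "\<exists>\<delta>>0. \<forall>(n::nat) a b.
        (\<forall>i<n. 0 \<le> a i \<and> a i \<le> b i \<and> b i \<le> t) \<longrightarrow> disjoint_family_on (\<lambda>i. {a i<..<b i}) {..<n} \<longrightarrow>
        (\<Sum>i<n. b i - a i) < \<delta> \<longrightarrow> (\<Sum>i<n. nrm (z (b i) - z (a i))) < e"
      if "is_flow_solution \<eta> K G \<mu>0 z" for z
      using that t e unfolding is_flow_solution_def H_absolutely_continuous_def H_norm_functional_diff by blast
    obtain \<delta>1 where \<delta>1: "\<delta>1 > 0" "\<And>(n::nat) a b.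
        (\<forall>i<n. 0 \<le> a i \<and> a i \<le> b i \<and> b i \<le> t) \<Longrightarrow> disjoint_family_on (\<lambda>i. {a i<..<b i}) {..<n} \<Longrightarrow>
        (\<Sum>i<n. b i - a i) < \<delta>1 \<Longrightarrow> (\<Sum>i<n. nrm (\<zeta> (b i) - \<zeta> (a i))) < e"
      using ac[OF \<zeta>] by blast
    obtain \<delta>2 where \<delta>2: "\<delta>2 > 0" "\<And>(n::nat) a b.
        (\<forall>i<n. 0 \<le> a i \<and> a i \<le> b i \<and> b i \<le> t) \<Longrightarrow> disjoint_family_on (\<lambda>i. {a i<..<b i}) {..<n} \<Longrightarrow>
        (\<Sum>i<n. b i - a i) < \<delta>2 \<Longrightarrow> (\<Sum>i<n. nrm (\<zeta>' (b i) - \<zeta>' (a i))) < e"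
      using ac[OF \<zeta>'] by blast
    have lip: "\<bar>\<phi> b - \<phi> a\<bar> \<le> 2 * C * (nrm (\<zeta> b - \<zeta> a) + nrm (\<zeta>' b - \<zeta>' a))" if "a \<ge> 0" "b \<ge> 0" for a b
    proof -
      let ?x = "nrm (\<zeta> b - \<zeta>' b)" and ?y = "nrm (\<zeta> a - \<zeta>' a)"
      have "\<bar>\<phi> b - \<phi> a\<bar> = \<bar>?x - ?y\<bar> * (?x + ?y)"
        unfolding \<phi>_def by (simp add: power2_eq_square square_diff_square_factored abs_mult)
      also have "\<dots> \<le> (nrm (\<zeta> b - \<zeta> a) + nrm (\<zeta>' b - \<zeta>' a)) * (2 * C)"
      proof (rule mult_mono)
        have "\<bar>?x - ?y\<bar> \<le> nrm ((\<zeta> b - \<zeta> a) - (\<zeta>' b - \<zeta>' a))"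
          using nrm_diff_le[of "\<zeta> b - \<zeta>' b" "\<zeta> a - \<zeta>' a"] by (simp add: algebra_simps)
        also have "\<dots> \<le> nrm (\<zeta> b - \<zeta> a) + nrm (\<zeta>' b - \<zeta>' a)"
          by (rule nrm_triangle_diff)
        finally show "\<bar>?x - ?y\<bar> \<le> nrm (\<zeta> b - \<zeta> a) + nrm (\<zeta>' b - \<zeta>' a)" .
        show "?x + ?y \<le> 2 * C"
          using C(2)[OF K(1)[OF that(1)] K(2)[OF that(1)]] C(2)[OF K(1)[OF that(2)] K(2)[OF that(2)]] by simp
      qed auto
      finally show ?thesis by (simp add: mult.commute)
    qed
    show "\<exists>\<delta>>0. \<forall>(n::nat) a b.
        (\<forall>i<n. 0 \<le> a i \<and> a i \<le> b i \<and> b i \<le> t) \<longrightarrow> disjoint_family_on (\<lambda>i. {a i<..<b i}) {..<n} \<longrightarrow>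
        (\<Sum>i<n. b i - a i) < \<delta> \<longrightarrow> (\<Sum>i<n. \<bar>\<phi> (b i) - \<phi> (a i)\<bar>) < \<epsilon>"
    proof (intro exI[of _ "min \<delta>1 \<delta>2"] conjI allI impI)
      fix n :: nat and a b :: "nat \<Rightarrow> real"
      assume ab: "\<forall>i<n. 0 \<le> a i \<and> a i \<le> b i \<and> b i \<le> t"
        and dis: "disjoint_family_on (\<lambda>i. {a i<..<b i}) {..<n}" and s: "(\<Sum>i<n. b i - a i) < min \<delta>1 \<delta>2"
      have "(\<Sum>i<n. \<bar>\<phi> (b i) - \<phi> (a i)\<bar>) \<le> (\<Sum>i<n. 2 * C * (nrm (\<zeta> (b i) - \<zeta> (a i)) + nrm (\<zeta>' (b i) - \<zeta>' (a i))))"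
      proof (intro sum_mono lip)
        fix i assume "i \<in> {..<n}"
        then have "0 \<le> a i" "a i \<le> b i" using ab by auto
        then show "0 \<le> a i" "0 \<le> b i" by auto
      qed
      also have "\<dots> = 2 * C * ((\<Sum>i<n. nrm (\<zeta> (b i) - \<zeta> (a i))) + (\<Sum>i<n. nrm (\<zeta>' (b i) - \<zeta>' (a i))))"
        by (simp add: sum_distrib_left sum.distrib distrib_left)
      also have "\<dots> < 2 * C * (e + e)"
        using \<delta>1(2)[OF ab dis] \<delta>2(2)[OF ab dis] s C(1) by (intro mult_strict_left_mono add_strict_mono) auto
      also have "\<dots> = \<epsilon>"
        using C(1) by (simp add: e_def)
      finally show "(\<Sum>i<n. \<bar>\<phi> (b i) - \<phi> (a i)\<bar>) < \<epsilon>" .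
    qed (use \<delta>1 \<delta>2 in auto)
  next
    have "AE t in lborel. t \<ge> 0 \<longrightarrow> (\<exists>\<xi>\<in>gaussian_H \<eta>. has_H_derivative \<eta> (\<lambda>s. blinfun_apply (\<zeta> s)) \<xi> t \<and>
           - gaussian_J \<eta> \<xi> \<in> diag_subdiff K G (\<zeta> t))"
      and "AE t in lborel. t \<ge> 0 \<longrightarrow> (\<exists>\<xi>\<in>gaussian_H \<eta>. has_H_derivative \<eta> (\<lambda>s. blinfun_apply (\<zeta>' s)) \<xi> t \<and>
           - gaussian_J \<eta> \<xi> \<in> diag_subdiff K G (\<zeta>' t))"
      using \<zeta> \<zeta>' by (auto simp: is_flow_solution_def)
    then show "AE t in lborel. 0 \<le> t \<longrightarrow> (\<exists>c\<le>0. (\<phi> has_real_derivative c) (at t within {0..}))"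
    proof (eventually_elim, intro impI)
      fix s :: real assume "0 \<le> s"
        and "s \<ge> 0 \<longrightarrow> (\<exists>\<xi>\<in>gaussian_H \<eta>. has_H_derivative \<eta> (\<lambda>s. blinfun_apply (\<zeta> s)) \<xi> s \<and>
           - gaussian_J \<eta> \<xi> \<in> diag_subdiff K G (\<zeta> s))"
        and "s \<ge> 0 \<longrightarrow> (\<exists>\<xi>\<in>gaussian_H \<eta>. has_H_derivative \<eta> (\<lambda>s. blinfun_apply (\<zeta>' s)) \<xi> s \<and>
           - gaussian_J \<eta> \<xi> \<in> diag_subdiff K G (\<zeta>' s))"
      then obtain \<xi> \<xi>' where \<xi>: "\<xi> \<in> L2 \<eta>" "has_H_derivative \<eta> (\<lambda>s. blinfun_apply (\<zeta> s)) \<xi> s"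
          "gaussian_J \<eta> (\<lambda>x. - \<xi> x) \<in> diag_subdiff K G (\<zeta> s)"
        and \<xi>': "\<xi>' \<in> L2 \<eta>" "has_H_derivative \<eta> (\<lambda>s. blinfun_apply (\<zeta>' s)) \<xi>' s"
          "gaussian_J \<eta> (\<lambda>x. - \<xi>' x) \<in> diag_subdiff K G (\<zeta>' s)"
        using gaussian_H_L2 by (auto simp: J_minus)
      define \<rho> where "\<rho> = (\<lambda>x. \<xi> x - \<xi>' x)"
      have \<rho>: "\<rho> \<in> L2 \<eta>" unfolding \<rho>_def by (rule L2_diff[OF \<xi>(1) \<xi>'(1)])
      have "has_H_derivative \<eta> (\<lambda>r. blinfun_apply (\<zeta> r - \<zeta>' r)) \<rho> s"
        unfolding has_H_derivative_def
      proof (rule Lim_null_comparison[OF always_eventually])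
        let ?q = "\<lambda>z r. (1 / (r - s)) *\<^sub>R (z r - z s) :: 'a \<Rightarrow>\<^sub>L real"
        have q: "(\<lambda>x. (z r x - z s x) / (r - s) - \<kappa> x) = (\<lambda>x. ?q z r x - \<kappa> x)" for z :: "real \<Rightarrow> 'a \<Rightarrow>\<^sub>L real" and r and \<kappa> :: "'a \<Rightarrow> real"
          by (simp add: blinfun.bilinear_simps)
        show "\<forall>r. norm (H_norm \<eta> (\<lambda>x. ((\<zeta> r - \<zeta>' r) x - (\<zeta> s - \<zeta>' s) x) / (r - s) - \<rho> x))
          \<le> H_norm \<eta> (\<lambda>x. (\<zeta> r x - \<zeta> s x) / (r - s) - \<xi> x) + H_norm \<eta> (\<lambda>x. (\<zeta>' r x - \<zeta>' s x) / (r - s) - \<xi>' x)"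
        proof
          fix r
          have L: "(\<lambda>x. ?q \<zeta> r x - \<xi> x) \<in> L2 \<eta>" "(\<lambda>x. - (?q \<zeta>' r x - \<xi>' x)) \<in> L2 \<eta>"
            by (intro L2_minus L2_diff functional_L2 \<xi> \<xi>')+
          have "(\<lambda>x. ((\<zeta> r - \<zeta>' r) x - (\<zeta> s - \<zeta>' s) x) / (r - s) - \<rho> x)
              = (\<lambda>x. (?q \<zeta> r x - \<xi> x) + - (?q \<zeta>' r x - \<xi>' x))"
            by (auto simp: \<rho>_def blinfun.bilinear_simps diff_divide_distrib)
          then show "norm (H_norm \<eta> (\<lambda>x. ((\<zeta> r - \<zeta>' r) x - (\<zeta> s - \<zeta>' s) x) / (r - s) - \<rho> x))
          \<le> H_norm \<eta> (\<lambda>x. (\<zeta> r x - \<zeta> s x) / (r - s) - \<xi> x) + H_norm \<eta> (\<lambda>x. (\<zeta>' r x - \<zeta>' s x) / (r - s) - \<xi>' x)"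
            using H_norm_triangle[OF L] unfolding q by (simp only: H_norm_minus real_norm_def abs_of_nonneg H_norm_nonneg)
        qed
        show "((\<lambda>r. H_norm \<eta> (\<lambda>x. (\<zeta> r x - \<zeta> s x) / (r - s) - \<xi> x) + H_norm \<eta> (\<lambda>x. (\<zeta>' r x - \<zeta>' s x) / (r - s) - \<xi>' x))
            \<longlongrightarrow> 0) (at s within {0..})"
          using tendsto_add[OF \<xi>(2)[unfolded has_H_derivative_def] \<xi>'(2)[unfolded has_H_derivative_def]] by simp
      qed
      from has_H_derivative_norm_sq[OF this \<rho>]
      have "(\<phi> has_real_derivative 2 * H_inner \<eta> (\<zeta> s - \<zeta>' s) \<rho>) (at s within {0..})"
        by (simp add: \<phi>_def[abs_def])
      moreover have "H_inner \<eta> (\<zeta> s - \<zeta>' s) \<rho> \<le> 0"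
      proof -
        have "0 \<le> H_inner \<eta> (\<zeta> s - \<zeta>' s) (\<lambda>x. - \<xi> x - - \<xi>' x)"
          using K[OF \<open>0 \<le> s\<close>] \<xi> \<xi>' by (intro monotone_pairing L2_minus)
        also have "(\<lambda>x. - \<xi> x - - \<xi>' x) = (\<lambda>x. - 1 * \<rho> x)"
          by (auto simp: \<rho>_def)
        also have "H_inner \<eta> (\<zeta> s - \<zeta>' s) (\<lambda>x. - 1 * \<rho> x) = - 1 * H_inner \<eta> (\<zeta> s - \<zeta>' s) \<rho>"
          by (subst (1 2) H_inner_commute) (rule H_inner_scale)
        finally show ?thesis by simp
      qed
      ultimately show "\<exists>c\<le>0. (\<phi> has_real_derivative c) (at s within {0..})"
        by (intro exI[of _ "2 * H_inner \<eta> (\<zeta> s - \<zeta>' s) \<rho>"]) auto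
    qed
  qed
  also have "\<phi> 0 = 0"
    using \<zeta> \<zeta>' by (simp add: \<phi>_def is_flow_solution_def)
  finally show ?thesis
    by (simp add: \<phi>_def)
qed

end

section \<open>Ergodic averages\<close>

context game
begin

text \<open>The candidate \<open>\<sigma>\<close> is not known to lie in \<open>K\<close>, but
  \<open>continuous_nrm_diff\<close> allows any centre: the image of \<open>K\<close> under the
  distance to \<open>\<sigma>\<close> is compact and has 0 in its closure.\<close>

lemma K_nrm_closed:
  assumes "\<And>e. e > 0 \<Longrightarrow> \<exists>\<nu>\<in>K. nrm (\<nu> - \<sigma>) < e"
  shows "\<sigma> \<in> K"
proof -
  have "compactin euclideanreal ((\<lambda>\<nu>. nrm (\<nu> - \<sigma>)) ` topspace T)"
    using compact_T by (intro image_compactin[OF _ continuous_nrm_diff]) (simp add: compact_space_def)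
  then have c: "closed ((\<lambda>\<nu>. nrm (\<nu> - \<sigma>)) ` K)"
    by (simp add: compact_imp_closed)
  have "0 \<in> closure ((\<lambda>\<nu>. nrm (\<nu> - \<sigma>)) ` K)"
    unfolding closure_approachable using assms by (auto simp: dist_real_def)
  then have "0 \<in> (\<lambda>\<nu>. nrm (\<nu> - \<sigma>)) ` K"
    using c by (simp add: closure_closed)
  then show ?thesis
    by (auto simp: image_iff)
qed

text \<open>The predicate \<open>Q\<close> selects the times along which to cluster: once all
  positive ones, and once, in a convergence proof by contradiction, those at which the averages stay
  away from a given point.\<close>

lemma K_cluster:
  fixes Q :: "real \<Rightarrow> bool"
  assumes Q: "\<And>N. \<exists>t\<ge>N. Q t" and f: "\<And>t. Q t \<Longrightarrow> f t \<in> K"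
  shows "\<exists>p\<in>K. \<forall>N e. e > 0 \<longrightarrow> (\<exists>t\<ge>N. Q t \<and> nrm (f t - p) < e)"
proof -
  define E where "E n = f ` {t. Q t \<and> t \<ge> real n}" for n :: nat
  have ET: "E n \<subseteq> topspace T" for n
    using f by (auto simp: E_def)
  have "\<Inter>(range (\<lambda>n. T closure_of E n)) \<noteq> {}"
  proof (rule compact_space_imp_nest[OF compact_T])
    show "closedin T (T closure_of E n)" for n by simp
    show "T closure_of E n \<noteq> {}" for n
      using closure_of_subset[OF ET, of n] Q[of "real n"] by (auto simp: E_def)
    show "decseq (\<lambda>n. T closure_of E n)"
      unfolding decseq_def E_def by (intro allI impI closure_of_mono image_mono) auto
  qed
  then obtain p where p: "\<And>n. p \<in> T closure_of E n" by blast
  have pK: "p \<in> K"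
    using p[of 0] by (simp add: in_closure_of)
  have "\<exists>t\<ge>N. Q t \<and> nrm (f t - p) < e" if e: "e > 0" for N e
  proof -
    have "openin T {\<nu> \<in> topspace T. nrm (\<nu> - p) \<in> {..<e}}"
      by (rule openin_continuous_map_preimage[OF continuous_nrm_diff]) auto
    moreover have "p \<in> {\<nu> \<in> topspace T. nrm (\<nu> - p) \<in> {..<e}}"
      using pK e by simp
    ultimately have "\<exists>y. y \<in> E (nat \<lceil>N\<rceil>) \<and> y \<in> {\<nu> \<in> topspace T. nrm (\<nu> - p) \<in> {..<e}}"
      using p[of "nat \<lceil>N\<rceil>", unfolded in_closure_of] by (elim conjE allE impE) (rule conjI)
    then obtain y where y: "y \<in> E (nat \<lceil>N\<rceil>)" "nrm (y - p) < e"
      by auto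
    then obtain t where "Q t" "t \<ge> real (nat \<lceil>N\<rceil>)" "y = f t"
      by (auto simp: E_def)
    then have "t \<ge> N"
      using real_nat_ceiling_ge[of N] by linarith
    then show ?thesis
      using y(2) \<open>Q t\<close> \<open>y = f t\<close> by blast
  qed
  then show ?thesis
    using pK by blast
qed

text \<open>The weak* integral; it exists since \<open>s \<mapsto> \<langle>u(s), x\<rangle>\<close> is continuous for every \<open>x\<close>.\<close>

definition weak_integral :: "(real \<Rightarrow> 'a \<Rightarrow>\<^sub>L real) \<Rightarrow> real \<Rightarrow> 'a \<Rightarrow>\<^sub>L real" where
  "weak_integral u t = Blinfun (\<lambda>x. integral {0..t} (\<lambda>s. blinfun_apply (u s) x))"

context
  fixes u M
  assumes ev: "evolution (\<lambda>\<mu> \<nu>. H_inner \<eta> (blinfun_apply \<mu>) (blinfun_apply \<nu>)) K A R u M"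
begin

interpretation u: evolution "\<lambda>\<mu> \<nu>. H_inner \<eta> (blinfun_apply \<mu>) (blinfun_apply \<nu>)" K A R u M
  by (rule ev)

lemma u_lipschitz: "0 \<le> s \<Longrightarrow> 0 \<le> t \<Longrightarrow> nrm (u t - u s) \<le> M * \<bar>t - s\<bar>"
  using u.u_lipschitz'[of s t] u.u_lipschitz'[of t s] nrm_minus_commute[of "u t" "u s"] by (cases "s \<le> t") auto

lemma continuous_on_eval: "continuous_on {0..} (\<lambda>s. blinfun_apply (u s) x)"
  unfolding continuous_on_def
proof
  fix t :: real assume t: "t \<in> {0..}"
  show "((\<lambda>s. blinfun_apply (u s) x) \<longlongrightarrow> blinfun_apply (u t) x) (at t within {0..})"
  proof (rule tendsto_eval)
    show "((\<lambda>s. nrm (u s - u t)) \<longlongrightarrow> 0) (at t within {0..})"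
    proof (rule Lim_null_comparison)
      show "\<forall>\<^sub>F s in at t within {0..}. norm (nrm (u s - u t)) \<le> M * \<bar>s - t\<bar>"
        unfolding eventually_at_filter using t by (intro always_eventually) (auto intro: u_lipschitz)
      have "((\<lambda>s. M * \<bar>s - t\<bar>) \<longlongrightarrow> M * \<bar>t - t\<bar>) (at t within {0..})"
        by (intro tendsto_intros)
      then show "((\<lambda>s. M * \<bar>s - t\<bar>) \<longlongrightarrow> 0) (at t within {0..})" by simp
    qed
    show "\<forall>\<^sub>F s in at t within {0..}. u s \<in> K"
      unfolding eventually_at_filter by (intro always_eventually) (auto intro: u.u_in)
  qed (use t u.u_in in auto)
qed

lemma integrable_eval: "(\<lambda>s. blinfun_apply (u s) x) integrable_on {0..t}"
  by (intro integrable_continuous_real continuous_on_subset[OF continuous_on_eval]) auto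

lemma weak_integral_apply:
  assumes "t \<ge> 0"
  shows "blinfun_apply (weak_integral u t) x = integral {0..t} (\<lambda>s. blinfun_apply (u s) x)"
proof -
  have "bounded_linear (\<lambda>x. integral {0..t} (\<lambda>s. blinfun_apply (u s) x))"
  proof (rule bounded_linear_intro[where K = "bound * t"])
    fix x y and r :: real
    show "integral {0..t} (\<lambda>s. blinfun_apply (u s) (x + y)) =
        integral {0..t} (\<lambda>s. blinfun_apply (u s) x) + integral {0..t} (\<lambda>s. blinfun_apply (u s) y)"
      by (simp add: blinfun.add_right Henstock_Kurzweil_Integration.integral_add integrable_eval)
    show "integral {0..t} (\<lambda>s. blinfun_apply (u s) (r *\<^sub>R x)) = r *\<^sub>R integral {0..t} (\<lambda>s. blinfun_apply (u s) x)"
      by (simp add: blinfun.scaleR_right)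
    have "norm (integral {0..t} (\<lambda>s. blinfun_apply (u s) x)) \<le> (bound * norm x) * (t - 0)"
    proof (rule integral_bound[OF assms])
      show "continuous_on {0..t} (\<lambda>s. blinfun_apply (u s) x)"
        by (rule continuous_on_subset[OF continuous_on_eval]) auto
      show "norm (blinfun_apply (u s) x) \<le> bound * norm x" if "s \<in> {0..t}" for s
      proof -
        have "norm (blinfun_apply (u s) x) \<le> norm (u s) * norm x" by (rule norm_blinfun)
        also have "\<dots> \<le> bound * norm x"
          using bound(2)[OF u.u_in] that by (intro mult_right_mono) auto
        finally show ?thesis .
      qed
    qed
    then show "norm (integral {0..t} (\<lambda>s. blinfun_apply (u s) x)) \<le> norm x * (bound * t)"
      by (simp add: mult_ac)
  qed
  then show ?thesis
    by (simp add: weak_integral_def bounded_linear_Blinfun_apply)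
qed

text \<open>The pairing with \<open>g\<close> is evaluation at the image of \<open>g\<close> under
  \<open>J\<close>, so the pointwise integral suffices.\<close>

lemma BH_weak_integral: "t \<ge> 0 \<Longrightarrow> BH (weak_integral u t) g = integral {0..t} (\<lambda>s. BH (u s) g)"
  by (simp add: weak_integral_apply flip: apply_J)

lemma BH_lipschitz:
  assumes "0 \<le> s" "0 \<le> t"
  shows "\<bar>BH (u s) g - BH (u t) g\<bar> \<le> (M * nrm g) * \<bar>s - t\<bar>"
proof -
  have "\<bar>BH (u s) g - BH (u t) g\<bar> = \<bar>BH (u s - u t) g\<bar>"
    by (simp only: B_diff)
  also have "\<dots> \<le> nrm (u s - u t) * nrm g"
    by (rule abs_B_le)
  also have "\<dots> \<le> (M * \<bar>s - t\<bar>) * nrm g"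
    using u_lipschitz[OF assms(2,1)] by (intro mult_right_mono) auto
  finally show ?thesis by (simp add: mult_ac)
qed

text \<open>The error is tested against itself: the pairing is then the error of a scalar Riemann
  sum whose Lipschitz constant is \<open>M\<close> times the norm of the error, and one factor
  cancels.\<close>

lemma riemann_sum_weak_integral:
  assumes "t \<ge> 0" and p: "p tagged_division_of {0..t}" "(\<lambda>x. ball x \<delta>) fine p" and "\<delta> > 0"
  shows "nrm ((\<Sum>(s, k)\<in>p. measure lborel k *\<^sub>R u s) - weak_integral u t) \<le> M * \<delta> * t"
proof -
  let ?D = "(\<Sum>(s, k)\<in>p. measure lborel k *\<^sub>R u s) - weak_integral u t"
  have BS: "BH (\<Sum>(s, k)\<in>p. measure lborel k *\<^sub>R u s) g = (\<Sum>(s, k)\<in>p. measure lborel k * BH (u s) g)" for g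
  proof -
    have "BH (sum h S) g = (\<Sum>i\<in>S. BH (h i) g)" for h :: "real \<times> real set \<Rightarrow> 'a \<Rightarrow>\<^sub>L real" and S
      by (induction S rule: infinite_finite_induct) 
         (simp_all only: sum.infinite sum.empty sum.insert B_zero B_add simp_thms)
    then show ?thesis
      by (simp only: case_prod_unfold B_scale)
  qed
  have "nrm ?D * nrm ?D = BH ?D ?D"
    using nrm_sq[of ?D] by (simp add: power2_eq_square)
  also have "\<dots> = (\<Sum>(s, k)\<in>p. measure lborel k * BH (u s) ?D) - integral {0..t} (\<lambda>s. BH (u s) ?D)"
    by (simp only: B_diff[of _ _ ?D] BS BH_weak_integral[OF assms(1)])
  also have "\<dots> \<le> (M * nrm ?D) * \<delta> * (t - 0)"
    using riemann_sum_lipschitz[OF assms(1) _ _ p, of "\<lambda>s. BH (u s) ?D" "M * nrm ?D"] BH_lipschitz u.M_nonneg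
    by (auto simp: abs_le_iff)
  finally have "nrm ?D * nrm ?D \<le> (M * \<delta> * t) * nrm ?D"
    by (simp add: mult_ac)
  then show ?thesis
    using nrm_nonneg[of ?D] u.M_nonneg assms(1,4) mult_le_cancel_right[of "nrm ?D" "nrm ?D" "M * \<delta> * t"]
    by (cases "nrm ?D = 0") auto
qed

lemma has_H_integral_weak_integral:
  assumes t: "t > 0"
  shows "has_H_integral \<eta> (\<lambda>s. blinfun_apply (u s)) (blinfun_apply (weak_integral u t)) 0 t"
  unfolding has_H_integral_def
proof (rule tendstoI)
  fix e :: real assume e: "e > 0"
  define \<delta> where "\<delta> = e / ((M + 1) * t)"
  have \<delta>: "\<delta> > 0" using e t u.M_nonneg by (simp add: \<delta>_def)
  have "M * \<delta> * t = e * (M / (M + 1))"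
    using t by (simp add: \<delta>_def)
  also have "\<dots> < e * 1"
    using e u.M_nonneg by (intro mult_strict_left_mono) auto
  finally have "M * \<delta> * t < e" by simp
  have eq: "H_norm \<eta> (\<lambda>x. (\<Sum>(s, k)\<in>p. measure lborel k * u s x) - weak_integral u t x)
      = nrm ((\<Sum>(s, k)\<in>p. measure lborel k *\<^sub>R u s) - weak_integral u t)" for p
  proof -
    have "(\<lambda>x. (\<Sum>(s, k)\<in>p. measure lborel k * u s x) - weak_integral u t x)
        = blinfun_apply ((\<Sum>(s, k)\<in>p. measure lborel k *\<^sub>R u s) - weak_integral u t)"
      by (simp add: blinfun.diff_left blinfun.sum_left case_prod_unfold blinfun.scaleR_left fun_eq_iff)
    then show ?thesis
      by (simp only: H_norm_functional)
  qed
  have "\<forall>p. p tagged_division_of cbox 0 t \<and> (\<lambda>x. ball x \<delta>) fine p \<longrightarrow>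
      dist (H_norm \<eta> (\<lambda>x. (\<Sum>(s, k)\<in>p. measure lborel k * u s x) - weak_integral u t x)) 0 < e"
  proof (intro allI impI)
    fix p assume p: "p tagged_division_of cbox 0 t \<and> (\<lambda>x. ball x \<delta>) fine p"
    then have "nrm ((\<Sum>(s, k)\<in>p. measure lborel k *\<^sub>R u s) - weak_integral u t) \<le> M * \<delta> * t"
      by (intro riemann_sum_weak_integral less_imp_le[OF t] \<delta>) auto
    then show "dist (H_norm \<eta> (\<lambda>x. (\<Sum>(s, k)\<in>p. measure lborel k * u s x) - weak_integral u t x)) 0 < e"
      unfolding eq dist_real_def using \<open>M * \<delta> * t < e\<close> nrm_nonneg by (simp only: diff_zero abs_of_nonneg)
  qed
  then show "\<forall>\<^sub>F p in division_filter (cbox 0 t).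
      dist (H_norm \<eta> (\<lambda>x. (\<Sum>(s, k)\<in>p. measure lborel k * u s x) - weak_integral u t x)) 0 < e"
    unfolding eventually_division_filter using gauge_ball_dependent[of "\<lambda>_. \<delta>"] \<delta> by blast
qed

definition average :: "real \<Rightarrow> 'a \<Rightarrow>\<^sub>L real" where "average t = (1 / t) *\<^sub>R weak_integral u t"

text \<open>Riemann sums divided by \<open>t\<close> are convex combinations of points of the curve,
  and \<open>K\<close> is closed for \<open>nrm\<close>.\<close>

lemma average_in:
  assumes t: "t > 0"
  shows "average t \<in> K"
proof (rule K_nrm_closed)
  fix e :: real assume e: "e > 0"
  define \<delta> where "\<delta> = e / (M + 1)"
  have \<delta>: "\<delta> > 0" using e u.M_nonneg by (simp add: \<delta>_def)
  have "gauge (\<lambda>x::real. ball x \<delta>)"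
    using gauge_ball_dependent[of "\<lambda>_. \<delta>"] \<delta> by blast
  then obtain p where p: "p tagged_division_of {0..t}" "(\<lambda>x. ball x \<delta>) fine p"
    using fine_division_exists_real by blast
  define \<nu> where "\<nu> = (\<Sum>q\<in>p. (measure lborel (snd q) / t) *\<^sub>R u (fst q))"
  have "\<nu> \<in> K"
    unfolding \<nu>_def
  proof (rule convex_sum[OF tagged_division_of_finite[OF p(1)] K_convex])
    have "(\<Sum>q\<in>p. measure lborel (snd q)) = t"
      using additive_content_tagged_division[of p 0 t] p(1) t by (simp add: case_prod_unfold)
    then show "(\<Sum>q\<in>p. measure lborel (snd q) / t) = 1"
      using t by (simp flip: sum_divide_distrib)
    show "u (fst q) \<in> K" if "q \<in> p" for q
    proof (rule u.u_in)
      show "0 \<le> fst q"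
        using tagged_division_ofD(2,3)[OF p(1), of "fst q" "snd q"] that by (auto simp: subset_eq)
    qed
  qed (use t in auto)
  moreover have "nrm (\<nu> - average t) < e"
  proof -
    have eq: "\<nu> - average t = (1 / t) *\<^sub>R ((\<Sum>(s, k)\<in>p. measure lborel k *\<^sub>R u s) - weak_integral u t)"
      by (simp add: \<nu>_def average_def scaleR_right_diff_distrib scaleR_sum_right case_prod_unfold)
    have "nrm (\<nu> - average t) = (1 / t) * nrm ((\<Sum>(s, k)\<in>p. measure lborel k *\<^sub>R u s) - weak_integral u t)"
      unfolding eq nrm_scale using t by simp
    also have "\<dots> \<le> (1 / t) * (M * \<delta> * t)"
      by (rule mult_left_mono[OF riemann_sum_weak_integral[OF less_imp_le[OF t] p \<delta>]]) (use t in simp)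
    also have "\<dots> = M * \<delta>" using t by simp
    also have "\<dots> < e" using e u.M_nonneg by (simp add: \<delta>_def field_simps)
    finally show ?thesis .
  qed
  ultimately show "\<exists>\<nu>\<in>K. nrm (\<nu> - average t) < e" by blast
qed

lemma primitive_derivative:
  assumes "0 \<le> t" "t \<le> b"
  shows "((\<lambda>t. BH (weak_integral u t) g) has_real_derivative BH (u t) g) (at t within {0..b})"
proof -
  have "continuous_on {0..b} (\<lambda>s. BH (u s) g)"
    unfolding apply_J[symmetric] by (rule continuous_on_subset[OF continuous_on_eval]) auto
  then have "((\<lambda>t. integral {0..t} (\<lambda>s. BH (u s) g)) has_real_derivative BH (u t) g) (at t within {0..b})"
    using assms by (intro integral_has_real_derivative) auto
  then show ?thesis
    by (rule has_field_derivative_transform_within[where d = 1]) (use assms BH_weak_integral in auto)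
qed

text \<open>\<open>u_energy\<close> and the derivative of the integral make the right Dini
  derivative of \<open>(nrm (u s - z))\<^sup>2 / 2 - s * BH z y + BH (weak_integral u s) y\<close>
  nonpositive; at the end the square at time \<open>t\<close> is dropped.\<close>

lemma energy_integral:
  assumes A: "(z, y) \<in> A" and t: "t \<ge> 0"
  shows "- (nrm (u 0 - z))\<^sup>2 / 2 \<le> t * BH z y - BH (weak_integral u t) y"
proof -
  define f where "f s = (nrm (u s - z))\<^sup>2 / 2 - s * BH z y + BH (weak_integral u s) y" for s
  have "f t \<le> f 0"
  proof (rule right_dini_nonincreasing[OF t])
    have "continuous_on {0..t} (\<lambda>s. nrm (u s - z))"
    proof (rule lipschitz_on_continuous_on[of M], rule lipschitz_onI)
      fix a b assume ab: "a \<in> {0..t}" "b \<in> {0..t}"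
      have "\<bar>nrm (u a - z) - nrm (u b - z)\<bar> \<le> nrm (u a - u b)"
        using nrm_diff_le[of "u a - z" "u b - z"] by simp
      also have "\<dots> \<le> M * \<bar>a - b\<bar>"
        using ab by (intro u_lipschitz) auto
      finally show "dist (nrm (u a - z)) (nrm (u b - z)) \<le> M * dist a b"
        by (simp add: dist_real_def)
    qed (rule u.M_nonneg)
    moreover have "continuous_on {0..t} (\<lambda>s. BH (weak_integral u s) y)"
      by (rule DERIV_continuous_on[where D = "\<lambda>s. BH (u s) y"]) (auto intro: primitive_derivative)
    ultimately show "continuous_on {0..t} f"
      unfolding f_def by (intro continuous_intros) auto
  next
    fix s e :: real assume s: "0 \<le> s" "s < t" and e: "e > 0"
    let ?F = "\<lambda>s. BH (weak_integral u s) y"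
    have "(?F has_derivative (\<lambda>x. x * BH (u s) y)) (at s within {0..t})"
      using primitive_derivative[of s t y] s by (simp add: has_field_derivative_def mult_commute_abs)
    then obtain d1 where d1: "d1 > 0" "\<And>r. r \<in> {0..t} \<Longrightarrow> \<bar>r - s\<bar> < d1 \<Longrightarrow>
        \<bar>?F r - ?F s - (r - s) * BH (u s) y\<bar> \<le> (e / 2) * \<bar>r - s\<bar>"
      using e half_gt_zero[OF e] unfolding has_derivative_within_alt real_norm_def by blast
    \<comment> \<open>The bound \<open>t - s\<close> keeps the step inside the interval; the last
      one keeps the quadratic error \<open>h * (nrm y * (M * h))\<close> at most
      \<open>(e / 2) * h\<close>.\<close>
    define d where "d = min (min d1 (t - s)) (e / (2 * (nrm y * M + 1)))"
    have nM: "nrm y * M \<ge> 0" using u.M_nonneg by simp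
    have "d > 0" using d1 s e nM by (simp add: d_def)
    moreover have "f (s + h) \<le> f s + e * h" if h: "0 < h" "h < d" for h
    proof -
      have "(nrm (u (s + h) - z))\<^sup>2 / 2 - (nrm (u s - z))\<^sup>2 / 2 \<le> h * (BH y (z - u s) + nrm y * (M * h))"
        using u.u_energy[OF A, of s "s + h"] s h by simp
      moreover have "BH y (z - u s) = BH z y - BH (u s) y"
        by (simp add: B_diff2 B_commute[of y])
      moreover have "?F (s + h) - ?F s \<le> h * BH (u s) y + (e / 2) * h"
      proof -
        have "\<bar>?F (s + h) - ?F s - (s + h - s) * BH (u s) y\<bar> \<le> (e / 2) * \<bar>s + h - s\<bar>"
          using s h by (intro d1(2)) (auto simp: d_def)
        then show ?thesis
          using h(1) unfolding abs_le_iff by simp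
      qed
      moreover have "h * (nrm y * (M * h)) \<le> (e / 2) * h"
      proof -
        have "h * (nrm y * M + 1) \<le> e / 2"
          using h nM by (simp add: d_def field_simps)
        then have "h * (nrm y * M) \<le> e / 2"
          using h by (simp add: distrib_left)
        then have "h * (h * (nrm y * M)) \<le> h * (e / 2)"
          using h by (intro mult_left_mono) auto
        then show ?thesis by (simp add: mult_ac)
      qed
      ultimately show ?thesis
        by (simp add: f_def algebra_simps)
    qed
    ultimately show "\<exists>d>0. \<forall>h. 0 < h \<and> h < d \<longrightarrow> f (s + h) \<le> f s + e * h" by blast
  qed
  moreover have "BH (weak_integral u 0) y = 0"
    by (simp add: BH_weak_integral)
  moreover have "0 \<le> (nrm (u t - z))\<^sup>2" by simp
  ultimately show ?thesis
    unfolding f_def by linarith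
qed

section \<open>Cluster points of the averages\<close>

definition is_cluster :: "('a \<Rightarrow>\<^sub>L real) \<Rightarrow> bool" where
  "is_cluster p \<longleftrightarrow> p \<in> K \<and> (\<forall>N e. e > 0 \<longrightarrow> (\<exists>t\<ge>N. t > 0 \<and> nrm (average t - p) < e))"

text \<open>\<open>energy_integral\<close> divided by \<open>t\<close> gives
  \<open>0 \<le> BH (z - p) y\<close> in the limit. The choice \<open>z = R 1 p\<close> and
  \<open>y = p - z\<close> turns this into \<open>y = 0\<close>, so that \<open>p\<close> is its own
  resolvent.\<close>

lemma cluster_equilibrium:
  assumes p: "is_cluster p"
  shows "(p, 0) \<in> A"
proof -
  have pK: "p \<in> K" using p by (simp add: is_cluster_def)
  define z where "z = R 1 p"
  define y where "y = Y 1 p"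
  have zy: "(z, y) \<in> A" unfolding z_def y_def by (rule Y_A) (use pK in auto)
  have y: "y = p - z" by (simp add: y_def z_def Y_def)
  define c where "c = (nrm (u 0 - z))\<^sup>2 / 2"
  have "- BH y y \<ge> 0 - e" if e: "e > 0" for e
  proof -
    define d where "d = e / (2 * (nrm y + 1))"
    have d: "d > 0" using e by (simp add: d_def add_nonneg_pos)
    obtain t where t: "t \<ge> 2 * c / e" "t > 0" "nrm (average t - p) < d"
      using p d unfolding is_cluster_def by blast
    have "- c \<le> t * BH z y - BH (weak_integral u t) y"
      using energy_integral[OF zy, of t] t by (simp add: c_def)
    also have "BH (weak_integral u t) y = t * BH (average t) y"
      using t(2) by (simp add: average_def B_scale)
    finally have "- c \<le> t * (BH z y - BH (average t) y)"
      by (simp add: right_diff_distrib)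
    then have "- c / t \<le> BH z y - BH (average t) y"
      using t(2) by (simp add: field_simps)
    moreover have "c / t \<le> e / 2"
      using t e by (simp add: field_simps)
    moreover have "BH z y - BH (average t) y = - BH y y - BH (average t - p) y"
      unfolding y by (simp only: bilin)
    moreover have "\<bar>BH (average t - p) y\<bar> \<le> e / 2"
    proof -
      have "\<bar>BH (average t - p) y\<bar> \<le> nrm (average t - p) * nrm y" by (rule abs_B_le)
      also have "\<dots> \<le> d * nrm y" using t(3) by (intro mult_right_mono) auto
      also have "\<dots> = e / 2 * (nrm y / (nrm y + 1))" by (simp add: d_def)
      also have "\<dots> \<le> e / 2 * 1"
        using e by (intro mult_left_mono) (auto simp: divide_le_eq_1 add_nonneg_pos)
      also have "\<dots> = e / 2" by simp
      finally show ?thesis .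
    qed
    ultimately show ?thesis by (simp add: abs_le_iff)
  qed
  then have "BH y y \<le> 0 + e" if "e > 0" for e
    using that by force
  then have "BH y y \<le> 0" by (rule field_le_epsilon)
  then have "y = 0"
    using B_nonneg[of y] by (intro B_definite antisym)
  then show ?thesis
    using zy y by simp
qed

lemma distance_converges:
  assumes p: "(p, 0) \<in> A"
  shows "\<exists>l. ((\<lambda>t. nrm (u t - p)) \<longlongrightarrow> l) at_top"
proof -
  define f where "f t = nrm (u t - p)" for t
  have mono: "f t \<le> f s" if "0 \<le> s" "s \<le> t" for s t
    using u.u_contract[OF p that] by (simp add: f_def)
  define l where "l = (INF t\<in>{0..}. f t)"
  have bdd: "bdd_below (f ` {0..})" by (rule bdd_belowI2[where m = 0]) (simp add: f_def)
  have "(f \<longlongrightarrow> l) at_top"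
  proof (rule tendstoI)
    fix e :: real assume e: "e > 0"
    obtain t0 where t0: "t0 \<ge> 0" "f t0 < l + e"
      using cINF_less_iff[of "{0..}" f "l + e"] bdd e by (auto simp: l_def)
    have "dist (f t) l < e" if "t \<ge> t0" for t
    proof -
      have "l \<le> f t" unfolding l_def using bdd that t0 by (intro cINF_lower) auto
      then show ?thesis using mono[OF t0(1) that] t0 by (simp add: dist_real_def)
    qed
    then show "\<forall>\<^sub>F t in at_top. dist (f t) l < e"
      by (auto simp: eventually_at_top_linorder)
  qed
  then show ?thesis by (auto simp: f_def[abs_def])
qed

text \<open>Opial's argument: \<open>BH (u t) (p - q)\<close> is an affine expression in the squared
  distances to the zeros \<open>p\<close> and \<open>q\<close>, which converge; hence so do its
  averages, and \<open>p\<close> and \<open>q\<close> have the same pairing with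
  \<open>p - q\<close>.\<close>

lemma cluster_unique:
  assumes p: "is_cluster p" and q: "is_cluster q"
  shows "p = q"
proof -
  let ?g = "p - q"
  obtain l1 where l1: "((\<lambda>t. nrm (u t - p)) \<longlongrightarrow> l1) at_top"
    using distance_converges[OF cluster_equilibrium[OF p]] by blast
  obtain l2 where l2: "((\<lambda>t. nrm (u t - q)) \<longlongrightarrow> l2) at_top"
    using distance_converges[OF cluster_equilibrium[OF q]] by blast
  have eq: "BH (u t) ?g = ((nrm (u t - q))\<^sup>2 - (nrm (u t - p))\<^sup>2 + (nrm p)\<^sup>2 - (nrm q)\<^sup>2) / 2" for t
    unfolding nrm_sq using B_commute[of "u t" p] B_commute[of "u t" q] by (simp only: bilin) simp
  define l where "l = (l2\<^sup>2 - l1\<^sup>2 + (nrm p)\<^sup>2 - (nrm q)\<^sup>2) / 2"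
  have lim: "((\<lambda>t. BH (u t) ?g) \<longlongrightarrow> l) at_top"
    unfolding eq l_def by (intro tendsto_intros l1 l2) simp
  have "((\<lambda>t. BH (weak_integral u t) ?g / t) \<longlongrightarrow> l) at_top"
  \<comment> \<open>L'Hospital's rule serves as the Cesaro theorem: the derivative of the integral
    converges.\<close>
  proof (rule lhospital_at_top_at_top[where f' = "\<lambda>t. BH (u t) ?g" and g' = "\<lambda>_. 1"])
    show "LIM t at_top. t :> at_top" by (rule filterlim_ident)
    show "\<forall>\<^sub>F t in at_top. ((\<lambda>t. BH (weak_integral u t) ?g) has_real_derivative BH (u t) ?g) (at t)"
    proof (rule eventually_mono[OF eventually_gt_at_top[of 0]])
      fix t :: real assume t: "t > 0"
      have "t \<in> interior {0..t + 1}" using t by simp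
      then show "((\<lambda>t. BH (weak_integral u t) ?g) has_real_derivative BH (u t) ?g) (at t)"
        using primitive_derivative[of t "t + 1" ?g] t at_within_interior[of t "{0..t + 1}"] by simp
    qed
  qed (use lim in \<open>auto intro!: always_eventually derivative_eq_intros\<close>)
  then have avg: "((\<lambda>t. BH (average t) ?g) \<longlongrightarrow> l) at_top"
    by (simp add: average_def B_scale)
  have "BH r ?g = l" if r: "is_cluster r" for r
  proof (rule ccontr)
    assume ne: "BH r ?g \<noteq> l"
    define e where "e = \<bar>BH r ?g - l\<bar> / 2"
    have e: "e > 0" using ne by (simp add: e_def)
    obtain N where N: "\<And>t. t \<ge> N \<Longrightarrow> \<bar>BH (average t) ?g - l\<bar> < e"
      using tendstoD[OF avg e] by (auto simp: eventually_at_top_linorder dist_real_def)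
    have "e / (nrm ?g + 1) > 0"
      using e by (simp add: add_nonneg_pos)
    then obtain t where t: "t \<ge> N" "nrm (average t - r) < e / (nrm ?g + 1)"
      using r unfolding is_cluster_def by blast
    have "\<bar>BH (average t) ?g - BH r ?g\<bar> \<le> nrm (average t - r) * nrm ?g"
      using abs_B_le[of "average t - r" ?g] by (simp only: B_diff[of "average t" r])
    also have "\<dots> \<le> e / (nrm ?g + 1) * nrm ?g"
      using t(2) by (intro mult_right_mono) auto
    also have "\<dots> < e"
    proof -
      have "nrm ?g / (nrm ?g + 1) < 1" by (simp add: add_nonneg_pos)
      then have "e * (nrm ?g / (nrm ?g + 1)) < e * 1" using e by (intro mult_strict_left_mono)
      then show ?thesis by simp
    qed
    finally have "\<bar>BH r ?g - l\<bar> < 2 * e"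
      using N[OF t(1)] by linarith
    then show False by (simp add: e_def)
  qed
  from this[OF p] this[OF q] have "BH ?g ?g = 0"
    by (simp only: B_diff[of p q])
  then show ?thesis
    using B_definite[of ?g] by simp
qed

lemma average_converges: "\<exists>p. (p, 0) \<in> A \<and> p \<in> K \<and> ((\<lambda>t. nrm (average t - p)) \<longlongrightarrow> 0) at_top"
proof -
  obtain p where p: "p \<in> K" "\<And>N e. e > 0 \<Longrightarrow> \<exists>t\<ge>N. t > 0 \<and> nrm (average t - p) < e"
  proof -
    have "\<exists>t\<ge>N. t > 0" for N :: real
      by (rule exI[of _ "max N 1"]) auto
    then show ?thesis
      using K_cluster[of "\<lambda>t. t > 0" average] average_in that by blast
  qed
  then have pc: "is_cluster p" by (simp add: is_cluster_def)
  have "((\<lambda>t. nrm (average t - p)) \<longlongrightarrow> 0) at_top"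
  proof (rule ccontr)
    assume "\<not> ?thesis"
    then obtain e where e: "e > 0" "\<not> (\<forall>\<^sub>F t in at_top. nrm (average t - p) < e)"
      by (auto simp: tendsto_iff dist_real_def)
    have "\<exists>t\<ge>N. t > 0 \<and> nrm (average t - p) \<ge> e" for N
    proof -
      have "\<not> (\<forall>t\<ge>max N 1. nrm (average t - p) < e)"
        using e(2) unfolding eventually_at_top_linorder by blast
      then obtain t where "t \<ge> N" "t \<ge> 1" "e \<le> nrm (average t - p)"
        by (auto simp: not_less)
      then show ?thesis by (intro exI[of _ t]) auto
    qed
    \<comment> \<open>A cluster point along the bad times is also one along all times, hence equal
      to \<open>p\<close>, which the bad times avoid.\<close>
    then obtain q where q: "q \<in> K" "\<And>N d. d > 0 \<Longrightarrow> \<exists>t\<ge>N. (t > 0 \<and> nrm (average t - p) \<ge> e) \<and> nrm (average t - q) < d"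
      using K_cluster[of "\<lambda>t. t > 0 \<and> nrm (average t - p) \<ge> e" average] average_in by blast
    then have "is_cluster q" unfolding is_cluster_def by blast
    then have "q = p" using cluster_unique pc by blast
    then show False using q(2)[OF e(1), of 0] by auto
  qed
  then show ?thesis
    using cluster_equilibrium[OF pc] p(1) by blast
qed

lemma average_weak_star_limit:
  "\<exists>\<mu>. is_equilibrium K G \<mu> \<and> limitin weak_star_topology (\<lambda>t. (1 / t) *\<^sub>R weak_integral u t) \<mu> at_top"
proof -
  obtain p where p: "(p, 0) \<in> A" "p \<in> K" "((\<lambda>t. nrm (average t - p)) \<longlongrightarrow> 0) at_top"
    using average_converges by blast
  have "is_equilibrium K G p"
    using p(1) by (auto simp: is_equilibrium_def A_iff)
  moreover have "limitin T average p at_top"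
    by (rule limitin_T[OF p(3) _ p(2)]) (rule eventually_mono[OF eventually_gt_at_top[of 0]], rule average_in)
  then have "limitin weak_star_topology average p at_top"
    by (simp add: limitin_subtopology)
  ultimately show ?thesis
    by (auto simp: average_def[abs_def])
qed

end

end

theorem theorem4p8:
  fixes \<eta> :: "'a::{banach, second_countable_topology} measure"
    and K :: "('a \<Rightarrow>\<^sub>L real) set"
    and G :: "('a \<Rightarrow>\<^sub>L real) \<Rightarrow> ('a \<Rightarrow>\<^sub>L real) \<Rightarrow> real"
    and \<mu>0 :: "'a \<Rightarrow>\<^sub>L real"
  assumes "centered_nondegenerate_gaussian \<eta>"
    and "K \<noteq> {}" and "convex K" and "compactin weak_star_topology K"
    and "continuous_map
           (prod_topology (subtopology weak_star_topology K) (subtopology weak_star_topology K))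
           euclideanreal (\<lambda>(\<mu>, \<nu>). G \<mu> \<nu>)"
    and "\<forall>\<mu>\<in>K. convex_on K (G \<mu>)"
    and "monotone_game K G"
    and "\<mu>0 \<in> flow_domain \<eta> K G"
  shows "\<exists>\<zeta>. is_flow_solution \<eta> K G \<mu>0 \<zeta> \<and>
           (\<forall>\<zeta>'. is_flow_solution \<eta> K G \<mu>0 \<zeta>' \<longrightarrow> (\<forall>t\<ge>0. \<zeta>' t = \<zeta> t)) \<and>
           H_lipschitz \<eta> (\<lambda>t. blinfun_apply (\<zeta> t)) \<and>
           (\<exists>I \<mu>. (\<forall>t>0. has_H_integral \<eta> (\<lambda>s. blinfun_apply (\<zeta> s)) (blinfun_apply (I t)) 0 t) \<and>
              is_equilibrium K G \<mu> \<and>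
              limitin weak_star_topology (\<lambda>t. (1 / t) *\<^sub>R I t) \<mu> at_top)"
proof -
  interpret game \<eta> K G
    by unfold_locales (rule assms)+
  obtain u M where ev: "evolution (\<lambda>\<mu> \<nu>. H_inner \<eta> (blinfun_apply \<mu>) (blinfun_apply \<nu>)) K A R u M" and u0: "u 0 = \<mu>0"
    using evolution_exists[OF assms(8)] by blast
  have sol: "is_flow_solution \<eta> K G \<mu>0 u"
    using evolution_is_flow_solution[OF ev] u0 by simp
  have "H_lipschitz \<eta> (\<lambda>t. blinfun_apply (u t))"
    unfolding H_lipschitz_def H_norm_functional_diff using u_lipschitz[OF ev] by blast
  moreover obtain \<mu> where "is_equilibrium K G \<mu>" "limitin weak_star_topology (\<lambda>t. (1 / t) *\<^sub>R weak_integral u t) \<mu> at_top"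
    using average_weak_star_limit[OF ev] by blast
  moreover have "\<forall>t>0. has_H_integral \<eta> (\<lambda>s. blinfun_apply (u s)) (blinfun_apply (weak_integral u t)) 0 t"
    using has_H_integral_weak_integral[OF ev] by simp
  moreover have "\<forall>\<zeta>'. is_flow_solution \<eta> K G \<mu>0 \<zeta>' \<longrightarrow> (\<forall>t\<ge>0. \<zeta>' t = u t)"
    using flow_unique[OF sol] by simp
  ultimately show ?thesis
    using sol by (intro exI[of _ u] conjI exI[of _ "weak_integral u"] exI[of _ \<mu>])
qed

end
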